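(* Let $a$ be a real number with $a<1/2$ and let $F\in\widetilde{\mathcal S}$ be such that $a\notin Z(F)$. Then all non-trivial zeros of $F$ lie on the line $\mathrm{Re}(s)=1/2$ if and only if $\mathrm{Re}(\lambda_F(n,a))\ge 0$ for all $n\in\mathbb N=\{1,2,\dots\}$.
   Context: **Selberg class.** $\mathcal S$ is the set of Dirichlet series $F(s)=\sum_{n\ge1}a(n)n^{-s}$, $\mathrm{Re}(s)>1$, such that: (1) there is an integer $m\ge0$ such that $(s-1)^mF(s)$ is an entire function of finite order; $m_F$ denotes the smallest such $m$; (2) there are positive reals $Q_F,\lambda_1,\dots,\lambda_r$ and complex numbers $\mu_1,\dots,\mu_r,\omega$ with $\mathrm{Re}(\mu_j)\ge0$ and $|\omega|=1$ such that $\phi_F(s)=F(s)Q_F^s\prod_{j=1}^r\Gamma(\lambda_js+\mu_j)$ satisfies $\phi_F(s)=\omega\overline{\phi_F(1-\overline s)}$; (3) $a(n)=O(n^{\epsilon})$ for every $\epsilon>0$; (4) $F(s)=\prod_p\exp\left(\sum_{k\ge1}b(p^k)p^{-ks}\right)$ with $b(p^k)=O(p^{k\theta})$ for some $\theta<1/2$. Set $b(n)=0$ if $n$ is not a prime power $p^k$, $k\geq 1$. Put $\Lambda_F(n)=b(n)\log n$, so that $-\frac{F'}{F}(s)=\sum_{n\ge1}\Lambda_F(n)n^{-s}$ for $\mathrm{Re}(s)>1$, and $\psi_F(x)=\sum_{n\le x}\Lambda_F(n)$. **The class $\widetilde{\mathcal S}$.** $\widetilde{\mathcal S}$ is the set of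 all $F\in\mathcal S$ that do not vanish on the line $\mathrm{Re}(s)=1$ and such that, for every positive integer $l$, $\psi_F(x)=m_Fx+o\left(x/\log^l x\right)$ as $x\to\infty$. **Zeros and coefficients.** Let $\xi_F(s)=s^{m_F}(s-1)^{m_F}\phi_F(s)$, an entire function of order 1. The non-trivial zeros of $F$ are the zeros of $\xi_F$; they lie in $0\le\mathrm{Re}(s)\le1$. $Z(F)$ is the multiset of these zeros, counted with multiplicity. The modified Li coefficients are $$\lambda_F(n,a)=\sum_{\rho\in Z(F)}\left[1-\left(\frac{\rho-a}{\rho+a-1}\right)^n\right],$$ where $\sum_\rho$ means $\lim_{T\to\infty}\sum_{|\mathrm{Im}\,\rho|\le T}$. *)

theory Defs
  imports
    "HOL-Complex_Analysis.Complex_Analysis"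
    "HOL-Library.Landau_Symbols"
    "HOL-Number_Theory.Prime_Powers"
begin

text \<open>
  An element of the Selberg class is represented by its meromorphic continuation
  \<open>F :: complex \<Rightarrow> complex\<close>.  It is required to be nicely meromorphic (value \<open>0\<close> at poles,
  continuous elsewhere), which determines the value at \<open>s = 1\<close>.
\<close>

definition entire_of_finite_order :: "(complex \<Rightarrow> complex) \<Rightarrow> bool" where
  "entire_of_finite_order g \<longleftrightarrow> g holomorphic_on UNIV \<and>
     (\<exists>A::real. (\<lambda>z. norm (g z)) \<in> O[at_infinity](\<lambda>z. exp (norm z powr A)))"

text \<open>\<open>(s - 1)\<^sup>m F(s)\<close> extends over \<open>s = 1\<close> to an entire function of finite order.\<close>

definition clears_pole :: "(complex \<Rightarrow> complex) \<Rightarrow> nat \<Rightarrow> bool" where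
  "clears_pole F m \<longleftrightarrow>
     (\<exists>g. entire_of_finite_order g \<and> (\<forall>s. s \<noteq> 1 \<longrightarrow> g s = (s - 1) ^ m * F s))"

definition pole_order_at_1 :: "(complex \<Rightarrow> complex) \<Rightarrow> nat" where
  "pole_order_at_1 F = (LEAST m. clears_pole F m)"

text \<open>
  The list \<open>gs\<close> holds the pairs \<open>(\<lambda>\<^sub>j, \<mu>\<^sub>j)\<close>; it may be empty.  Applying \<^const>\<open>remove_sings\<close> gives
  the product its limit where a zero of \<open>F\<close> cancels a pole of a Gamma factor, and the value \<open>0\<close>
  at genuine poles.
\<close>

definition completed :: "(complex \<Rightarrow> complex) \<Rightarrow> real \<Rightarrow> (real \<times> complex) list \<Rightarrow> complex \<Rightarrow> complex" where
  "completed F Q gs =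
     remove_sings (\<lambda>s. F s * of_real Q powr s * (\<Prod>(l, \<mu>)\<leftarrow>gs. Gamma (of_real l * s + \<mu>)))"

text \<open>
  With the above convention the functional equation can be required at every \<open>s\<close>: a pole
  at \<open>s\<close> is matched by a pole at \<open>1 - cnj s\<close>, where both sides are \<open>0\<close>.
\<close>

definition functional_equation ::
    "(complex \<Rightarrow> complex) \<Rightarrow> real \<Rightarrow> (real \<times> complex) list \<Rightarrow> complex \<Rightarrow> bool" where
  "functional_equation F Q gs \<omega> \<longleftrightarrow>
     Q > 0 \<and> (\<forall>(l, \<mu>) \<in> set gs. l > 0 \<and> Re \<mu> \<ge> 0) \<and> norm \<omega> = 1 \<and>
     (\<forall>s. completed F Q gs s = \<omega> * cnj (completed F Q gs (1 - cnj s)))"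

definition dirichlet_coeffs :: "(complex \<Rightarrow> complex) \<Rightarrow> (nat \<Rightarrow> complex) \<Rightarrow> bool" where
  "dirichlet_coeffs F a \<longleftrightarrow>
     (\<forall>s. Re s > 1 \<longrightarrow> (\<lambda>n. a (Suc n) / of_nat (Suc n) powr s) sums F s)"

definition euler_coeffs :: "(complex \<Rightarrow> complex) \<Rightarrow> (nat \<Rightarrow> complex) \<Rightarrow> bool" where
  "euler_coeffs F b \<longleftrightarrow>
     (\<forall>n. \<not> primepow n \<longrightarrow> b n = 0) \<and>
     (\<exists>\<theta><1/2. (\<lambda>n. norm (b n)) \<in> O(\<lambda>n. real n powr \<theta>)) \<and>
     (\<forall>s. Re s > 1 \<longrightarrow>
        (\<lambda>p. if prime p then exp (\<Sum>k. b (p ^ Suc k) / of_nat (p ^ Suc k) powr s) else 1)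
          has_prod F s)"

definition selberg_class :: "(complex \<Rightarrow> complex) set" where
  "selberg_class = {F. F nicely_meromorphic_on UNIV \<and>
     (\<exists>m. clears_pole F m) \<and>
     (\<exists>Q gs \<omega>. functional_equation F Q gs \<omega>) \<and>
     (\<exists>a. dirichlet_coeffs F a \<and>
        (\<forall>\<epsilon>>0. (\<lambda>n. norm (a n)) \<in> O(\<lambda>n. real n powr \<epsilon>))) \<and>
     (\<exists>b. euler_coeffs F b)}"

definition psi_sum :: "(nat \<Rightarrow> complex) \<Rightarrow> real \<Rightarrow> complex" where
  "psi_sum b x = (\<Sum>n | 1 \<le> n \<and> real n \<le> x. b n * of_real (ln (real n)))"

text \<open>The \<open>b\<close> below is unique: \<open>F\<close> determines its Euler coefficients.\<close>

definition selberg_class_tilde :: "(complex \<Rightarrow> complex) set" where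
  "selberg_class_tilde = {F \<in> selberg_class.
     (\<forall>s. Re s = 1 \<and> \<not> is_pole F s \<longrightarrow> F s \<noteq> 0) \<and>
     (\<exists>b. euler_coeffs F b \<and>
        (\<forall>l\<ge>1::nat. (\<lambda>x::real. norm (psi_sum b x - of_nat (pole_order_at_1 F) * of_real x))
                      \<in> o(\<lambda>x. x / ln x ^ l)))}"

definition xi_fun :: "(complex \<Rightarrow> complex) \<Rightarrow> real \<Rightarrow> (real \<times> complex) list \<Rightarrow> complex \<Rightarrow> complex" where
  "xi_fun F Q gs =
     remove_sings (\<lambda>s. s ^ pole_order_at_1 F * (s - 1) ^ pole_order_at_1 F * completed F Q gs s)"

text \<open>
  The multiset of non-trivial zeros is given by its support together with the multiplicities
  \<open>zorder (xi_fun F Q gs) \<rho>\<close>.  The gamma factors of \<open>F\<close> are not unique, but \<^const>\<open>completed\<close> is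
  unique up to a constant factor, so neither depends on \<open>Q\<close> and \<open>gs\<close>.
\<close>

definition nontrivial_zeros ::
    "(complex \<Rightarrow> complex) \<Rightarrow> real \<Rightarrow> (real \<times> complex) list \<Rightarrow> complex set" where
  "nontrivial_zeros F Q gs = {\<rho>. xi_fun F Q gs \<rho> = 0}"

definition li_coeff ::
    "(complex \<Rightarrow> complex) \<Rightarrow> real \<Rightarrow> (real \<times> complex) list \<Rightarrow> nat \<Rightarrow> real \<Rightarrow> complex" where
  "li_coeff F Q gs n a =
     Lim at_top (\<lambda>T::real. \<Sum>\<rho> | \<rho> \<in> nontrivial_zeros F Q gs \<and> \<bar>Im \<rho>\<bar> \<le> T.
       of_int (zorder (xi_fun F Q gs) \<rho>) *
       (1 - ((\<rho> - of_real a) / (\<rho> + of_real a - 1)) ^ n))"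

end

theory Submission
  imports Defs "HOL-Real_Asymp.Real_Asymp"
begin

text \<open>
  Put \<open>w = (\<rho> - a) / (\<rho> + a - 1)\<close>.  As \<open>a < 1/2\<close>, \<open>\<bar>w\<bar> \<le> 1\<close> means \<open>Re \<rho> \<le> 1/2\<close>, and the symmetry
  \<open>\<rho> \<mapsto> 1 - cnj \<rho>\<close> replaces \<open>w\<close> by \<open>1 / cnj w\<close>; so all zeros are on the critical line iff no \<open>\<bar>w\<bar>\<close>
  exceeds \<open>1\<close>.  In that case every \<open>1 - w\<^sup>n\<close> has nonnegative real part.  Otherwise, since \<open>w \<rightarrow> 1\<close>
  along the zeros, \<open>\<bar>w\<bar>\<close> has a maximum \<open>M > 1\<close> attained finitely often, and Dirichlet's approximation
  theorem yields \<open>n\<close> for which these dominant terms make the real part of the sum negative.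

  The delicate point is that the limit defining the Li coefficients exists, because the zeros
  need not be symmetric under conjugation: one has to show that the sum of \<open>Im \<rho> / \<bar>\<rho> - 2\<bar>\<^sup>2\<close> over
  \<open>\<bar>Im \<rho>\<bar> \<le> T\<close> converges.  The Hadamard expansion of \<open>\<xi>'/\<xi>\<close> on the line \<open>Re s = 2\<close> gives, with the sum
  over \<open>\<bar>Im \<rho>\<bar> \<le> X\<close>,
  \<open>\<integral>\<^sub>1\<^sup>X Re (\<xi>'/\<xi> (2 + \<i>t) - \<xi>'/\<xi> (2 - \<i>t)) dt/t = \<pi> \<Sum> Im \<rho> / \<bar>\<rho> - 2\<bar>\<^sup>2 + o(1) + const\<close>, the error being controlled
  by the local density of zeros, which follows from \<open>Re \<xi>'/\<xi> (2 + \<i>t) = O(log t)\<close>.  The integral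
  converges: the Gamma factors contribute \<open>O(1/t\<^sup>2)\<close> to the integrand, and \<open>F'/F\<close> is the derivative of
  a bounded function.  The growth \<open>exp (O(\<bar>s\<bar>\<^bsup>5/4\<^esup>))\<close> of \<open>\<xi>\<close> needed for the expansion comes from the Euler
  product, the functional equation and the Phragmen-Lindelof principle.
\<close>

section \<open>Zeros of entire functions of finite order\<close>

text \<open>The conditionally convergent part of the Li sums is the same for all \<open>n\<close>
  and \<open>a\<close> up to a factor: beyond a multiple of 1/(\<rho> - 2), every term 1 - w^n is
  O(1/|\<rho> - 2|^2), and so is Re 1/(\<rho> - 2). Only Im 1/(\<rho> - 2) = - Im \<rho> / |\<rho> -
  2|^2 remains, which need not be absolutely summable. The centre 2 lies in the half-plane of the
  Euler product and at distance at least 1 from all zeros. The exponents are matched to each other.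
  The growth exponent 5/4 comes from n! <= n^n and ln n = O(n^(1/4)). Being below 3/2, it makes the
  sum of |\<rho> - 2|^(-3/2) finite, and the spare half power over |\<rho> - 2|^(-2) is traded for
  decay in X. Being below 2, it makes the error R^(5/4 - 2) |s - 2| of the expansion over the zeros
  in a disc of radius R vanish as R grows, so that finite sums replace the Hadamard product
  throughout.\<close>

lemma entire_divide_zero:
  assumes hol: "f holomorphic_on UNIV" and nz: "f z1 \<noteq> 0"
  obtains g where "g holomorphic_on UNIV" "\<And>z. f z = g z * (z - \<rho>) ^ nat (zorder f \<rho>)" "g \<rho> \<noteq> 0"
proof -
  define n where "n = nat (zorder f \<rho>)"
  obtain r where r: "r > 0" "zor_poly f \<rho> holomorphic_on cball \<rho> r"
    and eq: "\<And>w. w \<in> cball \<rho> r \<Longrightarrow> f w = zor_poly f \<rho> w * (w - \<rho>) ^ n \<and> zor_poly f \<rho> w \<noteq> 0"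
    using zorder_exist_zero[OF hol open_UNIV connected_UNIV UNIV_I, of \<rho>] nz unfolding n_def by blast
  \<comment> \<open>At \<rho> the value comes from \<open>zor_poly\<close>, elsewhere from the
    quotient; the two agree on a ball, and holomorphy is glued from two overlapping open sets. If f
    \<rho> is nonzero, the order is 0 and nothing is divided out.\<close>
  define g where "g z = (if z = \<rho> then zor_poly f \<rho> \<rho> else f z / (z - \<rho>) ^ n)" for z
  have g1: "g z = zor_poly f \<rho> z" if "z \<in> ball \<rho> r" for z
    using eq[of z] that by (auto simp: g_def)
  have "g holomorphic_on ball \<rho> r"
    using holomorphic_on_subset[OF r(2) ball_subset_cball] g1 by (metis holomorphic_transform)
  moreover have "(\<lambda>z. f z / (z - \<rho>) ^ n) holomorphic_on UNIV - {\<rho>}"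
    by (intro holomorphic_intros holomorphic_on_subset[OF hol]) auto
  hence "g holomorphic_on UNIV - {\<rho>}"
    by (rule holomorphic_transform) (auto simp: g_def)
  ultimately have "g holomorphic_on ball \<rho> r \<union> (UNIV - {\<rho>})"
    by (intro holomorphic_on_Un) auto
  moreover have "ball \<rho> r \<union> (UNIV - {\<rho>}) = UNIV" using r(1) by auto
  ultimately have "g holomorphic_on UNIV" by simp
  moreover have "f z = g z * (z - \<rho>) ^ n" for z
    using eq[of z] eq[of \<rho>] r(1) by (auto simp: g_def)
  moreover have "g \<rho> \<noteq> 0" using eq[of \<rho>] r(1) by (auto simp: g_def)
  ultimately show ?thesis using that unfolding n_def by blast
qed

lemma entire_divide_zeros:
  assumes "finite A" and hol: "f holomorphic_on UNIV" and nz: "f z1 \<noteq> 0"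
  shows "\<exists>g. g holomorphic_on UNIV \<and> (\<forall>z. f z = g z * (\<Prod>\<rho>\<in>A. (z - \<rho>) ^ nat (zorder f \<rho>))) \<and>
           (\<forall>\<rho>\<in>A. g \<rho> \<noteq> 0)"
  using assms(1)
proof (induction A rule: finite_induct)
  case empty
  then show ?case using hol by (intro exI[of _ f]) auto
next
  case (insert \<rho> A)
  define P where "P z = (\<Prod>\<rho>\<in>A. (z - \<rho>) ^ nat (zorder f \<rho>))" for z
  from insert obtain g where g: "g holomorphic_on UNIV" "\<And>z. f z = g z * P z" "\<And>\<rho>. \<rho> \<in> A \<Longrightarrow> g \<rho> \<noteq> 0"
    unfolding P_def by auto
  have "g z1 \<noteq> 0" using nz g(2)[of z1] by auto
  then obtain h where h: "h holomorphic_on UNIV"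
    "\<And>z. g z = h z * (z - \<rho>) ^ nat (zorder g \<rho>)" "h \<rho> \<noteq> 0"
    using entire_divide_zero[OF g(1)] by metis
  have P: "P holomorphic_on UNIV" "P \<rho> \<noteq> 0"
    using insert.hyps unfolding P_def by (auto intro!: holomorphic_intros)
  \<comment> \<open>The factors removed before do not vanish at the new point, so the order of the
    quotient \<open>g\<close> there is still that of \<open>f\<close>; the exponents can refer to
    \<open>f\<close> throughout.\<close>
  have "zorder f \<rho> = int (nat (zorder g \<rho>))"
    by (rule zorder_eqI[of UNIV \<rho> "\<lambda>z. h z * P z"])
       (use h g(2) P in \<open>auto intro!: holomorphic_intros simp: power_int_def\<close>)
  hence "f z = h z * ((z - \<rho>) ^ nat (zorder f \<rho>) * P z)" for z
    using g(2)[of z] h(2)[of z] by (simp add: mult_ac)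
  moreover have "h \<sigma> \<noteq> 0" if "\<sigma> \<in> insert \<rho> A" for \<sigma>
    using that h(3) g(3)[of \<sigma>] h(2)[of \<sigma>] by auto
  ultimately show ?case
    using h(1) prod.insert[OF insert.hyps, of "\<lambda>\<rho>. (z - \<rho>) ^ nat (zorder f \<rho>)" for z]
    unfolding P_def by metis
qed

text \<open>The map u -> u / (2M - u) sends the half-plane Re u < M into the unit disc and fixes 0,
  so the Schwarz lemma applies to its composition with \<open>p\<close>. Radius 3/4 gives |p| <= 3/4
  (2M + |p|), hence the factor 6.\<close>

lemma Borel_Caratheodory:
  assumes hol: "p holomorphic_on ball c R" and "R > 0" and "p c = 0"
    and M: "\<And>z. z \<in> ball c R \<Longrightarrow> Re (p z) < M"
    and z: "dist c z \<le> 3 / 4 * R"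
  shows "norm (p z) \<le> 6 * M"
proof -
  have Mpos: "M > 0" using M[of c] assms by simp
  define \<phi> where "\<phi> u = p (c + of_real R * u) / (2 * of_real M - p (c + of_real R * u))" for u
  have inb: "c + of_real R * u \<in> ball c R" if "norm u < 1" for u
    using that \<open>R > 0\<close> by (simp add: dist_norm norm_mult)
  have lt: "norm w < norm (2 * of_real M - w)" if "Re w < M" for w
  proof (rule power2_less_imp_less)
    have "4 * (M * Re w) < 4 * (M * M)" using that Mpos by simp
    thus "(norm w)\<^sup>2 < (norm (2 * of_real M - w))\<^sup>2"
      unfolding cmod_power2 by (simp add: power2_eq_square algebra_simps)
  qed auto
  have ne: "2 * of_real M - p (c + of_real R * u) \<noteq> 0" if "norm u < 1" for u
    using lt[OF M[OF inb[OF that]]] by auto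
  have "(\<lambda>u. p (c + of_real R * u)) holomorphic_on ball 0 1"
    by (rule holomorphic_on_compose_gen[of "\<lambda>u. c + of_real R * u" _ p "ball c R", unfolded o_def])
       (use inb hol in \<open>auto intro!: holomorphic_intros\<close>)
  hence "\<phi> holomorphic_on ball 0 1"
    unfolding \<phi>_def using ne by (intro holomorphic_intros) auto
  moreover have "\<phi> 0 = 0" using assms by (simp add: \<phi>_def)
  moreover have "norm (\<phi> u) < 1" if "norm u < 1" for u
    using lt[OF M[OF inb[OF that]]] ne[OF that] by (simp add: \<phi>_def norm_divide divide_simps)
  ultimately have S: "norm (\<phi> u) \<le> norm u" if "norm u < 1" for u
    using Schwarz_Lemma'[of \<phi>] that by blast
  define u where "u = (z - c) / of_real R"
  have u: "norm u \<le> 3 / 4" using z \<open>R > 0\<close>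
    by (simp add: u_def norm_divide dist_norm norm_minus_commute field_simps)
  have zu: "c + of_real R * u = z" using \<open>R > 0\<close> by (simp add: u_def)
  have "norm (p z) / norm (2 * of_real M - p z) \<le> 3 / 4"
    using order_trans[OF S[of u] u] u unfolding \<phi>_def zu norm_divide by linarith
  moreover have "norm (2 * of_real M - p z) > 0" using ne[of u] u zu by simp
  ultimately have "norm (p z) \<le> 3 / 4 * norm (2 * of_real M - p z)" by (simp add: field_simps)
  also have "\<dots> \<le> 3 / 4 * (2 * M + norm (p z))"
    using norm_triangle_ineq4[of "2 * of_real M" "p z"] Mpos by (simp add: norm_mult)
  finally show ?thesis by simp
qed

text \<open>Cauchy's estimate for the second derivative on circles of radius R/4 gives 2! 6M /
  (R/4)^2 = 192 M / R^2. A difference of first derivatives thus gains R^(-2), where a single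
  derivative would gain only R^(-1); with M of size R^\<alpha> this is what decays for \<alpha> <
  2.\<close>

lemma Borel_Caratheodory_deriv_diff:
  assumes hol: "p holomorphic_on ball c R" and "R > 0" and "p c = 0"
    and M: "\<And>z. z \<in> ball c R \<Longrightarrow> Re (p z) < M"
    and s: "dist c s \<le> R / 2"
  shows "norm (deriv p s - deriv p c) \<le> 192 * M / R\<^sup>2 * norm (s - c)"
proof -
  have bd: "norm ((deriv ^^ 2) p z) \<le> 192 * M / R\<^sup>2" if z: "z \<in> cball c (R / 2)" for z
  proof -
    have sub: "cball z (R / 4) \<subseteq> cball c (3 / 4 * R)"
    proof
      fix x assume "x \<in> cball z (R / 4)"
      thus "x \<in> cball c (3 / 4 * R)"
        using z dist_triangle[of c x z] by simp
    qed
    hence sub': "cball z (R / 4) \<subseteq> ball c R" using \<open>R > 0\<close> by force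
    have "norm ((deriv ^^ 2) p z) \<le> fact 2 * (6 * M) / (R / 4) ^ 2"
    proof (rule Cauchy_inequality)
      show "p holomorphic_on ball z (R / 4)" using holomorphic_on_subset[OF hol] sub' by force
      show "continuous_on (cball z (R / 4)) p"
        using holomorphic_on_imp_continuous_on[OF holomorphic_on_subset[OF hol sub']] .
      show "norm (p x) \<le> 6 * M" if "norm (z - x) = R / 4" for x
      proof -
        have "x \<in> cball z (R / 4)" using that by (simp add: dist_norm)
        thus ?thesis using Borel_Caratheodory[OF assms(1-4)] sub by auto
      qed
    qed (use \<open>R > 0\<close> in auto)
    thus ?thesis using \<open>R > 0\<close> by (simp add: field_simps fact_numeral power2_eq_square)
  qed
  show ?thesis
  proof (rule field_differentiable_bound[of "cball c (R / 2)" "deriv p" "(deriv ^^ 2) p"])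
    fix z assume z: "z \<in> cball c (R / 2)"
    hence "z \<in> ball c R" using \<open>R > 0\<close> by auto
    hence "(deriv p has_field_derivative deriv (deriv p) z) (at z)"
      by (intro holomorphic_derivI[OF holomorphic_deriv[OF hol open_ball] open_ball])
    thus "(deriv p has_field_derivative (deriv ^^ 2) p z) (at z within cball c (R / 2))"
      by (simp add: numeral_2_eq_2 has_field_derivative_at_within)
  qed (use bd s \<open>R > 0\<close> in auto)
qed

section \<open>Growth, zero counting and partial fractions of the logarithmic derivative\<close>

locale entire_growth =
  fixes f :: "complex \<Rightarrow> complex" and c :: complex and C \<alpha> :: real
  assumes hol: "f holomorphic_on UNIV" and nz: "f c \<noteq> 0"
    and growth: "\<And>z. norm (f z) \<le> exp (C * (1 + norm (z - c)) powr \<alpha>)"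
    and \<alpha>: "\<alpha> > 0"
begin

definition zmult :: "complex \<Rightarrow> real" where "zmult \<rho> = of_int (zorder f \<rho>)"

definition zeros :: "complex set" where "zeros = {\<rho>. f \<rho> = 0}"

definition zeros_upto :: "real \<Rightarrow> complex set" where
  "zeros_upto R = {\<rho> \<in> zeros. norm (\<rho> - c) \<le> R}"

lemma finite_zeros_upto [simp, intro]: "finite (zeros_upto R)"
proof -
  have "finite {z \<in> cball c R. f z = 0}" if "\<not> f constant_on UNIV"
    by (rule holomorphic_compact_finite_zeros[OF hol]) (use that in auto)
  moreover have "{z \<in> cball c R. f z = 0} = {}" if "f constant_on UNIV"
    using that nz by (auto simp: constant_on_def)
  moreover have "zeros_upto R = {z \<in> cball c R. f z = 0}"
    by (auto simp: zeros_upto_def zeros_def dist_norm norm_minus_commute)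
  ultimately show ?thesis by (metis finite.emptyI)
qed

lemma zeros_upto_subset: "zeros_upto R \<subseteq> zeros"
  by (auto simp: zeros_upto_def)

lemma zorder_zero_pos: "\<rho> \<in> zeros \<Longrightarrow> zorder f \<rho> > 0"
  using zorder_exist_zero[OF hol open_UNIV connected_UNIV UNIV_I, of \<rho>] nz by (auto simp: zeros_def)

lemma zmult_pos: "\<rho> \<in> zeros \<Longrightarrow> zmult \<rho> > 0"
  using zorder_zero_pos by (simp add: zmult_def)

lemma zmult_nonneg: "\<rho> \<in> zeros \<Longrightarrow> zmult \<rho> \<ge> 0"
  using zmult_pos by force

lemma finite_subset_zeros_upto:
  assumes "finite A" "A \<subseteq> zeros"
  obtains R where "R \<ge> R0" "A \<subseteq> zeros_upto R"
proof -
  define R where "R = Max (insert R0 ((\<lambda>\<rho>. norm (\<rho> - c)) ` A))"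
  have "R \<ge> x" if "x \<in> insert R0 ((\<lambda>\<rho>. norm (\<rho> - c)) ` A)" for x
    using that assms(1) unfolding R_def by (intro Max_ge) auto
  thus ?thesis using assms(2) by (intro that[of R]) (auto simp: zeros_upto_def)
qed

text \<open>Normalises the growth bound by \<open>f c\<close>. Zeros up to radius R will be compared
  with the circle of radius 3R, and 1 + 3R <= 4R explains the 4. The summand 1 in \<open>K\<close>
  makes the inequality strict, as the Borel-Caratheodory step requires.\<close>

lemma exists_growth_const:
  obtains K where "K > 0" "\<And>R z. R \<ge> 1 \<Longrightarrow> norm (z - c) \<le> 3 * R \<Longrightarrow> norm (f z / f c) < exp (K * R powr \<alpha>)"
proof -
  define K where "K = max 0 C * 4 powr \<alpha> + \<bar>ln (norm (f c))\<bar> + 1"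
  have K: "K > 0" unfolding K_def by (smt (verit) mult_nonneg_nonneg powr_ge_zero)
  have "norm (f z / f c) < exp (K * R powr \<alpha>)" if "R \<ge> 1" "norm (z - c) \<le> 3 * R" for R z
  proof -
    have R1: "R powr \<alpha> \<ge> 1" using that(1) \<alpha> by (simp add: ge_one_powr_ge_zero)
    have "norm (f z) \<le> exp (C * (1 + norm (z - c)) powr \<alpha>)" by (rule growth)
    also have "C * (1 + norm (z - c)) powr \<alpha> \<le> max 0 C * (4 * R) powr \<alpha>"
      using that \<alpha> by (intro mult_mono powr_mono2) auto
    also have "\<dots> = max 0 C * 4 powr \<alpha> * R powr \<alpha>" using that by (simp add: powr_mult)
    finally have 1: "norm (f z) \<le> exp (max 0 C * 4 powr \<alpha> * R powr \<alpha>)" by simp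
    have "1 / norm (f c) = exp (- ln (norm (f c)))" using nz by (simp add: exp_minus field_simps)
    also have "\<dots> < exp (\<bar>ln (norm (f c))\<bar> + 1)" by simp
    also have "\<dots> \<le> exp ((\<bar>ln (norm (f c))\<bar> + 1) * R powr \<alpha>)"
      using R1 by (simp add: mult_le_cancel_left1)
    finally have 2: "1 / norm (f c) < exp ((\<bar>ln (norm (f c))\<bar> + 1) * R powr \<alpha>)" .
    have "norm (f z / f c) = norm (f z) * (1 / norm (f c))" by (simp add: norm_divide)
    also have "\<dots> < exp (max 0 C * 4 powr \<alpha> * R powr \<alpha>) * exp ((\<bar>ln (norm (f c))\<bar> + 1) * R powr \<alpha>)"
      by (intro le_less_trans[OF mult_right_mono[OF 1] mult_strict_left_mono[OF 2]]) auto
    also have "\<dots> = exp (K * R powr \<alpha>)" by (simp add: K_def algebra_simps flip: exp_add)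
    finally show ?thesis .
  qed
  thus ?thesis using K that by blast
qed

text \<open>On the circle of radius \<open>3R\<close> each divided factor \<open>(z - \<rho>) / (c - \<rho>)\<close> has modulus at least \<open>2\<close>;
  the maximum principle carries the resulting bound for the quotient inside, where at \<open>c\<close> it
  counts zeros.\<close>
lemma divided_function:
  assumes K: "\<And>R z. R \<ge> 1 \<Longrightarrow> norm (z - c) \<le> 3 * R \<Longrightarrow> norm (f z / f c) < exp (K * R powr \<alpha>)"
    and R: "R \<ge> 1"
  obtains g where "g holomorphic_on UNIV" "g c = 1" "\<And>z. z \<in> cball c R \<Longrightarrow> g z \<noteq> 0"
    "\<And>z. f z = f c * g z * (\<Prod>\<rho>\<in>zeros_upto R. ((z - \<rho>) / (c - \<rho>)) ^ nat (zorder f \<rho>))"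
    "\<And>z. norm (z - c) \<le> 3 * R \<Longrightarrow> norm (g z) < exp (K * R powr \<alpha>)"
    "2 powr (\<Sum>\<rho>\<in>zeros_upto R. zmult \<rho>) \<le> exp (K * R powr \<alpha>)"
proof -
  define A where "A = zeros_upto R"
  define n where "n \<rho> = nat (zorder f \<rho>)" for \<rho>
  obtain h where h: "h holomorphic_on UNIV" "\<And>z. f z = h z * (\<Prod>\<rho>\<in>A. (z - \<rho>) ^ n \<rho>)"
      "\<And>\<rho>. \<rho> \<in> A \<Longrightarrow> h \<rho> \<noteq> 0"
    using entire_divide_zeros[OF finite_zeros_upto hol nz, of R] unfolding A_def n_def by blast
  have cA: "c - \<rho> \<noteq> 0" if "\<rho> \<in> A" for \<rho>
    using that nz by (auto simp: A_def zeros_upto_def zeros_def)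
  define D where "D = (\<Prod>\<rho>\<in>A. (c - \<rho>) ^ n \<rho>)"
  have D: "D \<noteq> 0" using cA by (auto simp: D_def A_def)
  define g where "g z = h z * D / f c" for z
  define P where "P z = (\<Prod>\<rho>\<in>A. ((z - \<rho>) / (c - \<rho>)) ^ n \<rho>)" for z
  have P: "P z = (\<Prod>\<rho>\<in>A. (z - \<rho>) ^ n \<rho>) / D" for z
    by (simp add: P_def D_def power_divide prod_dividef)
  have fg: "f z = f c * g z * P z" for z
    using D nz h(2)[of z] by (simp add: g_def P)
  have gh: "g holomorphic_on UNIV" unfolding g_def using h(1) nz by (intro holomorphic_intros) auto
  have "P c = 1" using cA by (simp add: P_def)
  hence gc: "g c = 1" using fg[of c] nz by simp
  have gnz: "g z \<noteq> 0" if "z \<in> cball c R" for z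
  proof (cases "z \<in> A")
    case True thus ?thesis using h(3) D nz by (simp add: g_def)
  next
    case False
    hence "f z \<noteq> 0" using that by (auto simp: A_def zeros_upto_def zeros_def dist_norm norm_minus_commute)
    thus ?thesis using fg[of z] by auto
  qed
  define N where "N = (\<Sum>\<rho>\<in>A. n \<rho>)"
  have Psphere: "norm (P z) \<ge> 2 ^ N" if z: "norm (z - c) = 3 * R" for z
  proof -
    have "2 ^ N = (\<Prod>\<rho>\<in>A. 2 ^ n \<rho> :: real)" by (simp add: N_def power_sum)
    also have "\<dots> \<le> (\<Prod>\<rho>\<in>A. norm (((z - \<rho>) / (c - \<rho>)) ^ n \<rho>))"
    proof (intro prod_mono conjI)
      fix \<rho> assume \<rho>: "\<rho> \<in> A"
      have "norm (\<rho> - c) \<le> R" using \<rho> by (simp add: A_def zeros_upto_def)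
      moreover have "norm (z - c) \<le> norm (z - \<rho>) + norm (\<rho> - c)"
        using norm_triangle_ineq[of "z - \<rho>" "\<rho> - c"] by simp
      ultimately have "norm (z - \<rho>) \<ge> 2 * norm (c - \<rho>)" using z by (simp add: norm_minus_commute)
      hence "norm ((z - \<rho>) / (c - \<rho>)) \<ge> 2" using cA[OF \<rho>] by (simp add: norm_divide field_simps)
      thus "2 ^ n \<rho> \<le> norm (((z - \<rho>) / (c - \<rho>)) ^ n \<rho>)" by (simp add: norm_power power_mono)
    qed auto
    finally show ?thesis by (simp add: P_def prod_norm)
  qed
  define B where "B = exp (K * R powr \<alpha>)"
  have gsph: "norm (g z) * 2 ^ N < B" if z: "norm (z - c) = 3 * R" for z
  proof -
    have "norm (g z) * 2 ^ N \<le> norm (g z) * norm (P z)" using Psphere[OF z] by (intro mult_left_mono) auto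
    also have "\<dots> = norm (f z / f c)" using fg[of z] nz by (simp add: norm_mult norm_divide)
    also have "\<dots> < B" unfolding B_def using K[OF R] z by simp
    finally show ?thesis .
  qed
  have "compact (sphere c (3 * R))" by simp
  moreover have "sphere c (3 * R) \<noteq> {}" using R by simp
  moreover have "continuous_on (sphere c (3 * R)) (\<lambda>z. norm (g z))"
    by (intro continuous_intros holomorphic_on_imp_continuous_on holomorphic_on_subset[OF gh]) auto
  ultimately obtain w where w: "w \<in> sphere c (3 * R)" "\<And>z. z \<in> sphere c (3 * R) \<Longrightarrow> norm (g z) \<le> norm (g w)"
    using continuous_attains_sup by metis
  have gin: "norm (g z) \<le> norm (g w)" if "norm (z - c) \<le> 3 * R" for z
  proof (rule maximum_modulus_frontier[of g "cball c (3 * R)"])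
    show "continuous_on (closure (cball c (3 * R))) g"
      by (intro holomorphic_on_imp_continuous_on holomorphic_on_subset[OF gh]) auto
    show "g holomorphic_on interior (cball c (3 * R))" by (rule holomorphic_on_subset[OF gh]) auto
    show "norm (g z) \<le> norm (g w)" if "z \<in> frontier (cball c (3 * R))" for z
      using w(2)[of z] that R by simp
  qed (use that in \<open>auto simp: dist_norm norm_minus_commute\<close>)
  have gw: "norm (g w) * 2 ^ N < B" using gsph[of w] w(1) by (simp add: dist_norm norm_minus_commute)
  have "(1::real) \<le> 2 ^ N" by simp
  hence "norm (g w) * 1 \<le> norm (g w) * 2 ^ N" by (intro mult_left_mono) auto
  hence gw': "norm (g w) < B" using gw by simp
  have "1 \<le> norm (g w)" using gin[of c] gc R by simp
  hence "1 * 2 ^ N \<le> norm (g w) * 2 ^ N" by (intro mult_right_mono) auto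
  hence "2 ^ N \<le> B" using gw by linarith
  moreover have "(\<Sum>\<rho>\<in>A. zmult \<rho>) = real N"
    unfolding N_def n_def of_nat_sum zmult_def
    using zorder_zero_pos zeros_upto_subset by (intro sum.cong) (force simp: A_def)+
  hence "2 powr (\<Sum>\<rho>\<in>A. zmult \<rho>) = 2 ^ N" by (simp add: powr_realpow)
  ultimately show ?thesis
    by (intro that[OF gh gc gnz fg[unfolded P_def n_def A_def]
          le_less_trans[OF gin gw'[unfolded B_def]]])
       (simp_all add: A_def B_def)
qed

text \<open>A Jensen-type count without Jensen's formula: N zeros force 2^N <= exp (K R^\<alpha>),
  and taking logarithms gives the bound.\<close>

lemma zero_count_bound:
  obtains K where "K > 0" "\<And>R. R \<ge> 1 \<Longrightarrow> (\<Sum>\<rho>\<in>zeros_upto R. zmult \<rho>) \<le> K * R powr \<alpha>"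
proof -
  obtain K where K: "K > 0" "\<And>R z. R \<ge> 1 \<Longrightarrow> norm (z - c) \<le> 3 * R \<Longrightarrow> norm (f z / f c) < exp (K * R powr \<alpha>)"
    using exists_growth_const by blast
  have "(\<Sum>\<rho>\<in>zeros_upto R. zmult \<rho>) \<le> K / ln 2 * R powr \<alpha>" if R: "R \<ge> 1" for R
  proof -
    have "2 powr (\<Sum>\<rho>\<in>zeros_upto R. zmult \<rho>) \<le> exp (K * R powr \<alpha>)"
      using divided_function[OF K(2) R] by blast
    hence "(\<Sum>\<rho>\<in>zeros_upto R. zmult \<rho>) * ln 2 \<le> K * R powr \<alpha>" by (simp add: powr_def)
    thus ?thesis by (simp add: field_simps)
  qed
  thus ?thesis using K(1) by (intro that[of "K / ln 2"]) auto
qed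

text \<open>A truncated Hadamard expansion. After the zeros in the disc are divided out, the
  quotient \<open>g\<close> has a holomorphic logarithm \<open>p\<close> there with Re p < K
  R^\<alpha>, and the difference of the logarithmic derivatives at \<open>s\<close> and
  \<open>c\<close> deviates from the finite sum by p'(s) - p'(c). For fixed \<open>s\<close> and
  \<alpha> < 2 the error vanishes as R grows.\<close>

lemma logderiv_partial_fractions:
  obtains K where "K > 0"
    "\<And>R s. R \<ge> 1 \<Longrightarrow> norm (s - c) \<le> R / 2 \<Longrightarrow> f s \<noteq> 0 \<Longrightarrow>
       norm (deriv f s / f s - deriv f c / f c -
         (\<Sum>\<rho>\<in>zeros_upto R. of_real (zmult \<rho>) * (1 / (s - \<rho>) - 1 / (c - \<rho>))))
       \<le> K * R powr (\<alpha> - 2) * norm (s - c)"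
proof -
  obtain K where K: "K > 0" "\<And>R z. R \<ge> 1 \<Longrightarrow> norm (z - c) \<le> 3 * R \<Longrightarrow> norm (f z / f c) < exp (K * R powr \<alpha>)"
    using exists_growth_const by blast
  have "norm (deriv f s / f s - deriv f c / f c -
         (\<Sum>\<rho>\<in>zeros_upto R. of_real (zmult \<rho>) * (1 / (s - \<rho>) - 1 / (c - \<rho>))))
       \<le> (192 * K) * R powr (\<alpha> - 2) * norm (s - c)"
    if R: "R \<ge> 1" and s: "norm (s - c) \<le> R / 2" and fs: "f s \<noteq> 0" for R s
  proof -
    obtain g where g: "g holomorphic_on UNIV" "g c = 1" "\<And>z. z \<in> cball c R \<Longrightarrow> g z \<noteq> 0"
      "\<And>z. f z = f c * g z * (\<Prod>\<rho>\<in>zeros_upto R. ((z - \<rho>) / (c - \<rho>)) ^ nat (zorder f \<rho>))"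
      "\<And>z. norm (z - c) \<le> 3 * R \<Longrightarrow> norm (g z) < exp (K * R powr \<alpha>)"
      "2 powr (\<Sum>\<rho>\<in>zeros_upto R. zmult \<rho>) \<le> exp (K * R powr \<alpha>)"
      by (rule divided_function[OF _ R, of K]) (rule K(2), assumption+, rule that)
    obtain p0 where p0: "p0 holomorphic_on ball c R" "\<And>z. z \<in> ball c R \<Longrightarrow> exp (p0 z) = g z"
      by (rule holomorphic_logarithm_exists[of "ball c R" g c])
         (use R g(3) in \<open>auto intro: holomorphic_on_subset[OF g(1)]\<close>)
    \<comment> \<open>As g c = 1, subtracting \<open>p0 c\<close> keeps exp p = g and makes p vanish
      at the centre.\<close>
    define p where "p z = p0 z - p0 c" for z
    have p: "p holomorphic_on ball c R" unfolding p_def by (intro holomorphic_intros p0)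
    have ep: "exp (p z) = g z" if "z \<in> ball c R" for z
      using p0(2)[OF that] p0(2)[of c] g(2) R by (simp add: p_def exp_diff)
    have Rep: "Re (p z) < K * R powr \<alpha>" if z: "z \<in> ball c R" for z
    proof -
      have "norm (z - c) \<le> 3 * R" using z R by (simp add: dist_norm norm_minus_commute)
      hence "exp (Re (p z)) < exp (K * R powr \<alpha>)" using g(5)[of z] ep[OF z] norm_exp_eq_Re by metis
      thus ?thesis by simp
    qed
    have bound: "norm (deriv p s - deriv p c) \<le> 192 * (K * R powr \<alpha>) / R\<^sup>2 * norm (s - c)"
      by (rule Borel_Caratheodory_deriv_diff[OF p _ _ Rep])
         (use R s in \<open>auto simp: p_def dist_norm norm_minus_commute\<close>)
    have ld: "deriv f z / f z = deriv p z + (\<Sum>\<rho>\<in>zeros_upto R. of_real (zmult \<rho>) * (1 / (z - \<rho>)))"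
      if z: "z \<in> ball c R" "f z \<noteq> 0" for z
    proof -
      define Q where "Q = (\<lambda>z. \<Prod>\<rho>\<in>zeros_upto R. ((z - \<rho>) / (c - \<rho>)) ^ nat (zorder f \<rho>))"
      have dg: "(g has_field_derivative g z * deriv p z) (at z)"
      proof -
        have "((\<lambda>z. exp (p z)) has_field_derivative exp (p z) * deriv p z) (at z)"
          using holomorphic_derivI[OF p open_ball z(1)] by (auto intro!: derivative_eq_intros)
        moreover have "\<forall>\<^sub>F x in nhds z. exp (p x) = g x"
          using eventually_nhds_in_open[OF open_ball z(1)] by eventually_elim (simp add: ep)
        ultimately show ?thesis
          using DERIV_cong_ev[of z z "\<lambda>z. exp (p z)" g] ep[OF z(1)] by metis
      qed
      have ne: "z - \<rho> \<noteq> 0" "c - \<rho> \<noteq> 0" if "\<rho> \<in> zeros_upto R" for \<rho>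
        using that z nz by (auto simp: zeros_upto_def zeros_def)
      have dQ: "(Q has_field_derivative
         Q z * (\<Sum>\<rho>\<in>zeros_upto R. of_real (zmult \<rho>) * (1 / (z - \<rho>)))) (at z)"
      proof -
        have "(Q has_field_derivative Q z * (\<Sum>\<rho>\<in>zeros_upto R.
           (of_nat (nat (zorder f \<rho>)) * ((z - \<rho>) / (c - \<rho>)) ^ (nat (zorder f \<rho>) - 1) * (1 / (c - \<rho>)))
             / ((z - \<rho>) / (c - \<rho>)) ^ nat (zorder f \<rho>))) (at z)"
          unfolding Q_def
          by (rule has_field_derivative_prod')
             (use ne in \<open>auto intro!: DERIV_power[THEN DERIV_cong] DERIV_cdivide derivative_eq_intros\<close>)
        also have "(\<Sum>\<rho>\<in>zeros_upto R.
           (of_nat (nat (zorder f \<rho>)) * ((z - \<rho>) / (c - \<rho>)) ^ (nat (zorder f \<rho>) - 1) * (1 / (c - \<rho>)))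
             / ((z - \<rho>) / (c - \<rho>)) ^ nat (zorder f \<rho>)) =
           (\<Sum>\<rho>\<in>zeros_upto R. of_real (zmult \<rho>) * (1 / (z - \<rho>)))"
        proof (rule sum.cong)
          fix \<rho> assume \<rho>: "\<rho> \<in> zeros_upto R"
          hence pos: "zorder f \<rho> > 0" using zorder_zero_pos zeros_upto_subset by blast
          then obtain k where k: "nat (zorder f \<rho>) = Suc k" by (cases "nat (zorder f \<rho>)") auto
          have "zmult \<rho> = real (Suc k)" using pos k unfolding zmult_def by linarith
          thus "(of_nat (nat (zorder f \<rho>)) * ((z - \<rho>) / (c - \<rho>)) ^ (nat (zorder f \<rho>) - 1) * (1 / (c - \<rho>)))
             / ((z - \<rho>) / (c - \<rho>)) ^ nat (zorder f \<rho>) = of_real (zmult \<rho>) * (1 / (z - \<rho>))"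
            unfolding k using ne[OF \<rho>] by (simp add: divide_simps del: of_nat_Suc)
        qed auto
        finally show ?thesis .
      qed
      have feq: "(\<lambda>z. f c * g z * Q z) = f" using g(4)[symmetric] unfolding Q_def by (rule ext)
      have "((\<lambda>z. f c * g z * Q z) has_field_derivative
        f c * g z * Q z * (deriv p z + (\<Sum>\<rho>\<in>zeros_upto R. of_real (zmult \<rho>) * (1 / (z - \<rho>))))) (at z)"
        using dg dQ by (auto intro!: derivative_eq_intros simp: algebra_simps)
      hence "deriv f z = f z * (deriv p z + (\<Sum>\<rho>\<in>zeros_upto R. of_real (zmult \<rho>) * (1 / (z - \<rho>))))"
        unfolding feq fun_cong[OF feq] by (rule DERIV_imp_deriv)
      thus ?thesis using z by simp
    qed
    have "deriv f s / f s - deriv f c / f c -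
         (\<Sum>\<rho>\<in>zeros_upto R. of_real (zmult \<rho>) * (1 / (s - \<rho>) - 1 / (c - \<rho>))) = deriv p s - deriv p c"
      using ld[of s] ld[of c] s fs nz R
      by (simp add: dist_norm norm_minus_commute right_diff_distrib sum_subtractf)
    moreover have "192 * (K * R powr \<alpha>) / R\<^sup>2 = 192 * K * R powr (\<alpha> - 2)"
      using R by (simp add: powr_diff)
    ultimately show ?thesis using bound by simp
  qed
  thus ?thesis using K(1) by (intro that[of "192 * K"]) auto
qed

text \<open>Dyadic shells: at most K 2^((j+1) \<alpha>) zeros have distance between 2^j and 2^(j+1)
  from \<open>c\<close>, each weighing at most 2^(-j \<beta>), so shell j contributes a term of a
  geometric series with ratio 2^(\<alpha> - \<beta>).\<close>

lemma weighted_zero_sum_bound: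
  assumes away: "\<And>\<rho>. \<rho> \<in> zeros \<Longrightarrow> norm (\<rho> - c) \<ge> 1" and "\<beta> > \<alpha>"
  obtains S where "\<And>A. finite A \<Longrightarrow> A \<subseteq> zeros \<Longrightarrow> (\<Sum>\<rho>\<in>A. zmult \<rho> * norm (\<rho> - c) powr (- \<beta>)) \<le> S"
proof -
  obtain K where K: "K > 0" "\<And>R. R \<ge> 1 \<Longrightarrow> (\<Sum>\<rho>\<in>zeros_upto R. zmult \<rho>) \<le> K * R powr \<alpha>"
    using zero_count_bound by blast
  define q where "q = (2::real) powr (\<alpha> - \<beta>)"
  have q: "0 < q" "q < 1" using assms by (auto simp: q_def powr_less_one)
  define v where "v \<rho> = norm (\<rho> - c)" for \<rho>
  define k where "k \<rho> = nat \<lfloor>log 2 (v \<rho>)\<rfloor>" for \<rho>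
  have k: "2 ^ k \<rho> \<le> v \<rho>" "v \<rho> \<le> 2 ^ Suc (k \<rho>)" if "\<rho> \<in> zeros" for \<rho>
  proof -
    have v: "v \<rho> \<ge> 1" using away[OF that] by (simp add: v_def)
    hence "log 2 (v \<rho>) \<ge> 0" by simp
    hence "real (k \<rho>) = of_int \<lfloor>log 2 (v \<rho>)\<rfloor>" by (simp add: k_def)
    hence *: "real (k \<rho>) \<le> log 2 (v \<rho>)" "log 2 (v \<rho>) \<le> real (Suc (k \<rho>))"
      using floor_correct[of "log 2 (v \<rho>)"] by linarith+
    have "2 powr real (k \<rho>) \<le> 2 powr log 2 (v \<rho>)" "2 powr log 2 (v \<rho>) \<le> 2 powr real (Suc (k \<rho>))"
      by (intro powr_mono *; simp)+
    moreover have "2 powr log 2 (v \<rho>) = v \<rho>" using v by simp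
    ultimately show "2 ^ k \<rho> \<le> v \<rho>" "v \<rho> \<le> 2 ^ Suc (k \<rho>)" by (simp_all only: powr_realpow zero_less_numeral)
  qed
  have "(\<Sum>\<rho>\<in>A. zmult \<rho> * v \<rho> powr (- \<beta>)) \<le> K * 2 powr \<alpha> / (1 - q)" if A: "finite A" "A \<subseteq> zeros" for A
  proof -
    have "(\<Sum>\<rho>\<in>A. zmult \<rho> * v \<rho> powr (- \<beta>)) =
        (\<Sum>j\<in>k ` A. \<Sum>\<rho> | \<rho> \<in> A \<and> k \<rho> = j. zmult \<rho> * v \<rho> powr (- \<beta>))"
      using A(1) by (rule sum.image_gen)
    also have "\<dots> \<le> (\<Sum>j\<in>k ` A. K * 2 powr \<alpha> * q ^ j)"
    proof (rule sum_mono)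
      fix j
      have "(\<Sum>\<rho> | \<rho> \<in> A \<and> k \<rho> = j. zmult \<rho> * v \<rho> powr (- \<beta>)) \<le>
          (\<Sum>\<rho> | \<rho> \<in> A \<and> k \<rho> = j. zmult \<rho> * (2 ^ j) powr (- \<beta>))"
        using A k assms \<alpha> zmult_nonneg by (intro sum_mono mult_left_mono powr_mono2') auto
      also have "\<dots> = (\<Sum>\<rho> | \<rho> \<in> A \<and> k \<rho> = j. zmult \<rho>) * (2 ^ j) powr (- \<beta>)"
        by (simp add: sum_distrib_right)
      also have "\<dots> \<le> (K * (2 ^ Suc j) powr \<alpha>) * (2 ^ j) powr (- \<beta>)"
      proof (rule mult_right_mono)
        have "(\<Sum>\<rho> | \<rho> \<in> A \<and> k \<rho> = j. zmult \<rho>) \<le> (\<Sum>\<rho>\<in>zeros_upto (2 ^ Suc j). zmult \<rho>)"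
          using A k zmult_nonneg zeros_upto_subset
          by (intro sum_mono2) (auto simp: zeros_upto_def v_def simp del: finite_zeros_upto intro!: finite_zeros_upto[unfolded zeros_upto_def])
        also have "\<dots> \<le> K * (2 ^ Suc j) powr \<alpha>"
          by (rule K(2)) (metis one_le_numeral one_le_power)
        finally show "(\<Sum>\<rho> | \<rho> \<in> A \<and> k \<rho> = j. zmult \<rho>) \<le> K * (2 ^ Suc j) powr \<alpha>" .
      qed auto
      also have "\<dots> = K * 2 powr \<alpha> * q ^ j"
      proof -
        have "((2::real) ^ j) powr x = (2 powr x) ^ j" for x
          by (metis powr_power powr_powr powr_realpow zero_less_numeral mult.commute powr_gt_zero)
        hence "((2::real) ^ j) powr \<alpha> * (2 ^ j) powr (- \<beta>) = q ^ j"
          by (simp add: q_def flip: power_mult_distrib powr_add)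
        thus ?thesis by (simp add: powr_mult)
      qed
      finally show "(\<Sum>\<rho> | \<rho> \<in> A \<and> k \<rho> = j. zmult \<rho> * v \<rho> powr (- \<beta>)) \<le> K * 2 powr \<alpha> * q ^ j" .
    qed
    also have "\<dots> \<le> (\<Sum>j. K * 2 powr \<alpha> * q ^ j)"
      using A(1) K(1) q by (intro sum_le_suminf summable_mult summable_geometric) auto
    also have "\<dots> = K * 2 powr \<alpha> / (1 - q)"
      using q by (subst suminf_mult) (auto simp: suminf_geometric summable_geometric)
    finally show ?thesis .
  qed
  thus ?thesis using that unfolding v_def by blast
qed

end

section \<open>Growth of the Gamma and Digamma functions\<close>

text \<open>In the products approximating Gamma, |n^z| depends only on Re z and |z + i| >= Re z + i,
  so the inequality already holds for every approximant.\<close>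

lemma norm_Gamma_le:
  assumes "Re z > 0"
  shows "norm (Gamma z) \<le> Gamma (Re z)"
proof (rule tendsto_le[OF sequentially_bot])
  show "Gamma_series (Re z) \<longlonglongrightarrow> Gamma (Re z)" by (rule Gamma_series_LIMSEQ)
  show "(\<lambda>n. norm (Gamma_series z n)) \<longlonglongrightarrow> norm (Gamma z)" by (intro tendsto_norm Gamma_series_LIMSEQ)
  show "eventually (\<lambda>n. norm (Gamma_series z n) \<le> Gamma_series (Re z) n) sequentially"
  proof (intro always_eventually allI)
    fix n
    have "pochhammer (Re z) (n + 1) \<le> norm (pochhammer z (n + 1))"
      unfolding pochhammer_prod prod_norm[symmetric]
    proof (intro prod_mono conjI)
      fix i show "0 \<le> Re z + of_nat i" using assms by simp
      show "Re z + of_nat i \<le> norm (z + of_nat i)" using complex_Re_le_cmod[of "z + of_nat i"] by simp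
    qed
    moreover have "pochhammer (Re z) (n + 1) > 0" using assms by (intro pochhammer_pos)
    ultimately show "norm (Gamma_series z n) \<le> Gamma_series (Re z) n"
      unfolding Gamma_series_def by (simp add: norm_mult norm_divide frac_le)
  qed
qed

text \<open>The exponent 1/4 here is where the growth exponent 5/4 originates: it turns n ln n into
  a multiple of n^(5/4).\<close>

lemma ln_le_powr:
  assumes "x > (0::real)"
  shows "ln x \<le> 4 * x powr (1 / 4)"
proof -
  have "ln x = 4 * ln (x powr (1 / 4))" using assms by (simp add: ln_powr)
  also have "ln (x powr (1 / 4)) \<le> x powr (1 / 4)"
    using ln_le_minus_one[of "x powr (1 / 4)"] assms by simp
  finally show ?thesis by simp
qed

text \<open>Up to 2, continuity on a compact interval suffices, with \<delta> keeping away from the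
  pole at 0. Beyond 2, monotonicity gives Gamma x <= n! <= n^n with n the ceiling of x.\<close>

lemma Gamma_real_upper_bound:
  assumes "\<delta> > 0"
  obtains K where "K \<ge> 0" "\<And>x. x \<ge> \<delta> \<Longrightarrow> Gamma (x::real) \<le> exp (K * (1 + x) powr (5 / 4))"
proof -
  have "continuous_on {\<delta>..max 2 \<delta>} (Gamma :: real \<Rightarrow> real)"
    using assms by (intro continuous_on_Gamma) (auto elim!: nonpos_Ints_cases)
  hence "bdd_above (Gamma ` {\<delta>..max 2 \<delta>})"
    by (intro bounded_imp_bdd_above compact_imp_bounded compact_continuous_image) auto
  then obtain B where B: "\<And>x. \<delta> \<le> x \<Longrightarrow> x \<le> max 2 \<delta> \<Longrightarrow> Gamma x \<le> B"
    unfolding bdd_above_def by (metis atLeastAtMost_iff imageI)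
  define K where "K = 8 + \<bar>B\<bar>"
  have "Gamma x \<le> exp (K * (1 + x) powr (5 / 4))" if x: "x \<ge> \<delta>" for x
  proof -
    have p1: "(1 + x) powr (5 / 4) \<ge> 1" using x assms by (intro ge_one_powr_ge_zero) auto
    show ?thesis
    proof (cases "x \<le> 2")
      case True
      have "Gamma x \<le> \<bar>B\<bar>" using B[of x] x True by simp
      also have "\<dots> \<le> exp \<bar>B\<bar>" using exp_ge_add_one_self[of "\<bar>B\<bar>"] by linarith
      also have "\<bar>B\<bar> \<le> K * 1" by (simp add: K_def)
      also have "K * 1 \<le> K * (1 + x) powr (5 / 4)" using p1 by (intro mult_left_mono) (auto simp: K_def)
      finally show ?thesis by simp
    next
      case False
      define n where "n = nat \<lceil>x\<rceil>"
      have n: "x \<le> real n" "real n \<le> x + 1" using False by (auto simp: n_def of_nat_nat)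
      have "Gamma x < Gamma (real n + 1)" using n False by (intro Gamma_real_strict_mono) auto
      also have "\<dots> = fact n" by (metis Gamma_fact add.commute)
      also have "\<dots> \<le> real n ^ n" using fact_le_power[of n, where 'a = real] by simp
      also have "\<dots> = exp (real n * ln (real n))" using n False by (simp add: exp_of_nat_mult)
      also have "real n * ln (real n) \<le> (x + 1) * (4 * (x + 1) powr (1 / 4))"
      proof (intro mult_mono)
        have "ln (real n) \<le> ln (x + 1)" using n False by simp
        also have "\<dots> \<le> 4 * (x + 1) powr (1 / 4)" using False by (intro ln_le_powr) auto
        finally show "ln (real n) \<le> 4 * (x + 1) powr (1 / 4)" .
      qed (use n False in auto)
      also have "\<dots> = 4 * (1 + x) powr (5 / 4)"
      proof -
        have "(1 + x) powr (5 / 4) = (1 + x) powr (1 + 1 / 4)" by simp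
        also have "\<dots> = (1 + x) * (1 + x) powr (1 / 4)" using False by (subst powr_add) auto
        finally show ?thesis by (simp add: add.commute)
      qed
      also have "\<dots> \<le> K * (1 + x) powr (5 / 4)" by (intro mult_right_mono) (auto simp: K_def)
      finally show ?thesis by simp
    qed
  qed
  thus ?thesis by (intro that[of K]) (auto simp: K_def)
qed

text \<open>The trigamma function is the sum of 1/(z + k)^2. For Re z >= 0 one has |z + k|^2 >=
  |z|^2 + k^2 >= (|z| + k)^2 / 2, and the resulting real series is compared with a telescoping one;
  the term k = 0 accounts for 1/\<delta>.\<close>

lemma Polygamma_1_bound:
  assumes \<delta>: "\<delta> > 0" and z: "Re z \<ge> \<delta>"
  shows "norm (Polygamma 1 z :: complex) \<le> 2 * (1 / \<delta> + 1) / norm z"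
proof -
  define v where "v = norm z"
  have v: "v \<ge> \<delta>" using complex_Re_le_cmod[of z] z by (simp add: v_def)
  have v0: "v > 0" using v \<delta> by simp
  have bound: "norm (inverse ((z + of_nat k) ^ 2)) \<le> 2 / (v + real k)\<^sup>2" for k
  proof -
    have "(v + real k)\<^sup>2 \<le> 2 * (v\<^sup>2 + (real k)\<^sup>2)"
      using sum_squares_bound[of v "real k"] by (simp add: power2_eq_square algebra_simps)
    also have "v\<^sup>2 + (real k)\<^sup>2 \<le> (norm (z + of_nat k))\<^sup>2"
      using z \<delta> unfolding v_def cmod_power2 by (simp add: power2_eq_square algebra_simps)
    finally have "(v + real k)\<^sup>2 \<le> 2 * (norm (z + of_nat k))\<^sup>2" by simp
    moreover have "(v + real k)\<^sup>2 > 0" using v0 by (intro zero_less_power) auto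
    ultimately have "1 / (norm (z + of_nat k))\<^sup>2 \<le> 2 / (v + real k)\<^sup>2"
      by (simp add: divide_simps split: if_splits)
    thus ?thesis by (simp add: norm_divide norm_power inverse_eq_divide)
  qed
  have tele: "(\<lambda>k. 1 / (v + real k) - 1 / (v + real (Suc k))) sums (1 / (v + real 0) - 0)"
    by (rule telescope_sums') real_asymp
  have le: "2 / (v + real (Suc k))\<^sup>2 \<le> 2 * (1 / (v + real k) - 1 / (v + real (Suc k)))" for k
  proof -
    have "1 / (v + real k) - 1 / (v + real (Suc k)) = 1 / ((v + real k) * (v + real (Suc k)))"
      using v0 by (simp add: field_simps)
    also have "\<dots> \<ge> 1 / ((v + real (Suc k)) * (v + real (Suc k)))"
      using v0 by (intro divide_left_mono mult_right_mono mult_pos_pos) auto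
    finally show ?thesis by (simp add: power2_eq_square)
  qed
  have s1: "summable (\<lambda>k. 2 / (v + real (Suc k))\<^sup>2)"
    by (rule summable_comparison_test'[OF summable_mult[OF sums_summable[OF tele], of 2], of 0])
       (use le in \<open>simp del: of_nat_Suc\<close>)
  have s: "summable (\<lambda>k. 2 / (v + real k)\<^sup>2)" using s1 by (subst (asm) summable_Suc_iff)
  have "norm (\<Sum>k. inverse ((z + of_nat k) ^ 2)) \<le> (\<Sum>k. 2 / (v + real k)\<^sup>2)"
    by (rule norm_suminf_le[OF _ s]) (rule bound)
  also have "\<dots> = (\<Sum>k. 2 / (v + real (Suc k))\<^sup>2) + 2 / v\<^sup>2"
    using suminf_split_head[OF s] by simp
  also have "(\<Sum>k. 2 / (v + real (Suc k))\<^sup>2) \<le> (\<Sum>k. 2 * (1 / (v + real k) - 1 / (v + real (Suc k))))"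
    by (rule suminf_le[OF le s1]) (intro summable_mult sums_summable[OF tele])
  also have "\<dots> = 2 / v" using sums_unique[OF sums_mult[OF tele, of 2]] by simp
  also have "2 / v\<^sup>2 \<le> 2 / (\<delta> * v)" using v v0 \<delta> by (intro divide_left_mono) (auto simp: power2_eq_square)
  also have "2 / v + 2 / (\<delta> * v) = 2 * (1 / \<delta> + 1) / v" using \<delta> v0 by (simp add: field_simps)
  finally show ?thesis by (simp add: Polygamma_def v_def numeral_2_eq_2)
qed

lemma cnj_Digamma: 
  assumes "z \<noteq> 0"
  shows "Digamma (cnj z) = cnj (Digamma z)"
proof -
  have "cnj z \<noteq> 0" using assms by simp
  from Digamma_LIMSEQ[OF this]
  have "(\<lambda>m. cnj (of_real (ln (real m)) - (\<Sum>n<m. inverse (z + of_nat n)))) \<longlonglongrightarrow> Digamma (cnj z)"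
    by simp
  moreover have "(\<lambda>m. cnj (of_real (ln (real m)) - (\<Sum>n<m. inverse (z + of_nat n)))) \<longlonglongrightarrow> cnj (Digamma z)"
    by (intro tendsto_cnj Digamma_LIMSEQ assms)
  ultimately show ?thesis by (rule LIMSEQ_unique)
qed

lemma Re_pos_not_nonpos_Int: "Re z > 0 \<Longrightarrow> (z::complex) \<notin> \<int>\<^sub>\<le>\<^sub>0"
  by (auto elim!: nonpos_Ints_cases)

section \<open>The digamma function on the line Re s = 2\<close>

context
  fixes l :: real and \<mu> :: complex
  assumes l: "l > 0" and \<mu>: "Re \<mu> \<ge> 0"
begin

definition gamma_arg :: "real \<Rightarrow> complex \<Rightarrow> complex" where
  "gamma_arg t \<nu> = of_real l * (2 + \<i> * of_real t) + \<nu>"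

text \<open>The bound has to be uniform in \<nu> on the segment between \<mu> and its conjugate,
  because the digamma function will be compared at the two ends of that segment.\<close>

lemma gamma_arg_norm:
  obtains c where "c > 0" "\<And>t \<nu>. t \<ge> 1 \<Longrightarrow> Re \<nu> = Re \<mu> \<Longrightarrow> \<bar>Im \<nu>\<bar> \<le> \<bar>Im \<mu>\<bar> \<Longrightarrow> c * t \<le> norm (gamma_arg t \<nu>)"
proof -
  define q where "q = \<bar>Im \<mu>\<bar> + 1"
  have q: "q > 0" by (simp add: q_def)
  \<comment> \<open>Once l t >= 2q, the imaginary part is at least l t - q >= l t / 2. Below that, t
    < 2q/l, and the real part is at least 2l, which is no less than (l^2/q) t.\<close>
  define c where "c = min (l / 2) (l\<^sup>2 / q)"
  have c: "c > 0" using l q by (simp add: c_def)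
  have "c * t \<le> norm (gamma_arg t \<nu>)" if t: "t \<ge> 1" and \<nu>: "Re \<nu> = Re \<mu>" "\<bar>Im \<nu>\<bar> \<le> \<bar>Im \<mu>\<bar>" for t \<nu>
  proof (cases "l * t \<ge> 2 * q")
    case True
    have "c * t \<le> l / 2 * t" using t unfolding c_def by (intro mult_right_mono min.cobounded1) auto
    also have "\<dots> \<le> l * t - q" using True by simp
    also have "\<dots> \<le> Im (gamma_arg t \<nu>)" using \<nu> by (auto simp: gamma_arg_def q_def)
    also have "\<dots> \<le> norm (gamma_arg t \<nu>)" using abs_Im_le_cmod[of "gamma_arg t \<nu>"] by linarith
    finally show ?thesis .
  next
    case False
    have "c * t \<le> l\<^sup>2 / q * t" using t by (intro mult_right_mono) (auto simp: c_def)
    also have "\<dots> = l * (l * t) / q" by (simp add: power2_eq_square)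
    also have "\<dots> \<le> l * (2 * q) / q" using False l q by (intro divide_right_mono mult_left_mono) auto
    also have "\<dots> = 2 * l" using q by simp
    also have "\<dots> \<le> Re (gamma_arg t \<nu>)" using \<nu> \<mu> by (simp add: gamma_arg_def)
    also have "\<dots> \<le> norm (gamma_arg t \<nu>)" by (rule complex_Re_le_cmod)
    finally show ?thesis .
  qed
  thus ?thesis using c that by blast
qed

lemma gamma_arg_Polygamma:
  obtains K where "K > 0" "\<And>t \<nu>. t \<ge> 1 \<Longrightarrow> Re \<nu> = Re \<mu> \<Longrightarrow> \<bar>Im \<nu>\<bar> \<le> \<bar>Im \<mu>\<bar> \<Longrightarrow>
    norm (Polygamma 1 (gamma_arg t \<nu>)) \<le> K / t"
proof -
  obtain c where c: "c > 0" "\<And>t \<nu>. t \<ge> 1 \<Longrightarrow> Re \<nu> = Re \<mu> \<Longrightarrow> \<bar>Im \<nu>\<bar> \<le> \<bar>Im \<mu>\<bar> \<Longrightarrow> c * t \<le> norm (gamma_arg t \<nu>)"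
    using gamma_arg_norm by blast
  define K where "K = 2 * (1 / (2 * l) + 1) / c"
  have "norm (Polygamma 1 (gamma_arg t \<nu>)) \<le> K / t" if t: "t \<ge> 1" and \<nu>: "Re \<nu> = Re \<mu>" "\<bar>Im \<nu>\<bar> \<le> \<bar>Im \<mu>\<bar>" for t \<nu>
  proof -
    have "norm (Polygamma 1 (gamma_arg t \<nu>)) \<le> 2 * (1 / (2 * l) + 1) / norm (gamma_arg t \<nu>)"
      using l \<mu> \<nu> by (intro Polygamma_1_bound) (auto simp: gamma_arg_def)
    also have "\<dots> \<le> 2 * (1 / (2 * l) + 1) / (c * t)"
    proof (rule divide_left_mono)
      have "0 < c * t" using c(1) t by simp
      moreover have "0 < norm (gamma_arg t \<nu>)" using calculation c(2)[OF t \<nu>] by linarith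
      ultimately show "0 < norm (gamma_arg t \<nu>) * (c * t)" by (rule mult_pos_pos[rotated])
    qed (use c(2)[OF t \<nu>] l in auto)
    also have "\<dots> = K / t" by (simp add: K_def)
    finally show ?thesis .
  qed
  moreover have "K > 0" using c(1) l by (simp add: K_def add_pos_pos)
  ultimately show ?thesis using that by blast
qed

text \<open>The trigamma bound K/t, integrated from 1 to t, gives logarithmic growth.\<close>

lemma Re_Digamma_line_pos:
  assumes \<nu>: "Re \<nu> = Re \<mu>" "\<bar>Im \<nu>\<bar> \<le> \<bar>Im \<mu>\<bar>"
  obtains K where "K \<ge> 0" "\<And>t. t \<ge> 1 \<Longrightarrow> \<bar>Re (Digamma (gamma_arg t \<nu>))\<bar> \<le> K * (1 + ln t)"
proof -
  obtain K0 where K0: "K0 > 0" "\<And>t \<nu>. t \<ge> 1 \<Longrightarrow> Re \<nu> = Re \<mu> \<Longrightarrow> \<bar>Im \<nu>\<bar> \<le> \<bar>Im \<mu>\<bar> \<Longrightarrow>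
    norm (Polygamma 1 (gamma_arg t \<nu>)) \<le> K0 / t"
    using gamma_arg_Polygamma by blast
  define h where "h t = Digamma (gamma_arg t \<nu>)" for t
  have hd: "(h has_vector_derivative \<i> * of_real l * Polygamma 1 (gamma_arg t \<nu>)) (at t)" for t
  proof -
    have "Re (gamma_arg t \<nu>) > 0" using \<nu> \<mu> l by (simp add: gamma_arg_def add_pos_nonneg)
    hence "gamma_arg t \<nu> \<notin> \<int>\<^sub>\<le>\<^sub>0" by (rule Re_pos_not_nonpos_Int)
    hence "((\<lambda>s. Digamma (of_real l * (2 + \<i> * s) + \<nu>)) has_field_derivative
       Polygamma (Suc 0) (gamma_arg t \<nu>) * (of_real l * \<i>)) (at (of_real t))"
      unfolding gamma_arg_def by (auto intro!: derivative_eq_intros DERIV_chain2[OF has_field_derivative_Polygamma])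
    from has_vector_derivative_real_field[OF this] show ?thesis
      unfolding h_def gamma_arg_def by (simp add: mult_ac)
  qed
  define K where "K = norm (h 1) + l * K0"
  have "\<bar>Re (h t)\<bar> \<le> K * (1 + ln t)" if t: "t \<ge> 1" for t
  proof -
    have "norm (h t - h 1) \<le> l * K0 * ln t - l * K0 * ln 1" if "t > 1"
    proof (rule differentiable_bound_general[OF that])
      show "continuous_on {1..t} h"
        by (intro continuous_at_imp_continuous_on ballI has_vector_derivative_continuous[OF hd])
      show "continuous_on {1..t} (\<lambda>x. l * K0 * ln x)" by (intro continuous_intros) auto
      show "((\<lambda>x. l * K0 * ln x) has_vector_derivative l * K0 / x) (at x)" if "1 < x" "x < t" for x
        using that unfolding has_real_derivative_iff_has_vector_derivative[symmetric]
        by (auto intro!: derivative_eq_intros)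
      show "norm (\<i> * of_real l * Polygamma 1 (gamma_arg x \<nu>)) \<le> l * K0 / x" if "1 < x" "x < t" for x
        using mult_left_mono[OF K0(2)[OF _ \<nu>, of x], of l] that l by (simp add: norm_mult)
    qed (rule hd)
    hence "norm (h t - h 1) \<le> l * K0 * ln t" using t by (cases "t = 1") auto
    moreover have "norm (h t) \<le> norm (h t - h 1) + norm (h 1)" by (metis norm_triangle_sub add.commute)
    ultimately have "norm (h t) \<le> norm (h 1) + l * K0 * ln t" by simp
    also have "\<dots> \<le> norm (h 1) * (1 + ln t) + l * K0 * (1 + ln t)"
      using t l K0(1) by (intro add_mono) (auto simp: mult_le_cancel_left1)
    also have "\<dots> = K * (1 + ln t)" by (simp add: K_def algebra_simps)
    finally show ?thesis using abs_Re_le_cmod[of "h t"] by linarith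
  qed
  moreover have "K \<ge> 0" using l K0(1) by (simp add: K_def)
  ultimately show ?thesis using that unfolding h_def by blast
qed

text \<open>Conjugation moves the lower half of the line to the upper half at the price of replacing
  \<mu> by its conjugate, so bounds are needed for t >= 1 only.\<close>

lemma Re_Digamma_reflect:
  "Re (Digamma (of_real l * (2 - \<i> * of_real t) + \<mu>)) = Re (Digamma (gamma_arg t (cnj \<mu>)))"
proof -
  have "gamma_arg t (cnj \<mu>) = cnj (of_real l * (2 - \<i> * of_real t) + \<mu>)" by (simp add: gamma_arg_def)
  moreover have "Re (of_real l * (2 - \<i> * of_real t) + \<mu>) > 0" using l \<mu> by (simp add: add_pos_nonneg)
  hence "of_real l * (2 - \<i> * of_real t) + \<mu> \<noteq> 0" by (metis zero_complex.sel(1) less_irrefl)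
  ultimately have "Digamma (gamma_arg t (cnj \<mu>)) = cnj (Digamma (of_real l * (2 - \<i> * of_real t) + \<mu>))"
    by (metis cnj_Digamma)
  thus ?thesis by simp
qed

lemma Re_Digamma_line_bound:
  obtains K where "K \<ge> 0" "\<And>t. \<bar>t\<bar> \<ge> 1 \<Longrightarrow>
    \<bar>Re (Digamma (of_real l * (2 + \<i> * of_real t) + \<mu>))\<bar> \<le> K * (1 + ln \<bar>t\<bar>)"
proof -
  obtain K1 where K1: "K1 \<ge> 0" "\<And>t. t \<ge> 1 \<Longrightarrow> \<bar>Re (Digamma (gamma_arg t \<mu>))\<bar> \<le> K1 * (1 + ln t)"
    using Re_Digamma_line_pos[of \<mu>] by auto
  obtain K2 where K2: "K2 \<ge> 0" "\<And>t. t \<ge> 1 \<Longrightarrow> \<bar>Re (Digamma (gamma_arg t (cnj \<mu>)))\<bar> \<le> K2 * (1 + ln t)"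
    using Re_Digamma_line_pos[of "cnj \<mu>"] by auto
  have "\<bar>Re (Digamma (of_real l * (2 + \<i> * of_real t) + \<mu>))\<bar> \<le> (K1 + K2) * (1 + ln \<bar>t\<bar>)" if t: "\<bar>t\<bar> \<ge> 1" for t
  proof (cases "t \<ge> 0")
    case True
    have "K1 * (1 + ln t) \<le> (K1 + K2) * (1 + ln t)" using True t K2(1) by (intro mult_right_mono) auto
    thus ?thesis using K1(2)[of t] True t by (simp add: gamma_arg_def)
  next
    case False
    have "K2 * (1 + ln (-t)) \<le> (K1 + K2) * (1 + ln (-t))" using False t K1(1) by (intro mult_right_mono) auto
    thus ?thesis using K2(2)[of "-t"] Re_Digamma_reflect[of "-t"] False t by simp
  qed
  thus ?thesis using K1(1) K2(1) by (intro that[of "K1 + K2"]) auto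
qed

text \<open>After reflection both terms are taken at the same height t with parameters \<mu> and its
  conjugate, so the logarithmic growth cancels: the mean value inequality on the segment joining the
  parameters gives the trigamma bound times 2 |Im \<mu>|. Divided once more by t, this becomes
  integrable.\<close>

lemma Re_Digamma_line_diff:
  obtains K where "K \<ge> 0" "\<And>t. t \<ge> 1 \<Longrightarrow>
    \<bar>Re (Digamma (of_real l * (2 + \<i> * of_real t) + \<mu>)) - Re (Digamma (of_real l * (2 - \<i> * of_real t) + \<mu>))\<bar> \<le> K / t"
proof -
  obtain K0 where K0: "K0 > 0" "\<And>t \<nu>. t \<ge> 1 \<Longrightarrow> Re \<nu> = Re \<mu> \<Longrightarrow> \<bar>Im \<nu>\<bar> \<le> \<bar>Im \<mu>\<bar> \<Longrightarrow>
    norm (Polygamma 1 (gamma_arg t \<nu>)) \<le> K0 / t"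
    using gamma_arg_Polygamma by blast
  have "\<bar>Re (Digamma (gamma_arg t \<mu>)) - Re (Digamma (gamma_arg t (cnj \<mu>)))\<bar> \<le> (K0 * (2 * \<bar>Im \<mu>\<bar>)) / t"
    if t: "t \<ge> 1" for t
  proof -
    define S where "S = {\<nu>. Re \<nu> = Re \<mu> \<and> \<bar>Im \<nu>\<bar> \<le> \<bar>Im \<mu>\<bar>}"
    have "convex S"
    proof -
      have "S = {\<nu>. Re \<nu> = Re \<mu>} \<inter> ({\<nu>. Im \<nu> \<le> \<bar>Im \<mu>\<bar>} \<inter> {\<nu>. Im \<nu> \<ge> - \<bar>Im \<mu>\<bar>})"
        by (auto simp: S_def)
      moreover have "convex {\<nu>. Re \<nu> = Re \<mu>}"
        using convex_hyperplane[of "1::complex" "Re \<mu>"] by (simp add: inner_complex_def)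
      ultimately show ?thesis
        by (simp add: convex_Int convex_halfspace_Im_le convex_halfspace_Im_ge)
    qed
    have "norm (Digamma (gamma_arg t \<mu>) - Digamma (gamma_arg t (cnj \<mu>))) \<le> K0 / t * norm (\<mu> - cnj \<mu>)"
    proof (rule field_differentiable_bound[OF \<open>convex S\<close>])
      fix \<nu> assume "\<nu> \<in> S"
      hence \<nu>: "Re \<nu> = Re \<mu>" "\<bar>Im \<nu>\<bar> \<le> \<bar>Im \<mu>\<bar>" by (auto simp: S_def)
      show "norm (Polygamma 1 (gamma_arg t \<nu>)) \<le> K0 / t" by (rule K0(2)[OF t \<nu>])
      have "Re (gamma_arg t \<nu>) > 0" using \<nu> \<mu> l by (simp add: gamma_arg_def add_pos_nonneg)
      hence "gamma_arg t \<nu> \<notin> \<int>\<^sub>\<le>\<^sub>0" by (rule Re_pos_not_nonpos_Int)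
      thus "((\<lambda>\<nu>. Digamma (gamma_arg t \<nu>)) has_field_derivative Polygamma 1 (gamma_arg t \<nu>)) (at \<nu> within S)"
        unfolding gamma_arg_def by (auto intro!: derivative_eq_intros DERIV_chain2[OF has_field_derivative_Polygamma])
    qed (auto simp: S_def)
    also have "norm (\<mu> - cnj \<mu>) = 2 * \<bar>Im \<mu>\<bar>" by (simp add: complex_diff_cnj norm_mult)
    finally show ?thesis
      using abs_Re_le_cmod[of "Digamma (gamma_arg t \<mu>) - Digamma (gamma_arg t (cnj \<mu>))"] by simp
  qed
  thus ?thesis using K0(1) Re_Digamma_reflect
    by (intro that[of "K0 * (2 * \<bar>Im \<mu>\<bar>)"]) (auto simp: gamma_arg_def)
qed

end

section \<open>Zeros in a strip: the sum of the heights\<close>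

text \<open>The error is charged to the two endpoints separately, so \<open>E\<close> need not be
  monotone.\<close>

lemma convergent_at_top_if_cauchy_bound:
  fixes B E :: "real \<Rightarrow> real"
  assumes E: "(E \<longlongrightarrow> 0) at_top"
    and B: "\<And>x y. x0 \<le> x \<Longrightarrow> x \<le> y \<Longrightarrow> \<bar>B y - B x\<bar> \<le> E x + E y"
  shows "\<exists>l. (B \<longlongrightarrow> l) at_top"
proof -
  have En: "(\<lambda>n. E (real n)) \<longlonglongrightarrow> 0"
    by (rule filterlim_compose[OF E filterlim_real_sequentially])
  have "Cauchy (\<lambda>n. B (real n))"
  proof (rule metric_CauchyI)
    fix e :: real assume e: "e > 0"
    have "eventually (\<lambda>n. \<bar>E (real n)\<bar> < e / 2) sequentially"
      using En half_gt_zero[OF e] unfolding tendsto_iff dist_real_def by fastforce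
    moreover have "eventually (\<lambda>n. real n \<ge> x0) sequentially"
      using filterlim_real_sequentially by (simp add: filterlim_at_top)
    ultimately have "eventually (\<lambda>n. \<bar>E (real n)\<bar> < e / 2 \<and> real n \<ge> x0) sequentially"
      by eventually_elim auto
    then obtain N where N: "\<And>n. n \<ge> N \<Longrightarrow> \<bar>E (real n)\<bar> < e / 2 \<and> real n \<ge> x0"
      by (auto simp: eventually_sequentially)
    have *: "\<bar>B (real n) - B (real m)\<bar> < e" if "m \<ge> N" "n \<ge> m" for m n
    proof -
      have "\<bar>B (real n) - B (real m)\<bar> \<le> E (real m) + E (real n)"
        using B N[of m] that by auto
      thus ?thesis using N[of m] N[of n] that by linarith
    qed
    have "\<bar>B (real n) - B (real m)\<bar> < e" if "m \<ge> N" "n \<ge> N" for m n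
      using *[of m n] *[of n m] that by (cases "m \<le> n") (auto simp: abs_minus_commute)
    thus "\<exists>M. \<forall>m\<ge>M. \<forall>n\<ge>M. dist (B (real m)) (B (real n)) < e"
      by (auto simp: dist_real_def intro!: exI[of _ N])
  qed
  then obtain l where l: "(\<lambda>n. B (real n)) \<longlonglongrightarrow> l" using Cauchy_convergent convergent_def by metis
  have "\<bar>B x - l\<bar> \<le> E x" if "x \<ge> x0" for x
  proof (rule tendsto_le[OF sequentially_bot])
    show "(\<lambda>n. E x + E (real n)) \<longlonglongrightarrow> E x" using tendsto_add[OF tendsto_const En] by simp
    show "(\<lambda>n. \<bar>B (real n) - B x\<bar>) \<longlonglongrightarrow> \<bar>B x - l\<bar>"
      using tendsto_rabs[OF tendsto_diff[OF l tendsto_const[of "B x"]]] by (simp add: abs_minus_commute)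
    have "eventually (\<lambda>n. real n \<ge> x) sequentially"
      using filterlim_real_sequentially by (simp add: filterlim_at_top)
    thus "eventually (\<lambda>n. \<bar>B (real n) - B x\<bar> \<le> E x + E (real n)) sequentially"
      by eventually_elim (use B that in auto)
  qed
  hence "eventually (\<lambda>x. norm (B x - l) \<le> E x) at_top"
    by (intro eventually_mono[OF eventually_ge_at_top[of x0]]) auto
  hence "((\<lambda>x. B x - l) \<longlongrightarrow> 0) at_top" by (rule Lim_null_comparison[OF _ E])
  thus ?thesis by (auto simp: LIM_zero_iff)
qed

lemma half_pi_minus_arctan_le:
  assumes "x \<ge> (0::real)"
  shows "pi / 2 - arctan x \<le> 4 / (1 + x)"
proof (cases "x \<le> 1")
  case True
  have "pi / 2 - arctan x \<le> pi / 2" using assms by simp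
  also have "\<dots> \<le> 2" using pi_less_4 by simp
  also have "\<dots> \<le> 4 / (1 + x)" using True assms by (simp add: field_simps)
  finally show ?thesis .
next
  case False
  have "pi / 2 - arctan x = arctan (1 / x)"
    using arctan_inverse[of x] False by (simp add: inverse_eq_divide)
  also have "\<dots> \<le> 1 / x" using False by (intro arctan_le_self) auto
  also have "\<dots> \<le> 4 / (1 + x)" using False by (simp add: field_simps)
  finally show ?thesis .
qed

text \<open>With \<open>1/(\<rho> - 2)\<close> in front, the difference quotient of \<open>1/(s - \<rho>)\<close> over \<open>s = 2 \<plusminus> \<i>X\<close> integrates
  in closed form; its real part is essentially \<open>\<pi> Im \<rho> / \<bar>\<rho> - 2\<bar>\<^sup>2\<close> once \<open>X\<close> has passed \<open>\<bar>Im \<rho>\<bar>\<close>.\<close>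
definition window :: "complex \<Rightarrow> real \<Rightarrow> real" where
  "window \<rho> X = Re ((1 / (\<rho> - 2)) * (Ln (2 - \<rho> + \<i> * of_real X) - Ln (2 - \<rho> - \<i> * of_real X)))"

section \<open>The contribution of a single zero\<close>

context
  fixes \<rho> :: complex
  assumes Re_le: "0 \<le> Re \<rho>" "Re \<rho> \<le> 1"
begin

text \<open>The window is an antiderivative, in the height X, of what one zero contributes to Re
  (f'/f (2 + i X) - f'/f (2 - i X)) / X. The two terms 1/(2 - \<rho>) cancel; they are written out
  to match the summands of the partial fraction expansion.\<close>

lemma window_deriv:
  assumes "X > 0"
  shows "(window \<rho> has_real_derivative
     Re ((1 / (2 + \<i> * of_real X - \<rho>) - 1 / (2 - \<rho>)) - (1 / (2 - \<i> * of_real X - \<rho>) - 1 / (2 - \<rho>))) / X) (at X)"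
proof -
  have ne: "2 - \<rho> + \<i> * of_real X \<notin> \<real>\<^sub>\<le>\<^sub>0" "2 - \<rho> - \<i> * of_real X \<notin> \<real>\<^sub>\<le>\<^sub>0" "\<rho> - 2 \<noteq> 0"
    using Re_le by (auto simp: complex_nonpos_Reals_iff complex_eq_iff)
  have ne0: "2 - \<rho> + \<i> * of_real X \<noteq> 0" "2 - \<rho> - \<i> * of_real X \<noteq> 0" using ne by auto
  define u where "u = 1 / (\<rho> - 2) * (\<i> / (2 - \<rho> + \<i> * of_real X) + \<i> / (2 - \<rho> - \<i> * of_real X))"
  have "((\<lambda>x. (1 / (\<rho> - 2)) * (Ln (2 - \<rho> + \<i> * of_real x) - Ln (2 - \<rho> - \<i> * of_real x)))
      has_vector_derivative u) (at X)"
    unfolding u_def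
    by (rule has_vector_derivative_real_field)
       (use ne in \<open>auto intro!: derivative_eq_intros simp: divide_inverse algebra_simps\<close>)
  hence "(window \<rho> has_vector_derivative Re u) (at X)"
    unfolding window_def by (rule bounded_linear.has_vector_derivative[OF bounded_linear_Re])
  moreover have "Re u = Re ((1 / (2 + \<i> * of_real X - \<rho>) - 1 / (2 - \<rho>)) - (1 / (2 - \<i> * of_real X - \<rho>) - 1 / (2 - \<rho>))) / X"
  proof -
    have Re_mult_of_real: "Re (z * of_real x) = Re z * x" for z x by simp
    have "u * of_real X = 1 / (2 + \<i> * of_real X - \<rho>) - 1 / (2 - \<i> * of_real X - \<rho>)"
    proof -
      define z where "z = 2 - \<rho>"
      define w where "w = \<i> * of_real X"
      have z: "z \<noteq> 0" "z + w \<noteq> 0" "z - w \<noteq> 0" using ne ne0 by (auto simp: z_def w_def)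
      have "u * of_real X = 1 / (- z) * (w / (z + w) + w / (z - w))"
        by (simp add: u_def z_def w_def algebra_simps)
      also have "w / (z + w) + w / (z - w) = 2 * z * w / ((z + w) * (z - w))"
        using z by (simp add: field_simps)
      also have "1 / (- z) * \<dots> = - 2 * w / ((z + w) * (z - w))" using z by (simp add: field_simps)
      also have "\<dots> = 1 / (z + w) - 1 / (z - w)" using z by (simp add: field_simps)
      finally show ?thesis by (simp add: z_def w_def algebra_simps)
    qed
    hence "Re u * X = Re (1 / (2 + \<i> * of_real X - \<rho>) - 1 / (2 - \<i> * of_real X - \<rho>))"
      by (metis Re_mult_of_real)
    thus ?thesis using assms by (simp add: field_simps)
  qed
  ultimately show ?thesis by (simp add: has_real_derivative_iff_has_vector_derivative)
qed

lemma Re_inverse_line: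
  "Re (1 / (2 + \<i> * of_real t - \<rho>)) = (2 - Re \<rho>) / ((2 - Re \<rho>)\<^sup>2 + (t - Im \<rho>)\<^sup>2)"
  by (simp add: Re_divide)

lemma norm_ge_1: "norm (\<rho> - 2) \<ge> 1"
  using abs_Re_le_cmod[of "\<rho> - 2"] Re_le by simp

lemma norm_ge_Im: "norm (\<rho> - 2) \<ge> \<bar>Im \<rho>\<bar>"
  using abs_Im_le_cmod[of "\<rho> - 2"] by simp

lemma norm_le_Im: "norm (\<rho> - 2) \<le> 2 + \<bar>Im \<rho>\<bar>"
  using cmod_le[of "\<rho> - 2"] Re_le by simp

text \<open>Both numbers under Ln have real part 2 - Re \<rho> > 0, so their arguments are plain
  arctangents without branch correction. The factor 1/(\<rho> - 2) pairs its imaginary part with the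
  angles, which is the main term, and its real part with the logarithms, which is error. The sum of
  the arctangents is even in Im \<rho>, which allows |Im \<rho>|.\<close>

lemma window_decompose:
  assumes "X \<ge> 0"
  shows "window \<rho> X = Im \<rho> / norm (\<rho> - 2) ^ 2 *
      (arctan ((X - \<bar>Im \<rho>\<bar>) / (2 - Re \<rho>)) + arctan ((X + \<bar>Im \<rho>\<bar>) / (2 - Re \<rho>)))
     - (2 - Re \<rho>) / norm (\<rho> - 2) ^ 2 *
      (ln ((2 - Re \<rho>)\<^sup>2 + (X - Im \<rho>)\<^sup>2) - ln ((2 - Re \<rho>)\<^sup>2 + (X + Im \<rho>)\<^sup>2)) / 2"
proof -
  define c where "c = 2 - Re \<rho>"
  have c: "c > 0" using Re_le by (simp add: c_def)
  define w1 w2 where "w1 = 2 - \<rho> + \<i> * of_real X" and "w2 = 2 - \<rho> - \<i> * of_real X"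
  have w: "Re w1 = c" "Im w1 = X - Im \<rho>" "Re w2 = c" "Im w2 = - (X + Im \<rho>)"
    by (auto simp: w1_def w2_def c_def)
  have nz: "w1 \<noteq> 0" "w2 \<noteq> 0" using w c by auto
  have Im: "Im (Ln w1) = arctan ((X - Im \<rho>) / c)" "Im (Ln w2) = - arctan ((X + Im \<rho>) / c)"
  proof -
    show "Im (Ln w1) = arctan ((X - Im \<rho>) / c)" using nz w c by (simp add: Im_Ln_eq)
    have "Im (Ln w2) = arctan (- (X + Im \<rho>) / c)" using nz w c by (simp add: Im_Ln_eq)
    thus "Im (Ln w2) = - arctan ((X + Im \<rho>) / c)" by (metis arctan_minus minus_divide_left)
  qed
  have lnsqrt: "ln (sqrt x) = ln x / 2" if "x > 0" for x using that by (simp add: ln_sqrt)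
  have pos: "c\<^sup>2 + y\<^sup>2 > 0" for y using c by (simp add: add_pos_nonneg)
  have Re: "Re (Ln w1) = ln (c\<^sup>2 + (X - Im \<rho>)\<^sup>2) / 2" "Re (Ln w2) = ln (c\<^sup>2 + (X + Im \<rho>)\<^sup>2) / 2"
  proof -
    have "norm w1 = sqrt (c\<^sup>2 + (X - Im \<rho>)\<^sup>2)" by (simp add: cmod_def w)
    thus "Re (Ln w1) = ln (c\<^sup>2 + (X - Im \<rho>)\<^sup>2) / 2" using nz lnsqrt[OF pos] by simp
    have "norm w2 = sqrt (c\<^sup>2 + (X + Im \<rho>)\<^sup>2)" unfolding cmod_def w by (simp add: power2_eq_square algebra_simps)
    thus "Re (Ln w2) = ln (c\<^sup>2 + (X + Im \<rho>)\<^sup>2) / 2" using nz lnsqrt[OF pos] by simp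
  qed
  have inv: "Re (1 / (\<rho> - 2)) = - c / norm (\<rho> - 2) ^ 2" "Im (1 / (\<rho> - 2)) = - Im \<rho> / norm (\<rho> - 2) ^ 2"
    by (auto simp: Re_divide Im_divide cmod_def c_def)
  have even: "arctan ((X - Im \<rho>) / c) + arctan ((X + Im \<rho>) / c) =
     arctan ((X - \<bar>Im \<rho>\<bar>) / c) + arctan ((X + \<bar>Im \<rho>\<bar>) / c)"
    by (cases "Im \<rho> \<ge> 0") auto
  have "window \<rho> X = Re (1 / (\<rho> - 2)) * (Re (Ln w1) - Re (Ln w2)) - Im (1 / (\<rho> - 2)) * (Im (Ln w1) - Im (Ln w2))"
    unfolding window_def w1_def[symmetric] w2_def[symmetric]
    by (simp only: times_complex.simps minus_complex.simps)
  also have "\<dots> = Im \<rho> / norm (\<rho> - 2) ^ 2 * (arctan ((X - Im \<rho>) / c) + arctan ((X + Im \<rho>) / c))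
     - c / norm (\<rho> - 2) ^ 2 * (ln (c\<^sup>2 + (X - Im \<rho>)\<^sup>2) - ln (c\<^sup>2 + (X + Im \<rho>)\<^sup>2)) / 2"
    unfolding inv Im Re by (simp add: field_simps)
  finally show ?thesis unfolding c_def even[unfolded c_def] .
qed

text \<open>As X passes |Im \<rho>|, the angle swings from near 0 to near pi over a transition of
  bounded width: below, the two arctangents nearly cancel; above, each is close to pi/2.\<close>

lemma window_angle_error:
  assumes "X \<ge> 0"
  defines "A \<equiv> arctan ((X - \<bar>Im \<rho>\<bar>) / (2 - Re \<rho>)) + arctan ((X + \<bar>Im \<rho>\<bar>) / (2 - Re \<rho>))"
  shows "\<bar>A - (if \<bar>Im \<rho>\<bar> \<le> X then pi else 0)\<bar> \<le> 16 / (1 + \<bar>X - \<bar>Im \<rho>\<bar>\<bar>)"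
proof -
  define c where "c = 2 - Re \<rho>"
  define y where "y = \<bar>Im \<rho>\<bar>"
  have c: "c \<ge> 1" "c \<le> 2" using Re_le by (auto simp: c_def)
  have y: "y \<ge> 0" by (simp add: y_def)
  have bd: "0 \<le> pi / 2 - arctan (d / c)" "pi / 2 - arctan (d / c) \<le> 8 / (1 + d)" if "d \<ge> 0" for d
  proof -
    show "0 \<le> pi / 2 - arctan (d / c)" using arctan_ubound[of "d / c"] by simp
    have "pi / 2 - arctan (d / c) \<le> 4 / (1 + d / c)" using half_pi_minus_arctan_le[of "d / c"] that c by simp
    also have "\<dots> = 4 * c / (c + d)" using c by (simp add: field_simps)
    also have "\<dots> \<le> 8 / (1 + d)" using c that by (intro frac_le) auto
    finally show "pi / 2 - arctan (d / c) \<le> 8 / (1 + d)" .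
  qed
  show ?thesis
  proof (cases "y \<le> X")
    case True
    have "8 / (1 + (X + y)) \<le> 8 / (1 + (X - y))" using True y by (intro divide_left_mono) auto
    thus ?thesis using bd[of "X - y"] bd[of "X + y"] True assms(1) y
      unfolding A_def c_def[symmetric] y_def[symmetric] by simp
  next
    case False
    have "arctan ((X - y) / c) = - arctan ((y - X) / c)"
      by (metis arctan_minus minus_diff_eq minus_divide_left)
    moreover have "arctan ((y - X) / c) \<le> arctan ((X + y) / c)"
      using c assms(1) by (intro arctan_monotone' divide_right_mono) auto
    moreover have "8 / (1 + (y - X)) \<le> 16 / (1 + (y - X))" using False by (intro divide_right_mono) auto
    ultimately show ?thesis using bd[of "y - X"] bd(1)[of "X + y"] False assms(1) y
      unfolding A_def c_def[symmetric] y_def[symmetric] by simp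
  qed
qed

text \<open>If |Im \<rho>| <= X/2, the quotient a/b is 1 + O(|Im \<rho>| / X). Otherwise it is at
  most (3v)^2 with v = |\<rho> - 2|, its logarithm is O(v^(1/4)), and v > X/2. In both cases the
  half power between v^(-2) and v^(-3/2) is spent on decay in X.\<close>

lemma window_log_error:
  assumes X: "X \<ge> 4"
  shows "\<bar>(2 - Re \<rho>) / norm (\<rho> - 2) ^ 2 *
      (ln ((2 - Re \<rho>)\<^sup>2 + (X - Im \<rho>)\<^sup>2) - ln ((2 - Re \<rho>)\<^sup>2 + (X + Im \<rho>)\<^sup>2)) / 2\<bar>
     \<le> 32 * (norm (\<rho> - 2) powr (- 3 / 2) * X powr (- 1 / 4))"
proof -
  define c where "c = 2 - Re \<rho>"
  define y where "y = \<bar>Im \<rho>\<bar>"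
  define v where "v = norm (\<rho> - 2)"
  have c: "c \<ge> 1" "c \<le> 2" using Re_le by (auto simp: c_def)
  have v: "v \<ge> 1" "v \<ge> y" "v \<le> 2 + y" using norm_ge_1 norm_ge_Im norm_le_Im by (auto simp: v_def y_def)
  have y0: "y \<ge> 0" by (simp add: y_def)
  define a b where "a = c\<^sup>2 + (X + y)\<^sup>2" and "b = c\<^sup>2 + (X - y)\<^sup>2"
  have b1: "b \<ge> 1" using c unfolding b_def by (smt (verit) one_power2 power2_le_imp_le power_mono zero_le_power2)
  have ab: "a = b + 4 * X * y" by (simp add: a_def b_def power2_eq_square algebra_simps)
  have Xy: "X * y \<ge> 0" using X y0 by simp
  have eq: "\<bar>ln (c\<^sup>2 + (X - Im \<rho>)\<^sup>2) - ln (c\<^sup>2 + (X + Im \<rho>)\<^sup>2)\<bar> = ln (a / b)"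
  proof -
    have "ln a \<ge> ln b" using b1 ab Xy by simp
    moreover have "ln (a / b) = ln a - ln b" using b1 ab Xy by (simp add: ln_div)
    moreover have "(c\<^sup>2 + (X - Im \<rho>)\<^sup>2 = b \<and> c\<^sup>2 + (X + Im \<rho>)\<^sup>2 = a) \<or> (c\<^sup>2 + (X - Im \<rho>)\<^sup>2 = a \<and> c\<^sup>2 + (X + Im \<rho>)\<^sup>2 = b)"
      by (cases "Im \<rho> \<ge> 0") (auto simp: a_def b_def y_def)
    ultimately show ?thesis by auto
  qed
  have key: "ln (a / b) / v\<^sup>2 \<le> 32 * (v powr (- 3 / 2) * X powr (- 1 / 4))"
  proof (cases "y \<le> X / 2")
    case True
    have "(X / 2)\<^sup>2 \<le> (X - y)\<^sup>2" using True X by (intro power_mono) auto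
    hence "X\<^sup>2 / 4 \<le> (X - y)\<^sup>2" by (simp add: power_divide)
    hence bX: "b \<ge> X\<^sup>2 / 4" unfolding b_def using zero_le_power2[of c] by linarith
    have "a / b = 1 + 4 * X * y / b" using b1 by (simp add: ab field_simps)
    also have "\<dots> \<le> 1 + 4 * X * y / (X\<^sup>2 / 4)" using bX X Xy b1 by (intro add_left_mono divide_left_mono) auto
    also have "\<dots> = 1 + 16 * y / X" using X by (simp add: field_simps power2_eq_square)
    finally have "a / b \<le> 1 + 16 * y / X" .
    moreover have "a / b > 0" using b1 ab Xy by simp
    ultimately have "ln (a / b) \<le> ln (1 + 16 * y / X)" by simp
    also have "\<dots> \<le> 16 * y / X" using X y0 by (intro ln_add_one_self_le_self) auto
    also have "\<dots> \<le> 16 * v / X" using X v by (intro divide_right_mono) auto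
    finally have "ln (a / b) / v\<^sup>2 \<le> 16 * v / X / v\<^sup>2" by (intro divide_right_mono) auto
    also have "\<dots> = 16 * (v powr (- 3 / 2) * (v powr (1 / 2) / X))"
    proof -
      have "v powr (- 3 / 2) * v powr (1 / 2) = v powr (- 1)" by (simp flip: powr_add)
      also have "\<dots> = 1 / v" using v by (simp add: powr_minus_divide)
      finally have pv: "v powr (- 3 / 2) * v powr (1 / 2) = 1 / v" .
      have "16 * v / X / v\<^sup>2 = 16 * (1 / v / X)" using v by (simp add: power2_eq_square)
      thus ?thesis unfolding pv[symmetric] by (simp only: times_divide_eq_right)
    qed
    also have "v powr (1 / 2) / X \<le> X powr (- 1 / 4)"
    proof -
      \<comment> \<open>Here v <= 2 + |Im \<rho>| <= 2 + X/2 <= X, by X >= 4.\<close>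
      have "v powr (1 / 2) / X \<le> X powr (1 / 2) / X"
        using v X True by (intro divide_right_mono powr_mono2) auto
      also have "\<dots> = X powr (1 / 2 - 1)" using X unfolding powr_diff by simp
      also have "\<dots> \<le> X powr (- 1 / 4)" using X by (intro powr_mono) auto
      finally show ?thesis .
    qed
    finally have "ln (a / b) / v\<^sup>2 \<le> 16 * (v powr (- 3 / 2) * X powr (- 1 / 4))"
      using v by (simp add: mult_left_mono)
    thus ?thesis by (smt (verit) mult_nonneg_nonneg powr_ge_zero)
  next
    case False
    have "a / b = 1 + 4 * X * y / b" using b1 by (simp add: ab field_simps)
    also have "\<dots> \<le> 1 + 4 * X * y / 1" using b1 Xy by (intro add_left_mono divide_left_mono) auto
    also have "\<dots> \<le> 1 + 8 * y * y" using False X y0 by (simp add: mult_right_mono)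
    also have "\<dots> \<le> 9 * (v * v)" using mult_mono[OF v(1) v(1)] mult_mono[OF v(2) v(2)] v y0 by simp
    finally have "a / b \<le> (3 * v)\<^sup>2" by (simp add: power2_eq_square)
    moreover have "a / b > 0" using b1 ab Xy by simp
    ultimately have "ln (a / b) \<le> ln ((3 * v)\<^sup>2)" by (rule ln_mono)
    also have "\<dots> = 2 * ln (3 * v)" by (subst ln_realpow) (use v in auto)
    also have "ln (3 * v) \<le> 4 * (3 * v) powr (1 / 4)" using v by (intro ln_le_powr) auto
    also have "(3 * v) powr (1 / 4) = 3 powr (1 / 4) * v powr (1 / 4)" using v by (simp add: powr_mult)
    also have "3 powr (1 / 4) \<le> (16 :: real) powr (1 / 4)" by (intro powr_mono2) auto
    also have "(16 :: real) powr (1 / 4) = 2"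
    proof -
      have "(16 :: real) = 2 powr 4" by simp
      hence "(16 :: real) powr (1 / 4) = 2 powr (4 * (1 / 4))" by (simp only: powr_powr)
      thus ?thesis by simp
    qed
    finally have "ln (a / b) \<le> 16 * v powr (1 / 4)" by (simp add: mult_right_mono)
    hence "ln (a / b) / v\<^sup>2 \<le> 16 * v powr (1 / 4) / v\<^sup>2" by (intro divide_right_mono) auto
    also have "\<dots> = 16 * (v powr (1 / 4) * v powr (- 2))"
      using v by (simp add: powr_minus_divide)
    also have "v powr (1 / 4) * v powr (- 2) = v powr (- 3 / 2) * v powr (- 1 / 4)" by (simp flip: powr_add)
    also have "v powr (- 1 / 4) \<le> (X / 2) powr (- 1 / 4)"
      using v False X by (intro powr_mono2') auto
    also have "(X / 2) powr (- 1 / 4) = X powr (- 1 / 4) * 2 powr (1 / 4)"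
      using X by (simp add: powr_divide powr_minus_divide)
    also have "2 powr (1 / 4) \<le> (2 :: real) powr 1" by (intro powr_mono) auto
    finally have "ln (a / b) / v\<^sup>2 \<le> 16 * (v powr (- 3 / 2) * (X powr (- 1 / 4) * 2))"
      using v by (simp add: mult_left_mono)
    thus ?thesis by simp
  qed
  have "\<bar>c / v\<^sup>2 * (ln (c\<^sup>2 + (X - Im \<rho>)\<^sup>2) - ln (c\<^sup>2 + (X + Im \<rho>)\<^sup>2)) / 2\<bar> = c / 2 * (ln (a / b) / v\<^sup>2)"
    unfolding eq[symmetric] using c by (simp add: abs_mult)
  also have "\<dots> \<le> 1 * (ln (a / b) / v\<^sup>2)"
    using c b1 ab Xy by (intro mult_right_mono divide_nonneg_nonneg) auto
  finally show ?thesis using key unfolding c_def v_def by simp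
qed

text \<open>A zero whose height differs from X by d causes an angle error of order 1 / (v (1 + d))
  with v = |\<rho> - 2|; d gives no help for zeros near that height. The error is split between the
  weight \<open>w\<close>, summable over all zeros, and the Poisson kernels \<open>P X\<close> and
  \<open>P (- X)\<close>, whose sums over the zeros grow only logarithmically; both parts receive a
  negative power of X.\<close>

lemma window_error:
  assumes X: "X \<ge> 4"
  defines "P \<equiv> (\<lambda>t. Re (1 / (2 + \<i> * of_real t - \<rho>)))" and "w \<equiv> norm (\<rho> - 2) powr (- 3 / 2)"
  shows "\<bar>window \<rho> X - (if \<bar>Im \<rho>\<bar> \<le> X then pi * Im \<rho> / norm (\<rho> - 2) ^ 2 else 0)\<bar> \<le>
     w * (16 * X powr (- 1 / 8) + 64 * X powr (- 11 / 8) + 32 * X powr (- 1 / 4))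
     + (P X + P (- X)) * (64 * X powr (- 1 / 8))"
proof -
  define y where "y = \<bar>Im \<rho>\<bar>"
  define v where "v = norm (\<rho> - 2)"
  have v: "v \<ge> 1" "v \<ge> y" "v \<le> 2 + y" using norm_ge_1 norm_ge_Im norm_le_Im by (auto simp: v_def y_def)
  have y0: "y \<ge> 0" by (simp add: y_def)
  define d where "d = \<bar>X - y\<bar>"
  have d0: "d \<ge> 0" by (simp add: d_def)
  define A where "A = arctan ((X - \<bar>Im \<rho>\<bar>) / (2 - Re \<rho>)) + arctan ((X + \<bar>Im \<rho>\<bar>) / (2 - Re \<rho>))"
  have c: "2 - Re \<rho> \<ge> 1" "2 - Re \<rho> \<le> 2" using Re_le by auto
  \<comment> \<open>One of the heights X and -X, depending on the sign of Im \<rho>, differs from Im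
    \<rho> by exactly d, and the kernel at the other is nonnegative. The horizontal distance lies
    between 1 and 2.\<close>
  have Pge: "1 / (1 + d)\<^sup>2 \<le> 4 * (P X + P (- X))"
  proof -
    have Pnn: "P t \<ge> 0" for t unfolding P_def Re_inverse_line using c by auto
    have Pt: "1 / (1 + d)\<^sup>2 \<le> 4 * P t" if "\<bar>t - Im \<rho>\<bar> = d" for t
    proof -
      have "(2 - Re \<rho>)\<^sup>2 + (t - Im \<rho>)\<^sup>2 = (2 - Re \<rho>)\<^sup>2 + d\<^sup>2" using that by (metis power2_abs)
      moreover have "(2 - Re \<rho>)\<^sup>2 \<le> 4" using power_mono[OF c(2), of 2] c by simp
      moreover have "d\<^sup>2 \<ge> 0" by simp
      moreover have "(1 + d)\<^sup>2 = 1 + 2 * d + d\<^sup>2" by (simp add: power2_eq_square algebra_simps)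
      ultimately have *: "(2 - Re \<rho>)\<^sup>2 + (t - Im \<rho>)\<^sup>2 \<le> 4 * (1 + d)\<^sup>2" using d0 by linarith
      have "1 / (4 * (1 + d)\<^sup>2) \<le> (2 - Re \<rho>) / ((2 - Re \<rho>)\<^sup>2 + (t - Im \<rho>)\<^sup>2)"
        using * c d0 by (intro frac_le) (auto simp: add_pos_nonneg)
      moreover have "1 / (1 + d)\<^sup>2 = 4 * (1 / (4 * (1 + d)\<^sup>2))" by simp
      ultimately show ?thesis unfolding P_def Re_inverse_line by linarith
    qed
    have "\<bar>X - Im \<rho>\<bar> = d \<or> \<bar>- X - Im \<rho>\<bar> = d" by (auto simp: d_def y_def)
    thus ?thesis using Pt Pnn[of X] Pnn[of "-X"] by fastforce
  qed
  \<comment> \<open>This is p q <= p^2 + q^2, with powers of X inserted so that p^2 carries X^(-1/8)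
    and q^2 carries X^(1/8); the latter is outweighed by the X^(-1/4) gained next.\<close>
  have amgm: "1 / (v * (1 + d)) \<le> X powr (- 1 / 8) * w + X powr (1 / 8) * (v powr (- 1 / 2) / (1 + d)\<^sup>2)"
  proof -
    define p q where "p = X powr (- 1 / 16) * v powr (- 3 / 4)" and "q = X powr (1 / 16) * (v powr (- 1 / 4) / (1 + d))"
    have "p * q = (X powr (- 1 / 16) * X powr (1 / 16)) * (v powr (- 3 / 4) * v powr (- 1 / 4)) / (1 + d)"
      by (simp add: p_def q_def)
    also have "X powr (- 1 / 16) * X powr (1 / 16) = 1" using X by (simp flip: powr_add)
    also have "v powr (- 3 / 4) * v powr (- 1 / 4) = v powr (- 1)" by (simp flip: powr_add)
    also have "v powr (- 1) = 1 / v" using v by (simp add: powr_minus_divide)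
    also have "1 * (1 / v) / (1 + d) = 1 / (v * (1 + d))" by simp
    finally have pq: "p * q = 1 / (v * (1 + d))" .
    have p2: "p * p = X powr (- 1 / 8) * w"
    proof -
      have "p * p = (X powr (- 1 / 16) * X powr (- 1 / 16)) * (v powr (- 3 / 4) * v powr (- 3 / 4))"
        by (simp add: p_def mult_ac)
      thus ?thesis by (simp add: w_def v_def flip: powr_add)
    qed
    have q2: "q * q = X powr (1 / 8) * (v powr (- 1 / 2) / (1 + d)\<^sup>2)"
    proof -
      have "q * q = (X powr (1 / 16) * X powr (1 / 16)) * (v powr (- 1 / 4) * v powr (- 1 / 4)) / (1 + d)\<^sup>2"
        by (simp add: q_def mult_ac power2_eq_square)
      thus ?thesis by (simp flip: powr_add)
    qed
    have "0 \<le> (p - q) * (p - q)" by simp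
    moreover have "p * q \<ge> 0" unfolding pq using v d0 by simp
    ultimately have "p * q \<le> p * p + q * q" by (simp add: algebra_simps)
    thus ?thesis using pq p2 q2 by simp
  qed
  \<comment> \<open>A zero with v >= sqrt X has v^(-1/2) <= X^(-1/4). Any other zero lies low: then
    d >= X/2, and v^(-1/2) = v^(-3/2) v <= w sqrt X.\<close>
  have near: "v powr (- 1 / 2) / (1 + d)\<^sup>2 \<le> X powr (- 1 / 4) * (4 * (P X + P (- X))) + 4 * X powr (- 3 / 2) * w"
  proof (cases "v \<ge> X powr (1 / 2)")
    case True
    have "v powr (- 1 / 2) \<le> (X powr (1 / 2)) powr (- 1 / 2)" using True X by (intro powr_mono2') auto
    also have "\<dots> = X powr (- 1 / 4)" by (simp add: powr_powr)
    finally have "v powr (- 1 / 2) * (1 / (1 + d)\<^sup>2) \<le> X powr (- 1 / 4) * (4 * (P X + P (- X)))"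
      using Pge by (intro mult_mono) auto
    moreover have "4 * X powr (- 3 / 2) * w \<ge> 0" by (simp add: w_def)
    moreover have "v powr (- 1 / 2) * (1 / (1 + d)\<^sup>2) = v powr (- 1 / 2) / (1 + d)\<^sup>2" by simp
    ultimately show ?thesis by linarith
  next
    case False
    have "X powr (1 / 2) \<le> X / 2"
    proof -
      have "(2 :: real) = 4 powr (1 / 2)" by (simp add: powr_half_sqrt)
      also have "\<dots> \<le> X powr (1 / 2)" using X by (intro powr_mono2) auto
      finally have "2 * X powr (1 / 2) \<le> X powr (1 / 2) * X powr (1 / 2)" by (intro mult_right_mono) auto
      also have "\<dots> = X" using X by (simp flip: powr_add)
      finally show ?thesis by simp
    qed
    hence "1 + d \<ge> X / 2" using False v by (simp add: d_def)
    hence "(X / 2)\<^sup>2 \<le> (1 + d)\<^sup>2" using X by (intro power_mono) auto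
    hence "v powr (- 1 / 2) / (1 + d)\<^sup>2 \<le> v powr (- 1 / 2) / (X / 2)\<^sup>2"
      using X d0 by (intro divide_left_mono) auto
    also have "\<dots> = 4 * (v powr (- 1 / 2) * X powr (- 2))" using X by (simp add: powr_minus_divide power_divide)
    also have "\<dots> \<le> 4 * ((w * X powr (1 / 2)) * X powr (- 2))"
    proof (intro mult_left_mono mult_right_mono)
      have "v powr (- 1 / 2) = v powr (- 3 / 2) * v powr 1"
        by (simp flip: powr_add del: powr_one powr_one')
      also have "\<dots> \<le> w * X powr (1 / 2)"
        using False v unfolding w_def v_def[symmetric] by (intro mult_left_mono) auto
      finally show "v powr (- 1 / 2) \<le> w * X powr (1 / 2)" .
    qed auto
    also have "\<dots> = 4 * (w * (X powr (1 / 2) * X powr (- 2)))" by simp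
    also have "X powr (1 / 2) * X powr (- 2) = X powr (- 3 / 2)" by (simp flip: powr_add)
    finally have "v powr (- 1 / 2) / (1 + d)\<^sup>2 \<le> 4 * X powr (- 3 / 2) * w" by (simp add: mult_ac)
    moreover have "4 * (P X + P (- X)) \<ge> 0" using order_trans[OF _ Pge, of 0] by simp
    hence "X powr (- 1 / 4) * (4 * (P X + P (- X))) \<ge> 0" by (intro mult_nonneg_nonneg) auto
    ultimately show ?thesis by simp
  qed
  have "\<bar>Im \<rho> / v\<^sup>2 * A - (if \<bar>Im \<rho>\<bar> \<le> X then pi * Im \<rho> / v\<^sup>2 else 0)\<bar> =
      \<bar>Im \<rho> / v\<^sup>2 * (A - (if \<bar>Im \<rho>\<bar> \<le> X then pi else 0))\<bar>"
    by (rule arg_cong[of _ _ abs], cases "\<bar>Im \<rho>\<bar> \<le> X")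
       (simp_all add: right_diff_distrib diff_divide_distrib mult_ac)
  also have "\<dots> = y / v\<^sup>2 * \<bar>A - (if \<bar>Im \<rho>\<bar> \<le> X then pi else 0)\<bar>"
    by (simp add: abs_mult y_def)
  also have "\<dots> \<le> v / v\<^sup>2 * (16 / (1 + d))"
    using window_angle_error[of X] X v y0
    by (intro mult_mono divide_right_mono) (auto simp: A_def d_def y_def)
  also have "\<dots> = 16 * (1 / (v * (1 + d)))" using v by (simp add: power2_eq_square)
  also have "\<dots> \<le> 16 * (X powr (- 1 / 8) * w + X powr (1 / 8) *
      (X powr (- 1 / 4) * (4 * (P X + P (- X))) + 4 * X powr (- 3 / 2) * w))"
    using amgm mult_left_mono[OF near, of "X powr (1 / 8)"] by simp
  also have "\<dots> = 16 * X powr (- 1 / 8) * w + 64 * (X powr (1 / 8) * X powr (- 1 / 4)) * (P X + P (- X))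
      + 64 * (X powr (1 / 8) * X powr (- 3 / 2)) * w"
    by (simp add: algebra_simps)
  also have "X powr (1 / 8) * X powr (- 1 / 4) = X powr (- 1 / 8)" by (simp flip: powr_add)
  also have "X powr (1 / 8) * X powr (- 3 / 2) = X powr (- 11 / 8)" by (simp flip: powr_add)
  finally have 1: "\<bar>Im \<rho> / v\<^sup>2 * A - (if \<bar>Im \<rho>\<bar> \<le> X then pi * Im \<rho> / v\<^sup>2 else 0)\<bar> \<le>
     16 * X powr (- 1 / 8) * w + 64 * X powr (- 1 / 8) * (P X + P (- X)) + 64 * X powr (- 11 / 8) * w" .
  define g where "g = (2 - Re \<rho>) / v ^ 2 *
      (ln ((2 - Re \<rho>)\<^sup>2 + (X - Im \<rho>)\<^sup>2) - ln ((2 - Re \<rho>)\<^sup>2 + (X + Im \<rho>)\<^sup>2)) / 2"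
  have "window \<rho> X = Im \<rho> / v\<^sup>2 * A - g"
    using window_decompose[of X] X by (simp add: A_def v_def g_def)
  moreover have "\<bar>g\<bar> \<le> 32 * (w * X powr (- 1 / 4))"
    using window_log_error[OF X] unfolding g_def v_def w_def .
  ultimately have "\<bar>window \<rho> X - (if \<bar>Im \<rho>\<bar> \<le> X then pi * Im \<rho> / v\<^sup>2 else 0)\<bar> \<le>
     16 * X powr (- 1 / 8) * w + 64 * X powr (- 1 / 8) * (P X + P (- X)) + 64 * X powr (- 11 / 8) * w
     + 32 * (w * X powr (- 1 / 4))"
    using 1 by linarith
  also have "\<dots> = w * (16 * X powr (- 1 / 8) + 64 * X powr (- 11 / 8) + 32 * X powr (- 1 / 4))
     + (P X + P (- X)) * (64 * X powr (- 1 / 8))"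
    by (simp add: algebra_simps)
  finally show ?thesis unfolding v_def .
qed

end

text \<open>The bound \<alpha> < 3/2 gives both the summability of |\<rho> - 2|^(-3/2) over the
  zeros and, for R >= t^2, the boundedness of R^(\<alpha> - 2) t.\<close>

locale strip_zeros = entire_growth f 2 C \<alpha> for f C \<alpha> +
  assumes strip: "\<And>\<rho>. f \<rho> = 0 \<Longrightarrow> 0 \<le> Re \<rho> \<and> Re \<rho> \<le> 1"
    and \<alpha>_less: "\<alpha> < 3 / 2"
begin

definition zeros_below :: "real \<Rightarrow> complex set" where
  "zeros_below T = {\<rho> \<in> zeros. \<bar>Im \<rho>\<bar> \<le> T}"

lemma zeros_strip: "\<rho> \<in> zeros \<Longrightarrow> 0 \<le> Re \<rho>" "\<rho> \<in> zeros \<Longrightarrow> Re \<rho> \<le> 1"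
  using strip by (auto simp: zeros_def)

lemma zeros_below_subset_upto: "T + 2 \<le> R \<Longrightarrow> zeros_below T \<subseteq> zeros_upto R"
  using norm_le_Im zeros_strip by (fastforce simp: zeros_below_def zeros_upto_def)

lemma finite_zeros_below [simp, intro]: "finite (zeros_below T)"
  using finite_subset[OF zeros_below_subset_upto[OF order_refl]] by blast

lemma zeros_below_subset: "zeros_below T \<subseteq> zeros"
  by (auto simp: zeros_below_def)

lemma norm_zero_ge_1: "\<rho> \<in> zeros \<Longrightarrow> norm (\<rho> - 2) \<ge> 1"
  using norm_ge_1 zeros_strip by blast

lemma line_nonzero: "f (2 + \<i> * of_real t) \<noteq> 0" "f (2 - \<i> * of_real t) \<noteq> 0"
  using strip[of "2 + \<i> * of_real t"] strip[of "2 - \<i> * of_real t"] by auto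

lemma zero_sum_bound:
  obtains S where "\<And>A. finite A \<Longrightarrow> A \<subseteq> zeros \<Longrightarrow> (\<Sum>\<rho>\<in>A. zmult \<rho> * norm (\<rho> - 2) powr (- 3 / 2)) \<le> S"
  using weighted_zero_sum_bound[of "3 / 2"] norm_zero_ge_1 \<alpha>_less by auto

lemma summable_zeros:
  "(\<lambda>\<rho>. zmult \<rho> * norm (\<rho> - 2) powr (- 3 / 2)) summable_on zeros"
proof -
  obtain S where "\<And>A. finite A \<Longrightarrow> A \<subseteq> zeros \<Longrightarrow> (\<Sum>\<rho>\<in>A. zmult \<rho> * norm (\<rho> - 2) powr (- 3 / 2)) \<le> S"
    using zero_sum_bound by blast
  thus ?thesis
    by (intro nonneg_bdd_above_summable_on bdd_aboveI[of _ S]) (auto simp: zmult_nonneg)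
qed

lemma summable_zeros_comparison:
  fixes g :: "complex \<Rightarrow> 'b :: banach"
  assumes "\<And>\<rho>. \<rho> \<in> zeros \<Longrightarrow> norm (g \<rho>) \<le> K * (zmult \<rho> / norm (\<rho> - 2) ^ 2)"
  shows "g summable_on zeros"
proof (rule abs_summable_summable, rule summable_on_comparison_test)
  show "(\<lambda>\<rho>. \<bar>K\<bar> * (zmult \<rho> * norm (\<rho> - 2) powr (- 3 / 2))) summable_on zeros"
    by (rule summable_on_cmult_right[OF summable_zeros])
  fix \<rho> assume \<rho>: "\<rho> \<in> zeros"
  have v: "norm (\<rho> - 2) \<ge> 1" using norm_zero_ge_1[OF \<rho>] .
  have le: "norm (\<rho> - 2) powr (- 2) \<le> norm (\<rho> - 2) powr (- 3 / 2)" using v by (intro powr_mono) auto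
  hence "zmult \<rho> / norm (\<rho> - 2) ^ 2 \<le> zmult \<rho> * norm (\<rho> - 2) powr (- 3 / 2)"
    using mult_left_mono[OF le zmult_nonneg[OF \<rho>]] v by (simp add: powr_minus_divide)
  hence "\<bar>K\<bar> * (zmult \<rho> / norm (\<rho> - 2) ^ 2) \<le> \<bar>K\<bar> * (zmult \<rho> * norm (\<rho> - 2) powr (- 3 / 2))"
    by (intro mult_left_mono) auto
  moreover have "K * (zmult \<rho> / norm (\<rho> - 2) ^ 2) \<le> \<bar>K\<bar> * (zmult \<rho> / norm (\<rho> - 2) ^ 2)"
    using zmult_nonneg[OF \<rho>] by (intro mult_right_mono) auto
  ultimately show "norm (g \<rho>) \<le> \<bar>K\<bar> * (zmult \<rho> * norm (\<rho> - 2) powr (- 3 / 2))"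
    using assms[OF \<rho>] by linarith
qed auto

text \<open>Every finite set of zeros is eventually contained in the truncations by height, so an
  unconditionally convergent sum is also the limit of its truncated sums.\<close>

lemma filterlim_zeros_below: "filterlim zeros_below (finite_subsets_at_top zeros) at_top"
  unfolding filterlim_def le_filter_def eventually_filtermap eventually_finite_subsets_at_top
proof (intro allI impI)
  fix P assume "\<exists>X. finite X \<and> X \<subseteq> zeros \<and> (\<forall>Y. finite Y \<and> X \<subseteq> Y \<and> Y \<subseteq> zeros \<longrightarrow> P Y)"
  then obtain X where X: "finite X \<and> X \<subseteq> zeros \<and> (\<forall>Y. finite Y \<and> X \<subseteq> Y \<and> Y \<subseteq> zeros \<longrightarrow> P Y)" ..
  define T where "T = Max (insert 0 ((\<lambda>\<rho>. \<bar>Im \<rho>\<bar>) ` X))"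
  have "\<bar>Im \<rho>\<bar> \<le> T" if "\<rho> \<in> X" for \<rho> unfolding T_def using that X by (intro Max_ge) auto
  hence "X \<subseteq> zeros_below t" if "t \<ge> T" for t
    using that X by (force simp: zeros_below_def)
  hence "P (zeros_below t)" if "t \<ge> T" for t
    using that X finite_zeros_below zeros_below_subset by simp
  thus "eventually (\<lambda>t. P (zeros_below t)) at_top"
    using eventually_ge_at_top[of T] by (rule eventually_mono[rotated]) auto
qed

lemma tendsto_zeros_below:
  assumes "g summable_on zeros"
  shows "((\<lambda>T. \<Sum>\<rho>\<in>zeros_below T. g \<rho>) \<longlongrightarrow> infsum g zeros) at_top"
  using filterlim_compose[OF _ filterlim_zeros_below] has_sum_infsum[OF assms]
  unfolding has_sum_def by blast

lemma powr_exponent_le: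
  assumes "R \<ge> 1" "t \<ge> 1" "R \<ge> t\<^sup>2"
  shows "R powr (\<alpha> - 2) * t \<le> 1"
proof -
  have "R powr (\<alpha> - 2) \<le> R powr (- 1 / 2)" using assms \<alpha>_less by (intro powr_mono) auto
  also have "\<dots> \<le> (t\<^sup>2) powr (- 1 / 2)" using assms by (intro powr_mono2') auto
  also have "\<dots> = 1 / t" using assms by (simp add: powr_minus_divide powr_half_sqrt)
  finally show ?thesis using assms by (simp add: field_simps)
qed

text \<open>On the line Re s = 2 every term Re 1/(s - \<rho>) is nonnegative, because all zeros lie
  to the left. An upper bound for Re f'/f therefore bounds each partial sum, uniformly in the finite
  set \<open>A\<close>.\<close>

lemma local_density:
  assumes K: "\<And>t. \<bar>t\<bar> \<ge> 1 \<Longrightarrow> Re (deriv f (2 + \<i> * of_real t) / f (2 + \<i> * of_real t)) \<le> K * (1 + ln \<bar>t\<bar>)"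
  obtains D where "D \<ge> 0" "\<And>t A. \<bar>t\<bar> \<ge> 1 \<Longrightarrow> finite A \<Longrightarrow> A \<subseteq> zeros \<Longrightarrow>
     (\<Sum>\<rho>\<in>A. zmult \<rho> * Re (1 / (2 + \<i> * of_real t - \<rho>))) \<le> D * (1 + ln \<bar>t\<bar>)"
proof -
  obtain S where S: "\<And>A. finite A \<Longrightarrow> A \<subseteq> zeros \<Longrightarrow> (\<Sum>\<rho>\<in>A. zmult \<rho> * norm (\<rho> - 2) powr (- 3 / 2)) \<le> S"
    using zero_sum_bound by blast
  obtain K2 where K2: "K2 > 0" "\<And>R s. R \<ge> 1 \<Longrightarrow> norm (s - 2) \<le> R / 2 \<Longrightarrow> f s \<noteq> 0 \<Longrightarrow>
       norm (deriv f s / f s - deriv f 2 / f 2 -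
         (\<Sum>\<rho>\<in>zeros_upto R. of_real (zmult \<rho>) * (1 / (s - \<rho>) - 1 / (2 - \<rho>))))
       \<le> K2 * R powr (\<alpha> - 2) * norm (s - 2)"
    using logderiv_partial_fractions by blast
  define D where "D = max 0 K + \<bar>Re (deriv f 2 / f 2)\<bar> + 2 * \<bar>S\<bar> + K2"
  have D0: "D \<ge> 0" using K2(1) by (simp add: D_def)
  have "(\<Sum>\<rho>\<in>A. zmult \<rho> * Re (1 / (2 + \<i> * of_real t - \<rho>))) \<le> D * (1 + ln \<bar>t\<bar>)"
    if t: "\<bar>t\<bar> \<ge> 1" and A: "finite A" "A \<subseteq> zeros" for t A
  proof -
    define s where "s = 2 + \<i> * of_real t"
    \<comment> \<open>The disc has to contain \<open>A\<close>; R >= 2 |t| admits the expansion at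
      \<open>s\<close>, and R >= t^2 makes its error at most K2.\<close>
    obtain R where R: "R \<ge> max (2 * \<bar>t\<bar>) (\<bar>t\<bar>\<^sup>2)" "A \<subseteq> zeros_upto R"
      using finite_subset_zeros_upto[OF A] by blast
    have ns: "norm (s - 2) = \<bar>t\<bar>" by (simp add: s_def norm_mult)
    have R1: "R \<ge> 1" using R(1) t by simp
    have pos: "Re (1 / (s - \<rho>)) \<ge> 0" "Re (1 / (2 - \<rho>)) \<le> 2 * norm (\<rho> - 2) powr (- 3 / 2)" if \<rho>: "\<rho> \<in> zeros" for \<rho>
    proof -
      show "Re (1 / (s - \<rho>)) \<ge> 0" unfolding s_def Re_inverse_line[OF zeros_strip[OF \<rho>]]
        using zeros_strip[OF \<rho>] by auto
      have v: "norm (\<rho> - 2) \<ge> 1" using norm_zero_ge_1[OF \<rho>] .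
      have "Re (1 / (2 - \<rho>)) = (2 - Re \<rho>) / norm (\<rho> - 2) ^ 2"
        by (simp add: Re_divide cmod_power2 power2_commute)
      also have "\<dots> \<le> 2 / norm (\<rho> - 2) ^ 2" using zeros_strip[OF \<rho>] by (intro divide_right_mono) auto
      also have "\<dots> = 2 * norm (\<rho> - 2) powr (- 2)" using v by (simp add: powr_minus_divide)
      also have "\<dots> \<le> 2 * norm (\<rho> - 2) powr (- 3 / 2)" using v by (intro mult_left_mono powr_mono) auto
      finally show "Re (1 / (2 - \<rho>)) \<le> 2 * norm (\<rho> - 2) powr (- 3 / 2)" .
    qed
    have Re_of_real_mult: "Re (of_real x * w) = x * Re w" for x w by simp
    have "Re (\<Sum>\<rho>\<in>zeros_upto R. of_real (zmult \<rho>) * (1 / (s - \<rho>) - 1 / (2 - \<rho>))) \<le>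
       Re (deriv f s / f s - deriv f 2 / f 2) + K2 * R powr (\<alpha> - 2) * norm (s - 2)"
    proof -
      have "norm (s - 2) \<le> R / 2" "f s \<noteq> 0" using R(1) ns line_nonzero by (auto simp: s_def)
      from K2(2)[OF R1 this] show ?thesis
        using abs_Re_le_cmod[of "deriv f s / f s - deriv f 2 / f 2 -
          (\<Sum>\<rho>\<in>zeros_upto R. of_real (zmult \<rho>) * (1 / (s - \<rho>) - 1 / (2 - \<rho>)))"] 
        unfolding minus_complex.sel by linarith
    qed
    also have "Re (deriv f s / f s - deriv f 2 / f 2) \<le> max 0 K * (1 + ln \<bar>t\<bar>) + \<bar>Re (deriv f 2 / f 2)\<bar>"
    proof -
      have "K * (1 + ln \<bar>t\<bar>) \<le> max 0 K * (1 + ln \<bar>t\<bar>)" using t by (intro mult_right_mono) auto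
      thus ?thesis using K[OF t] unfolding s_def minus_complex.sel by linarith
    qed
    also have "K2 * R powr (\<alpha> - 2) * norm (s - 2) \<le> K2"
    proof -
      have "R powr (\<alpha> - 2) * \<bar>t\<bar> \<le> 1" using R t R1 by (intro powr_exponent_le) auto
      thus ?thesis using K2(1) ns by (simp add: mult.assoc mult_left_le)
    qed
    also have "Re (\<Sum>\<rho>\<in>zeros_upto R. of_real (zmult \<rho>) * (1 / (s - \<rho>) - 1 / (2 - \<rho>))) =
       (\<Sum>\<rho>\<in>zeros_upto R. zmult \<rho> * Re (1 / (s - \<rho>))) - (\<Sum>\<rho>\<in>zeros_upto R. zmult \<rho> * Re (1 / (2 - \<rho>)))"
      by (simp only: Re_sum Re_of_real_mult minus_complex.sel right_diff_distrib sum_subtractf)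
    finally have "(\<Sum>\<rho>\<in>zeros_upto R. zmult \<rho> * Re (1 / (s - \<rho>))) \<le>
        (\<Sum>\<rho>\<in>zeros_upto R. zmult \<rho> * Re (1 / (2 - \<rho>))) + max 0 K * (1 + ln \<bar>t\<bar>) + \<bar>Re (deriv f 2 / f 2)\<bar> + K2"
      by simp
    moreover have "(\<Sum>\<rho>\<in>zeros_upto R. zmult \<rho> * Re (1 / (2 - \<rho>))) \<le> 2 * \<bar>S\<bar>"
    proof -
      have "(\<Sum>\<rho>\<in>zeros_upto R. zmult \<rho> * Re (1 / (2 - \<rho>))) \<le>
         (\<Sum>\<rho>\<in>zeros_upto R. zmult \<rho> * (2 * norm (\<rho> - 2) powr (- 3 / 2)))"
        using subsetD[OF zeros_upto_subset] by (intro sum_mono mult_left_mono pos zmult_nonneg)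
      also have "\<dots> = 2 * (\<Sum>\<rho>\<in>zeros_upto R. zmult \<rho> * norm (\<rho> - 2) powr (- 3 / 2))"
        by (simp add: sum_distrib_left mult_ac)
      also have "\<dots> \<le> 2 * \<bar>S\<bar>" using S[OF finite_zeros_upto zeros_upto_subset, of R] by simp
      finally show ?thesis .
    qed
    moreover have "(\<Sum>\<rho>\<in>A. zmult \<rho> * Re (1 / (s - \<rho>))) \<le> (\<Sum>\<rho>\<in>zeros_upto R. zmult \<rho> * Re (1 / (s - \<rho>)))"
      using subsetD[OF zeros_upto_subset]
      by (intro sum_mono2 mult_nonneg_nonneg pos zmult_nonneg finite_zeros_upto R(2)) auto
    moreover have "\<bar>Re (deriv f 2 / f 2)\<bar> + 2 * \<bar>S\<bar> + K2 \<le> (\<bar>Re (deriv f 2 / f 2)\<bar> + 2 * \<bar>S\<bar> + K2) * (1 + ln \<bar>t\<bar>)"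
      using t K2(1) by (intro mult_left_mono[of 1 "1 + ln \<bar>t\<bar>", simplified]) auto
    ultimately show ?thesis unfolding s_def D_def by (simp add: algebra_simps)
  qed
  thus ?thesis using that D0 by blast
qed

text \<open>R truncates the expansion and X is the height; R tends to infinity only after the
  heights are fixed, so the estimates have to be uniform in R.\<close>

definition window_sum :: "real \<Rightarrow> real \<Rightarrow> real" where
  "window_sum R X = (\<Sum>\<rho>\<in>zeros_upto R. zmult \<rho> * window \<rho> X)"

text \<open>Minus the imaginary part of the truncated sum of 1/(\<rho> - 2).\<close>

definition height_sum :: "real \<Rightarrow> real" where
  "height_sum T = (\<Sum>\<rho>\<in>zeros_below T. zmult \<rho> * (Im \<rho> / norm (\<rho> - 2) ^ 2))"

text \<open>Summed over the zeros, the weight |\<rho> - 2|^(-3/2) gives a constant and the Poisson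
  kernels give O(log X); the factor X^(-1/8) beats the logarithm.\<close>

lemma window_sum_error:
  assumes K: "\<And>t. \<bar>t\<bar> \<ge> 1 \<Longrightarrow> Re (deriv f (2 + \<i> * of_real t) / f (2 + \<i> * of_real t)) \<le> K * (1 + ln \<bar>t\<bar>)"
  obtains E where "(E \<longlongrightarrow> 0) at_top"
    "\<And>X R. X \<ge> 4 \<Longrightarrow> R \<ge> X + 2 \<Longrightarrow> \<bar>window_sum R X - pi * height_sum X\<bar> \<le> E X"
proof -
  obtain S where S: "\<And>A. finite A \<Longrightarrow> A \<subseteq> zeros \<Longrightarrow> (\<Sum>\<rho>\<in>A. zmult \<rho> * norm (\<rho> - 2) powr (- 3 / 2)) \<le> S"
    using zero_sum_bound by blast
  obtain D where D: "D \<ge> 0" "\<And>t A. \<bar>t\<bar> \<ge> 1 \<Longrightarrow> finite A \<Longrightarrow> A \<subseteq> zeros \<Longrightarrow>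
     (\<Sum>\<rho>\<in>A. zmult \<rho> * Re (1 / (2 + \<i> * of_real t - \<rho>))) \<le> D * (1 + ln \<bar>t\<bar>)"
    using local_density[OF K] by blast
  define w1 w2 where "w1 X = 16 * X powr (- 1 / 8) + 64 * X powr (- 11 / 8) + 32 * X powr (- 1 / 4)"
    and "w2 X = 64 * X powr (- 1 / 8)" for X :: real
  define E where "E X = S * w1 X + 2 * D * (1 + ln X) * w2 X" for X
  have "(E \<longlongrightarrow> 0) at_top" unfolding E_def w1_def w2_def by real_asymp
  moreover have "\<bar>window_sum R X - pi * height_sum X\<bar> \<le> E X" if X: "X \<ge> 4" and R: "R \<ge> X + 2" for X R
  proof -
    define Z where "Z = zeros_upto R"
    have Z: "finite Z" "Z \<subseteq> zeros" using zeros_upto_subset by (auto simp: Z_def)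
    define P where "P \<rho> t = Re (1 / (2 + \<i> * of_real t - \<rho>))" for \<rho> t
    have zb: "zeros_below X = {\<rho> \<in> Z. \<bar>Im \<rho>\<bar> \<le> X}"
      using zeros_below_subset_upto[OF R] zeros_upto_subset[of R] unfolding zeros_below_def Z_def by blast
    have "pi * height_sum X = (\<Sum>\<rho>\<in>Z. zmult \<rho> * (if \<bar>Im \<rho>\<bar> \<le> X then pi * Im \<rho> / norm (\<rho> - 2) ^ 2 else 0))"
      unfolding height_sum_def zb sum.inter_filter[OF Z(1)] sum_distrib_left by (intro sum.cong) auto
    hence "\<bar>window_sum R X - pi * height_sum X\<bar> =
       \<bar>\<Sum>\<rho>\<in>Z. zmult \<rho> * (window \<rho> X - (if \<bar>Im \<rho>\<bar> \<le> X then pi * Im \<rho> / norm (\<rho> - 2) ^ 2 else 0))\<bar>"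
      unfolding window_sum_def Z_def[symmetric] by (simp add: right_diff_distrib sum_subtractf)
    also have "\<dots> \<le> (\<Sum>\<rho>\<in>Z. \<bar>zmult \<rho> * (window \<rho> X - (if \<bar>Im \<rho>\<bar> \<le> X then pi * Im \<rho> / norm (\<rho> - 2) ^ 2 else 0))\<bar>)"
      by (rule sum_abs)
    also have "\<dots> \<le> (\<Sum>\<rho>\<in>Z. zmult \<rho> * (norm (\<rho> - 2) powr (- 3 / 2) * w1 X + (P \<rho> X + P \<rho> (- X)) * w2 X))"
    proof (rule sum_mono)
      fix \<rho> assume "\<rho> \<in> Z"
      hence \<rho>: "\<rho> \<in> zeros" using Z by blast
      show "\<bar>zmult \<rho> * (window \<rho> X - (if \<bar>Im \<rho>\<bar> \<le> X then pi * Im \<rho> / norm (\<rho> - 2) ^ 2 else 0))\<bar> \<le>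
          zmult \<rho> * (norm (\<rho> - 2) powr (- 3 / 2) * w1 X + (P \<rho> X + P \<rho> (- X)) * w2 X)"
        unfolding abs_mult abs_of_nonneg[OF zmult_nonneg[OF \<rho>]] P_def w1_def w2_def
        by (rule mult_left_mono[OF window_error[OF zeros_strip[OF \<rho>] X] zmult_nonneg[OF \<rho>]])
    qed
    also have "\<dots> = (\<Sum>\<rho>\<in>Z. zmult \<rho> * norm (\<rho> - 2) powr (- 3 / 2)) * w1 X +
       ((\<Sum>\<rho>\<in>Z. zmult \<rho> * P \<rho> X) + (\<Sum>\<rho>\<in>Z. zmult \<rho> * P \<rho> (- X))) * w2 X"
      by (simp add: algebra_simps sum.distrib sum_distrib_left sum_distrib_right)
    also have "\<dots> \<le> S * w1 X + (D * (1 + ln X) + D * (1 + ln X)) * w2 X"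
      using S[OF Z] D(2)[OF _ Z, of X] D(2)[OF _ Z, of "-X"] X unfolding P_def
      by (intro add_mono mult_right_mono) (auto simp: w1_def w2_def)
    also have "\<dots> = E X" by (simp add: E_def)
    finally show ?thesis .
  qed
  ultimately show ?thesis using that by blast
qed

text \<open>The function L' need not tend to 0, but L is bounded. Subtracting L X / X from the
  window sum is an integration by parts: it replaces L' x / x in the derivative by L x / x^2. What
  is left of the derivative is O(1/x^2) plus an error vanishing as R grows, and this gives the
  Cauchy property.\<close>

theorem height_sum_convergent:
  assumes K: "\<And>t. \<bar>t\<bar> \<ge> 1 \<Longrightarrow> Re (deriv f (2 + \<i> * of_real t) / f (2 + \<i> * of_real t)) \<le> K * (1 + ln \<bar>t\<bar>)"
    and L: "\<And>t. t \<ge> 1 \<Longrightarrow> (L has_real_derivative L' t) (at t)" "\<And>t. t \<ge> 1 \<Longrightarrow> \<bar>L t\<bar> \<le> M"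
    and L': "\<And>t. t \<ge> 1 \<Longrightarrow> \<bar>Re (deriv f (2 + \<i> * of_real t) / f (2 + \<i> * of_real t)) -
        Re (deriv f (2 - \<i> * of_real t) / f (2 - \<i> * of_real t)) - L' t\<bar> \<le> M / t"
  shows "\<exists>l. (height_sum \<longlongrightarrow> l) at_top"
proof -
  obtain E where E: "(E \<longlongrightarrow> 0) at_top"
    "\<And>X R. X \<ge> 4 \<Longrightarrow> R \<ge> X + 2 \<Longrightarrow> \<bar>window_sum R X - pi * height_sum X\<bar> \<le> E X"
    using window_sum_error[OF K] by metis
  obtain K2 where K2: "K2 > 0" "\<And>R s. R \<ge> 1 \<Longrightarrow> norm (s - 2) \<le> R / 2 \<Longrightarrow> f s \<noteq> 0 \<Longrightarrow>
       norm (deriv f s / f s - deriv f 2 / f 2 -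
         (\<Sum>\<rho>\<in>zeros_upto R. of_real (zmult \<rho>) * (1 / (s - \<rho>) - 1 / (2 - \<rho>))))
       \<le> K2 * R powr (\<alpha> - 2) * norm (s - 2)"
    using logderiv_partial_fractions by blast
  have M0: "M \<ge> 0" using L(2)[of 1] by simp
  define W where "W R X = window_sum R X - L X / X" for R X
  define W' where "W' R x = (\<Sum>\<rho>\<in>zeros_upto R. zmult \<rho> *
      (Re ((1 / (2 + \<i> * of_real x - \<rho>) - 1 / (2 - \<rho>)) - (1 / (2 - \<i> * of_real x - \<rho>) - 1 / (2 - \<rho>))) / x))
      - (L' x / x - L x / x\<^sup>2)" for R x
  have L_div: "\<bar>L x / x\<bar> \<le> M / x" if "x \<ge> 1" for x
    using divide_right_mono[OF L(2)[OF that], of x] that by simp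
  have W_deriv: "(W R has_real_derivative W' R x) (at x)" if "x \<ge> 1" for R x
  proof -
    have "((\<lambda>x. L x / x) has_real_derivative L' x / x - L x / x\<^sup>2) (at x)"
      using that by (auto intro!: derivative_eq_intros L(1) simp: field_simps power2_eq_square)
    moreover have "(window_sum R has_real_derivative (\<Sum>\<rho>\<in>zeros_upto R. zmult \<rho> *
      (Re ((1 / (2 + \<i> * of_real x - \<rho>) - 1 / (2 - \<rho>)) - (1 / (2 - \<i> * of_real x - \<rho>) - 1 / (2 - \<rho>))) / x))) (at x)"
      unfolding window_sum_def[abs_def]
      by (intro DERIV_sum DERIV_cmult window_deriv zeros_strip subsetD[OF zeros_upto_subset]) (use that in auto)
    ultimately show ?thesis unfolding W_def W'_def by (intro DERIV_diff)
  qed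
  have W'_bound: "\<bar>W' R x\<bar> \<le> 2 * M / x\<^sup>2 + 2 * K2 * R powr (\<alpha> - 2)" if x: "x \<ge> 1" and R: "R \<ge> 2 * x" for R x
  proof -
    define T where "T s = (\<Sum>\<rho>\<in>zeros_upto R. of_real (zmult \<rho>) * (1 / (s - \<rho>) - 1 / (2 - \<rho>)))" for s
    define d where "d s = deriv f s / f s" for s
    define s1 s2 where "s1 = 2 + \<i> * of_real x" and "s2 = 2 - \<i> * of_real x"
    have n: "norm (s1 - 2) = x" "norm (s2 - 2) = x" using x by (auto simp: s1_def s2_def norm_mult)
    have scale: "m * (Re (u - w) / x) = Re (of_real m * u - of_real m * w) / x" for m u w
      by (simp add: right_diff_distrib)
    have e: "\<bar>Re (d s - d 2 - T s)\<bar> \<le> K2 * R powr (\<alpha> - 2) * x" if "s = s1 \<or> s = s2" for s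
    proof -
      have "norm (s - 2) = x" "f s \<noteq> 0" using that n line_nonzero by (auto simp: s1_def s2_def)
      thus ?thesis using K2(2)[of R s] R x abs_Re_le_cmod[of "d s - d 2 - T s"] unfolding d_def T_def by fastforce
    qed
    have "(\<Sum>\<rho>\<in>zeros_upto R. zmult \<rho> *
      (Re ((1 / (s1 - \<rho>) - 1 / (2 - \<rho>)) - (1 / (s2 - \<rho>) - 1 / (2 - \<rho>))) / x)) = Re (T s1 - T s2) / x"
      unfolding T_def sum_subtractf[symmetric] Re_sum sum_divide_distrib
      by (intro sum.cong refl scale)
    hence "W' R x = Re (T s1 - T s2) / x - (L' x / x - L x / x\<^sup>2)"
      unfolding W'_def s1_def s2_def by simp
    also have "\<dots> = ((Re (d s1) - Re (d s2) - L' x) - Re (d s1 - d 2 - T s1) + Re (d s2 - d 2 - T s2)) / x + L x / x\<^sup>2"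
      by (simp add: diff_divide_distrib add_divide_distrib)
    finally have W'eq: "W' R x = ((Re (d s1) - Re (d s2) - L' x) - Re (d s1 - d 2 - T s1) + Re (d s2 - d 2 - T s2)) / x + L x / x\<^sup>2" .
    have "\<bar>(Re (d s1) - Re (d s2) - L' x) - Re (d s1 - d 2 - T s1) + Re (d s2 - d 2 - T s2)\<bar>
       \<le> M / x + 2 * (K2 * R powr (\<alpha> - 2) * x)"
      using e[OF disjI1[OF refl]] e[OF disjI2[OF refl]] L'[OF x, folded s1_def s2_def, folded d_def]
      by linarith
    hence "\<bar>(Re (d s1) - Re (d s2) - L' x) - Re (d s1 - d 2 - T s1) + Re (d s2 - d 2 - T s2)\<bar> / x
       \<le> (M / x + 2 * (K2 * R powr (\<alpha> - 2) * x)) / x"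
      using x by (intro divide_right_mono) auto
    also have "\<dots> = M / x\<^sup>2 + 2 * K2 * R powr (\<alpha> - 2)" using x by (simp add: field_simps power2_eq_square)
    finally have "\<bar>((Re (d s1) - Re (d s2) - L' x) - Re (d s1 - d 2 - T s1) + Re (d s2 - d 2 - T s2)) / x\<bar>
       \<le> M / x\<^sup>2 + 2 * K2 * R powr (\<alpha> - 2)" using x by simp
    moreover have "\<bar>L x / x\<^sup>2\<bar> \<le> M / x\<^sup>2" using L(2)[OF x] by (simp add: divide_right_mono)
    moreover have "2 * M / x\<^sup>2 = M / x\<^sup>2 + M / x\<^sup>2" by simp
    ultimately show ?thesis unfolding W'eq by linarith
  qed
  have W_diff: "\<bar>W R Y - W R X\<bar> \<le> 2 * M / X + 2 * K2 * R powr (\<alpha> - 2) * (Y - X)"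
    if XY: "1 \<le> X" "X < Y" "2 * Y \<le> R" for X Y R
  proof -
    \<comment> \<open>An antiderivative of the bound for |W'|; the mean value inequality then takes
      the place of integration.\<close>
    define \<phi> where "\<phi> x = - 2 * M / x + 2 * K2 * R powr (\<alpha> - 2) * x" for x
    have \<phi>: "(\<phi> has_real_derivative 2 * M / x\<^sup>2 + 2 * K2 * R powr (\<alpha> - 2)) (at x)" if "x \<ge> 1" for x
      unfolding \<phi>_def using that by (auto intro!: derivative_eq_intros simp: power2_eq_square)
    have "norm (W R Y - W R X) \<le> \<phi> Y - \<phi> X"
    proof (rule differentiable_bound_general[OF XY(2)])
      show "continuous_on {X..Y} (W R)"
        by (rule DERIV_continuous_on, rule has_field_derivative_at_within, rule W_deriv) (use XY in simp)
      show "continuous_on {X..Y} \<phi>"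
        by (rule DERIV_continuous_on, rule has_field_derivative_at_within, rule \<phi>) (use XY in simp)
      show "(W R has_vector_derivative W' R x) (at x)" if "X < x" "x < Y" for x
        using W_deriv[of x R] XY that by (simp add: has_real_derivative_iff_has_vector_derivative)
      show "(\<phi> has_vector_derivative 2 * M / x\<^sup>2 + 2 * K2 * R powr (\<alpha> - 2)) (at x)" if "X < x" "x < Y" for x
        using \<phi>[of x] XY that by (simp add: has_real_derivative_iff_has_vector_derivative)
      show "norm (W' R x) \<le> 2 * M / x\<^sup>2 + 2 * K2 * R powr (\<alpha> - 2)" if "X < x" "x < Y" for x
        using W'_bound[of x R] XY that by simp
    qed
    also have "\<dots> \<le> 2 * M / X + 2 * K2 * R powr (\<alpha> - 2) * (Y - X)"
      using M0 XY by (simp add: \<phi>_def algebra_simps)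
    finally show ?thesis by simp
  qed
  \<comment> \<open>2M/X comes from the derivative bound and M/X from the correction L X / X;
    division by pi returns from the window sum to the height sum.\<close>
  define E' where "E' X = (E X + 3 * M / X) / pi" for X
  have "((\<lambda>X. 3 * M / X) \<longlongrightarrow> 0) at_top"
    by (intro tendsto_divide_0[OF tendsto_const] filterlim_at_top_imp_at_infinity filterlim_ident)
  hence "(E' \<longlongrightarrow> (0 + 0) / pi) at_top" unfolding E'_def by (intro tendsto_intros E) auto
  hence E'0: "(E' \<longlongrightarrow> 0) at_top" by simp
  have Epos: "E X \<ge> 0" if "X \<ge> 4" for X using E(2)[OF that order_refl] by (smt (verit) abs_ge_zero)
  have "\<bar>height_sum Y - height_sum X\<bar> \<le> E' X + E' Y" if XY: "4 \<le> X" "X \<le> Y" for X Y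
  proof (cases "X = Y")
    case True
    have "E' Y \<ge> 0" using Epos[of Y] XY M0 by (simp add: E'_def)
    thus ?thesis using True by simp
  next
    case False
    have "\<bar>pi * height_sum Y - pi * height_sum X\<bar> \<le> E X + E Y + 3 * M / X + M / Y"
    \<comment> \<open>X and Y are fixed and R tends to infinity, which removes the truncation
      error.\<close>
    proof (rule tendsto_le[OF trivial_limit_at_top_linorder])
      have "((\<lambda>R::real. R powr (\<alpha> - 2)) \<longlongrightarrow> 0) at_top"
        using \<alpha>_less by (intro tendsto_neg_powr filterlim_ident) auto
      hence "((\<lambda>R. E X + E Y + 3 * M / X + M / Y + 2 * K2 * R powr (\<alpha> - 2) * (Y - X)) \<longlongrightarrow>
         E X + E Y + 3 * M / X + M / Y + 2 * K2 * 0 * (Y - X)) at_top" by (intro tendsto_intros)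
      thus "((\<lambda>R. E X + E Y + 3 * M / X + M / Y + 2 * K2 * R powr (\<alpha> - 2) * (Y - X)) \<longlongrightarrow>
         E X + E Y + 3 * M / X + M / Y) at_top" by simp
      show "eventually (\<lambda>R. \<bar>pi * height_sum Y - pi * height_sum X\<bar> \<le>
          E X + E Y + 3 * M / X + M / Y + 2 * K2 * R powr (\<alpha> - 2) * (Y - X)) at_top"
        using eventually_ge_at_top[of "2 * Y"]
      proof eventually_elim
        case (elim R)
        have "\<bar>L X / X\<bar> \<le> M / X" "\<bar>L Y / Y\<bar> \<le> M / Y"
          using L_div[of X] L_div[of Y] XY by simp_all
        moreover have "\<bar>window_sum R X - pi * height_sum X\<bar> \<le> E X" "\<bar>window_sum R Y - pi * height_sum Y\<bar> \<le> E Y"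
          using E(2)[of X R] E(2)[of Y R] XY elim by linarith+
        moreover have "\<bar>W R Y - W R X\<bar> \<le> 2 * M / X + 2 * K2 * R powr (\<alpha> - 2) * (Y - X)"
          using W_diff[of X Y R] XY False elim by linarith
        moreover have "3 * M / X = M / X + 2 * M / X" by simp
        ultimately show ?case unfolding W_def by linarith
      qed
    qed (rule tendsto_const)
    also have "\<dots> \<le> E X + E Y + 3 * M / X + 3 * M / Y" using M0 XY by (simp add: divide_right_mono)
    also have "\<dots> = pi * (E' X + E' Y)" by (simp add: E'_def field_simps)
    finally show ?thesis by (simp add: abs_mult flip: right_diff_distrib)
  qed
  thus ?thesis using convergent_at_top_if_cauchy_bound[OF E'0] by blast
qed

end

section \<open>The Euler product\<close>

lemma holomorphic_suminf:
  fixes f :: "nat \<Rightarrow> complex \<Rightarrow> complex"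
  assumes "open S" "\<And>n. f n holomorphic_on S"
    and "\<And>n x. x \<in> S \<Longrightarrow> norm (f n x) \<le> M n" "summable M"
  shows "(\<lambda>x. \<Sum>n. f n x) holomorphic_on S"
proof (rule holomorphic_uniform_sequence[OF assms(1), of "\<lambda>N x. \<Sum>n<N. f n x"])
  show "(\<lambda>x. \<Sum>n<N. f n x) holomorphic_on S" for N
    by (intro holomorphic_intros assms)
  have lim: "uniform_limit S (\<lambda>N x. \<Sum>n<N. f n x) (\<lambda>x. \<Sum>n. f n x) sequentially"
    by (rule Weierstrass_m_test[OF assms(3,4)])
  fix x assume "x \<in> S"
  then obtain d where "d > 0" "cball x d \<subseteq> S" using assms(1) open_contains_cball by blast
  thus "\<exists>d>0. cball x d \<subseteq> S \<and> uniform_limit (cball x d) (\<lambda>N x. \<Sum>n<N. f n x) (\<lambda>x. \<Sum>n. f n x) sequentially"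
    using uniform_limit_on_subset[OF lim] by blast
qed

lemma euler_coeffs_bound:
  assumes "euler_coeffs F b"
  obtains C where "C \<ge> 0" "\<And>n. n \<ge> 1 \<Longrightarrow> norm (b n) \<le> C * real n powr (1 / 2)"
proof -
  obtain \<theta> where \<theta>: "\<theta> < 1 / 2" "(\<lambda>n. norm (b n)) \<in> O(\<lambda>n. real n powr \<theta>)"
    using assms by (auto simp: euler_coeffs_def)
  obtain c where c: "c > 0" "eventually (\<lambda>n. norm (norm (b n)) \<le> c * norm (real n powr \<theta>)) sequentially"
    using landau_o.bigE[OF \<theta>(2)] by blast
  obtain N where N: "\<And>n. n \<ge> N \<Longrightarrow> norm (b n) \<le> c * real n powr \<theta>"
    using c(2) by (auto simp: eventually_sequentially)
  define C where "C = c + (\<Sum>n<N. norm (b n))"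
  have "norm (b n) \<le> C * real n powr (1 / 2)" if n: "n \<ge> 1" for n
  proof -
    have p1: "real n powr (1 / 2) \<ge> 1" using n by (intro ge_one_powr_ge_zero) auto
    show ?thesis
    proof (cases "n < N")
      case True
      have "norm (b n) \<le> (\<Sum>n<N. norm (b n))" using True by (intro member_le_sum) auto
      also have "\<dots> \<le> C * 1" using c(1) by (simp add: C_def)
      also have "\<dots> \<le> C * real n powr (1 / 2)" using p1 c(1) by (intro mult_left_mono) (auto simp: C_def sum_nonneg add_nonneg_nonneg)
      finally show ?thesis .
    next
      case False
      hence "norm (b n) \<le> c * real n powr \<theta>" using N by simp
      also have "\<dots> \<le> c * real n powr (1 / 2)" using \<theta>(1) c(1) n by (intro mult_left_mono powr_mono) auto
      also have "\<dots> \<le> C * real n powr (1 / 2)" by (intro mult_right_mono) (auto simp: C_def sum_nonneg)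
      finally show ?thesis .
    qed
  qed
  moreover have "C \<ge> 0" using c(1) by (simp add: C_def sum_nonneg add_nonneg_nonneg)
  ultimately show ?thesis using that by blast
qed

text \<open>\<open>has_prod\<close> does not admit divergence to 0: the value 0 requires a vanishing
  factor, and here every factor is an exponential or 1.\<close>

lemma euler_product_nonzero:
  assumes "euler_coeffs F b" "Re s > 1"
  shows "F s \<noteq> 0"
proof
  assume "F s = 0"
  hence "(\<lambda>p. if prime p then exp (\<Sum>k. b (p ^ Suc k) / of_nat (p ^ Suc k) powr s) else 1) has_prod 0"
    using assms by (auto simp: euler_coeffs_def)
  thus False unfolding has_prod_0_iff by (auto split: if_splits)
qed

text \<open>With b(n) = O(n^(1/2)) the logarithm is dominated by sums of n^(1/2 - Re s), which calls
  for Re s > 3/2. The boundary 8/5 leaves a margin on both sides: the exponent stays below -11/10,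
  and discs of radius 1/5 around points of the line Re s = 2 fit. Defining L as a sum of local
  logarithms avoids any choice of branch.\<close>

lemma euler_product_log:
  assumes E: "euler_coeffs F b"
  obtains L M where "L holomorphic_on {s. Re s > 8 / 5}" "\<And>s. Re s > 8 / 5 \<Longrightarrow> F s = exp (L s)"
    "\<And>s. Re s > 8 / 5 \<Longrightarrow> norm (L s) \<le> M"
proof -
  obtain C where C: "C \<ge> 0" "\<And>n. n \<ge> 1 \<Longrightarrow> norm (b n) \<le> C * real n powr (1 / 2)"
    using euler_coeffs_bound[OF E] by blast
  define S where "S = {s. Re s > 8 / 5}"
  have S: "open S" unfolding S_def by (rule open_halfspace_Re_gt)
  define t where "t p k s = b (p ^ Suc k) / of_nat (p ^ Suc k) powr s" for p k s
  define g where "g p s = (if prime p then \<Sum>k. t p k s else 0)" for p :: nat and s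
  \<comment> \<open>Since p^(-11/10) <= 1/2, all but one factor of the power Suc k become a
    geometric series, leaving p^(-11/10) for the summation over p.\<close>
  define N where "N p k = C * (real p powr (- 11 / 10) * (1 / 2) ^ k)" for p k :: nat
  have tb: "norm (t p k s) \<le> N p k" if p: "prime p" and s: "s \<in> S" for p k s
  proof -
    have p2: "p \<ge> 2" using p by (rule prime_ge_2_nat)
    define q where "q = real p ^ Suc k"
    have q: "q \<ge> 1" using p2 by (simp add: q_def del: power_Suc)
    have "norm (t p k s) = norm (b (p ^ Suc k)) / q powr Re s"
      unfolding t_def norm_divide q_def by (subst norm_powr_real_powr) (auto simp del: power_Suc)
    also have "\<dots> \<le> (C * q powr (1 / 2)) / q powr Re s"
      using C(2)[of "p ^ Suc k"] p2 unfolding q_def by (intro divide_right_mono) (auto simp del: power_Suc)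
    also have "\<dots> = C * q powr (1 / 2 - Re s)" by (simp add: powr_diff)
    also have "\<dots> \<le> C * q powr (- 11 / 10)"
      using q C(1) s by (intro mult_left_mono powr_mono) (auto simp: S_def)
    also have "q powr (- 11 / 10) = (real p powr (- 11 / 10)) ^ Suc k"
    proof -
      have "q = real p powr real (Suc k)" using p2 by (simp only: q_def powr_realpow of_nat_0_less_iff)
      hence "q powr (- 11 / 10) = (real p powr (- 11 / 10)) powr real (Suc k)"
        by (simp only: powr_powr mult.commute)
      thus ?thesis using p2 by (subst (asm) powr_realpow) auto
    qed
    also have "\<dots> \<le> real p powr (- 11 / 10) * (1 / 2) ^ k"
    proof -
      have "real p powr (- 11 / 10) \<le> real p powr (- 1)" using p2 by (intro powr_mono) auto
      also have "\<dots> \<le> 1 / 2" using p2 by (simp add: powr_minus_divide)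
      finally have "(real p powr (- 11 / 10)) ^ k \<le> (1 / 2) ^ k" by (intro power_mono) auto
      thus ?thesis by (simp add: mult_left_mono)
    qed
    finally show ?thesis unfolding N_def using C(1) by (simp add: mult_left_mono)
  qed
  have sN: "summable (N p)" for p unfolding N_def
    by (intro summable_mult summable_geometric) auto
  have gb: "norm (g p s) \<le> 2 * C * real p powr (- 11 / 10)" if s: "s \<in> S" for p s
  proof (cases "prime p")
    case True
    have "norm (g p s) \<le> (\<Sum>k. N p k)" unfolding g_def using True tb[OF True s]
      by (auto intro!: norm_suminf_le sN)
    also have "\<dots> = C * (real p powr (- 11 / 10) * 2)"
      unfolding N_def by (subst suminf_mult, intro summable_mult summable_geometric, simp, subst suminf_mult)
        (auto simp: suminf_geometric intro!: summable_geometric)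
    finally show ?thesis by simp
  qed (use C(1) in \<open>simp add: g_def\<close>)
  have gh: "g p holomorphic_on S" for p
  proof (cases "prime p")
    case True
    have "t p k holomorphic_on S" for k
      unfolding t_def using prime_gt_0_nat[OF True] by (intro holomorphic_intros) auto
    hence "(\<lambda>s. \<Sum>k. t p k s) holomorphic_on S"
      by (intro holomorphic_suminf[OF S _ tb[OF True] sN])
    thus ?thesis unfolding g_def using True by simp
  next
    case False
    hence "g p = (\<lambda>s. 0)" by (intro ext) (simp add: g_def)
    thus ?thesis by simp
  qed
  have sM: "summable (\<lambda>p. 2 * C * real p powr (- 11 / 10))"
    by (intro summable_mult) (simp add: summable_real_powr_iff)
  define L where "L s = (\<Sum>p. g p s)" for s
  have "L holomorphic_on S" unfolding L_def by (rule holomorphic_suminf[OF S gh gb sM])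
  moreover have "F s = exp (L s)" if s: "s \<in> S" for s
  proof -
    have "Re s > 1" using s by (simp add: S_def)
    hence "(\<lambda>p. if prime p then exp (\<Sum>k. b (p ^ Suc k) / of_nat (p ^ Suc k) powr s) else 1) has_prod F s"
      using E by (simp add: euler_coeffs_def)
    also have "(\<lambda>p. if prime p then exp (\<Sum>k. b (p ^ Suc k) / of_nat (p ^ Suc k) powr s) else 1) = (\<lambda>p. exp (g p s))"
      by (auto simp: g_def t_def)
    finally have "(\<lambda>n. \<Prod>p\<le>n. exp (g p s)) \<longlonglongrightarrow> F s" by (rule has_prod_imp_tendsto)
    hence "(\<lambda>n. exp (\<Sum>p\<le>n. g p s)) \<longlonglongrightarrow> F s" by (simp add: exp_sum)
    moreover have "summable (\<lambda>p. g p s)" by (rule summable_comparison_test'[OF sM gb[OF s]])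
    hence "(\<lambda>n. exp (\<Sum>p\<le>n. g p s)) \<longlonglongrightarrow> exp (L s)"
      unfolding L_def by (intro tendsto_exp summable_LIMSEQ')
    ultimately show ?thesis by (rule LIMSEQ_unique)
  qed
  moreover have "norm (L s) \<le> (\<Sum>p. 2 * C * real p powr (- 11 / 10))" if "s \<in> S" for s
    unfolding L_def by (rule norm_suminf_le[OF gb[OF that] sM])
  ultimately show ?thesis using that unfolding S_def by auto
qed

section \<open>The Phragmen-Lindelof principle in a strip\<close>

lemma cos_Re_complex: "Re (cos z) = cos (Re z) * cosh (Im z)" for z :: complex
  by (simp add: Re_cos cosh_def field_simps)

text \<open>The convergence factor exp (- \<epsilon> cos w) uses a rescaling w of the strip to |Re
  w| <= 1/2, well inside |Re w| < pi/2, so that Re cos w >= \<kappa> cosh (\<delta> Im z). The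
  factor decays doubly exponentially and beats exp (C |z|^A) for every A; this is why only some
  finite order has to be known beforehand. At the end \<epsilon> tends to 0.\<close>

theorem phragmen_lindelof_strip:
  fixes a b A B C :: real
  assumes hol: "f holomorphic_on {z. a \<le> Re z \<and> Re z \<le> b}" and ab: "a < b" and B: "B > 0" and A: "A > 0"
    and growth: "\<And>z. a \<le> Re z \<Longrightarrow> Re z \<le> b \<Longrightarrow> norm (f z) \<le> exp (C * (1 + norm z) powr A)"
    and boundary: "\<And>z. Re z = a \<or> Re z = b \<Longrightarrow> norm (f z) \<le> B"
    and z0: "a \<le> Re z0" "Re z0 \<le> b"
  shows "norm (f z0) \<le> B"
proof -
  define \<delta> where "\<delta> = 1 / (b - a)"
  define w where "w z = of_real \<delta> * (z - of_real ((a + b) / 2))" for z :: complex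
  define \<kappa> where "\<kappa> = cos (1 / 2 :: real)"
  have \<delta>: "\<delta> > 0" using ab by (simp add: \<delta>_def)
  have \<kappa>: "\<kappa> > 0" unfolding \<kappa>_def using pi_gt3 by (intro cos_gt_zero_pi) auto
  have Rew: "\<bar>Re (w z)\<bar> \<le> 1 / 2" if "a \<le> Re z" "Re z \<le> b" for z
  proof -
    have "\<bar>Re z - (a + b) / 2\<bar> \<le> (b - a) / 2" using that by (simp add: abs_le_iff field_simps)
    hence "\<delta> * \<bar>Re z - (a + b) / 2\<bar> \<le> \<delta> * ((b - a) / 2)" using \<delta> by (intro mult_left_mono) auto
    also have "\<dots> = 1 / 2" using ab by (simp add: \<delta>_def)
    finally show ?thesis using \<delta> by (simp add: w_def abs_mult)
  qed
  have Imw: "Im (w z) = \<delta> * Im z" for z by (simp add: w_def)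
  have cosw: "Re (cos (w z)) \<ge> \<kappa> * cosh (\<delta> * Im z)" if "a \<le> Re z" "Re z \<le> b" for z
  proof -
    have "\<kappa> \<le> cos \<bar>Re (w z)\<bar>" unfolding \<kappa>_def
      using Rew[OF that] pi_gt3 by (intro cos_monotone_0_pi_le) auto
    thus ?thesis unfolding cos_Re_complex Imw by (intro mult_right_mono) auto
  qed
  define h where "h \<epsilon> z = f z * exp (- of_real \<epsilon> * cos (w z))" for \<epsilon> :: real and z
  have norm_h: "norm (h \<epsilon> z) \<le> norm (f z) * exp (- \<epsilon> * (\<kappa> * cosh (\<delta> * Im z)))"
    if "\<epsilon> > 0" "a \<le> Re z" "Re z \<le> b" for \<epsilon> z
    unfolding h_def norm_mult norm_exp_eq_Re
    using cosw[OF that(2,3)] that(1) by (intro mult_left_mono) auto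
  have main: "norm (h \<epsilon> z0) \<le> B" if \<epsilon>: "\<epsilon> > 0" for \<epsilon>
  proof -
    define m where "m = 1 + \<bar>a\<bar> + \<bar>b\<bar>"
    define c where "c = \<bar>C\<bar> + 1"
    have c: "c > 0" by (simp add: c_def)
    define k where "k = \<epsilon> * \<kappa> / 2"
    have "k > 0" using \<epsilon> \<kappa> by (simp add: k_def)
    have "((\<lambda>t. exp (c * (t + m) powr A - k * exp (\<delta> * t))) \<longlongrightarrow> 0) at_top"
      using A \<delta> \<open>k > 0\<close> c by real_asymp
    hence "eventually (\<lambda>t. exp (c * (t + m) powr A - k * exp (\<delta> * t)) < B) at_top"
      using B by (rule order_tendstoD)
    moreover have "eventually (\<lambda>t. t > \<bar>Im z0\<bar>) at_top" by (rule eventually_gt_at_top)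
    ultimately have "eventually (\<lambda>t. t > \<bar>Im z0\<bar> \<and> exp (c * (t + m) powr A - k * exp (\<delta> * t)) < B) at_top"
      by eventually_elim auto
    \<comment> \<open>A height beyond that of z0 at which the damped growth bound is already below
      B; it closes the rectangle above and below.\<close>
    then obtain T where T: "T > \<bar>Im z0\<bar>" "exp (c * (T + m) powr A - k * exp (\<delta> * T)) < B"
      using eventually_happens'[OF trivial_limit_at_top_linorder] by blast
    define S where "S = cbox (Complex a (- T)) (Complex b T)"
    show ?thesis
    proof (rule maximum_modulus_frontier[of "h \<epsilon>" S])
      have "S \<subseteq> {z. a \<le> Re z \<and> Re z \<le> b}" by (auto simp: S_def in_cbox_complex_iff)
      hence hS: "h \<epsilon> holomorphic_on S" unfolding h_def w_def
        by (intro holomorphic_intros holomorphic_on_subset[OF hol])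
      thus "h \<epsilon> holomorphic_on interior S" using interior_subset holomorphic_on_subset by blast
      have "closure S = S" by (simp add: S_def)
      thus "continuous_on (closure S) (h \<epsilon>)" using hS holomorphic_on_imp_continuous_on by metis
      show "bounded S" by (simp add: S_def bounded_cbox)
      show "z0 \<in> S" using z0 T(1) by (auto simp: S_def in_cbox_complex_iff)
      fix z assume "z \<in> frontier S"
      hence z: "z \<in> S" "z \<notin> box (Complex a (- T)) (Complex b T)"
        unfolding S_def frontier_cbox by auto
      hence Re: "a \<le> Re z" "Re z \<le> b" by (auto simp: S_def in_cbox_complex_iff)
      have cpos: "\<epsilon> * (\<kappa> * cosh (\<delta> * Im z)) \<ge> 0" using \<epsilon> \<kappa> by simp
      consider "Re z = a \<or> Re z = b" | "\<bar>Im z\<bar> = T"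
        using z by (auto simp: S_def in_cbox_complex_iff in_box_complex_iff)
      thus "norm (h \<epsilon> z) \<le> B"
      proof cases
        case 1
        have "norm (h \<epsilon> z) \<le> norm (f z) * exp (- \<epsilon> * (\<kappa> * cosh (\<delta> * Im z)))" by (rule norm_h[OF \<epsilon> Re])
        also have "\<dots> \<le> norm (f z) * 1" using cpos by (intro mult_left_mono) auto
        finally show ?thesis using boundary[OF 1] by simp
      next
        case 2
        have "norm z \<le> \<bar>Re z\<bar> + \<bar>Im z\<bar>" by (rule cmod_le)
        hence "1 + norm z \<le> T + m" using Re 2 by (auto simp: m_def)
        hence "C * (1 + norm z) powr A \<le> c * (T + m) powr A"
          using A by (intro mult_mono powr_mono2) (auto simp: c_def)
        hence "norm (f z) \<le> exp (c * (T + m) powr A)"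
          using order_trans[OF growth[OF Re]] by simp
        moreover have "exp (\<delta> * T) / 2 \<le> cosh (\<delta> * Im z)"
        proof -
          have "cosh (\<delta> * Im z) = cosh (\<delta> * T)"
            using 2 by (metis abs_if cosh_minus mult_minus_right)
          thus ?thesis unfolding cosh_def[of "\<delta> * T"] by simp
        qed
        hence "exp (- \<epsilon> * (\<kappa> * cosh (\<delta> * Im z))) \<le> exp (- (k * exp (\<delta> * T)))"
          using \<epsilon> \<kappa> by (simp add: k_def)
        ultimately have "norm (f z) * exp (- \<epsilon> * (\<kappa> * cosh (\<delta> * Im z))) \<le>
           exp (c * (T + m) powr A) * exp (- (k * exp (\<delta> * T)))"
          by (intro mult_mono) auto
        also have "\<dots> = exp (c * (T + m) powr A - k * exp (\<delta> * T))" by (simp flip: exp_add)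
        finally have "norm (f z) * exp (- \<epsilon> * (\<kappa> * cosh (\<delta> * Im z))) \<le>
           exp (c * (T + m) powr A - k * exp (\<delta> * T))" .
        thus ?thesis using norm_h[OF \<epsilon> Re] T(2) by linarith
      qed
    qed
  qed
  have "((\<lambda>\<epsilon>. h \<epsilon> z0) \<longlongrightarrow> f z0 * exp (- of_real 0 * cos (w z0))) (at_right 0)"
    unfolding h_def by (intro tendsto_intros)
  hence "((\<lambda>\<epsilon>. norm (h \<epsilon> z0)) \<longlongrightarrow> norm (f z0)) (at_right 0)" by (auto dest: tendsto_norm)
  moreover have "eventually (\<lambda>\<epsilon>. norm (h \<epsilon> z0) \<le> B) (at_right 0)"
    using eventually_at_right_less by eventually_elim (rule main)
  ultimately show ?thesis by (rule tendsto_upperbound) auto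
qed

section \<open>The completed function\<close>

text \<open>There is no multiplicative constant in front, and the base is at least 1: products are
  then handled by adding the constants C, and bounded functions belong to the class for every A >=
  0.\<close>

definition exp_bounded :: "real \<Rightarrow> (complex \<Rightarrow> complex) \<Rightarrow> complex set \<Rightarrow> bool" where
  "exp_bounded A f S \<longleftrightarrow> (\<exists>C. \<forall>s\<in>S. norm (f s) \<le> exp (C * (1 + norm s) powr A))"

lemma exp_boundedI: "(\<And>s. s \<in> S \<Longrightarrow> norm (f s) \<le> exp (C * (1 + norm s) powr A)) \<Longrightarrow> exp_bounded A f S"
  by (auto simp: exp_bounded_def)

lemma exp_bounded_subset: "exp_bounded A f S \<Longrightarrow> S' \<subseteq> S \<Longrightarrow> exp_bounded A f S'"
  by (auto simp: exp_bounded_def)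

lemma exp_bounded_cong: "(\<And>s. s \<in> S \<Longrightarrow> f s = h s) \<Longrightarrow> exp_bounded A f S \<longleftrightarrow> exp_bounded A h S"
  by (simp add: exp_bounded_def)

lemma exp_bounded_mult:
  assumes "exp_bounded A f S" "exp_bounded A h S"
  shows "exp_bounded A (\<lambda>s. f s * h s) S"
proof -
  obtain C D where C: "\<And>s. s \<in> S \<Longrightarrow> norm (f s) \<le> exp (C * (1 + norm s) powr A)"
    and D: "\<And>s. s \<in> S \<Longrightarrow> norm (h s) \<le> exp (D * (1 + norm s) powr A)"
    using assms by (auto simp: exp_bounded_def)
  show ?thesis
  proof (rule exp_boundedI)
    fix s assume "s \<in> S"
    hence "norm (f s * h s) \<le> exp (C * (1 + norm s) powr A) * exp (D * (1 + norm s) powr A)"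
      unfolding norm_mult by (intro mult_mono C D) auto
    also have "\<dots> = exp ((C + D) * (1 + norm s) powr A)" by (simp add: algebra_simps flip: exp_add)
    finally show "norm (f s * h s) \<le> exp ((C + D) * (1 + norm s) powr A)" .
  qed
qed

lemma exp_bounded_union:
  assumes "exp_bounded A f S" "exp_bounded A f T"
  shows "exp_bounded A f (S \<union> T)"
proof -
  obtain C D where C: "\<And>s. s \<in> S \<Longrightarrow> norm (f s) \<le> exp (C * (1 + norm s) powr A)"
    and D: "\<And>s. s \<in> T \<Longrightarrow> norm (f s) \<le> exp (D * (1 + norm s) powr A)"
    using assms by (auto simp: exp_bounded_def)
  show ?thesis
  proof (rule exp_boundedI)
    fix s :: complex
    have *: "exp (x * (1 + norm s) powr A) \<le> exp (max C D * (1 + norm s) powr A)" if "x \<le> max C D" for x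
      using that by (auto intro!: mult_right_mono)
    assume "s \<in> S \<union> T"
    thus "norm (f s) \<le> exp (max C D * (1 + norm s) powr A)"
      using order_trans[OF C[of s] *[OF max.cobounded1]] order_trans[OF D[of s] *[OF max.cobounded2]] by blast
  qed
qed

lemma norm_le_powr:
  assumes "A \<ge> 1"
  shows "1 + norm s \<le> (1 + norm s) powr A"
  using powr_mono[of 1 A "1 + norm s"] assms by simp

lemma exp_bounded_const:
  assumes "A \<ge> 0" "\<And>s. s \<in> S \<Longrightarrow> norm (f s) \<le> B"
  shows "exp_bounded A f S"
proof (rule exp_boundedI)
  fix s assume "s \<in> S"
  hence "norm (f s) \<le> \<bar>B\<bar>" using assms(2)[of s] by simp
  also have "\<dots> \<le> exp \<bar>B\<bar>" using exp_ge_add_one_self[of "\<bar>B\<bar>"] by linarith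
  also have "\<bar>B\<bar> * 1 \<le> \<bar>B\<bar> * (1 + norm s) powr A"
    using assms(1) by (intro mult_left_mono ge_one_powr_ge_zero) auto
  hence "exp \<bar>B\<bar> \<le> exp (\<bar>B\<bar> * (1 + norm s) powr A)" by simp
  finally show "norm (f s) \<le> exp (\<bar>B\<bar> * (1 + norm s) powr A)" .
qed

lemma exp_bounded_linear:
  assumes "A \<ge> 1"
  shows "exp_bounded A (\<lambda>s. s - c) S"
proof (rule exp_boundedI)
  fix s :: complex
  have "norm (s - c) \<le> norm s + norm c" by (rule norm_triangle_ineq4)
  also have "\<dots> \<le> exp (norm s + norm c)" using exp_ge_add_one_self[of "norm s + norm c"] by linarith
  also have "norm s + norm c \<le> (1 + norm c) * (1 + norm s)" by (simp add: algebra_simps)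
  also have "\<dots> \<le> (1 + norm c) * (1 + norm s) powr A"
    using norm_le_powr[OF assms] by (intro mult_left_mono) auto
  finally show "norm (s - c) \<le> exp ((1 + norm c) * (1 + norm s) powr A)" by simp
qed

lemma exp_bounded_power:
  assumes "A \<ge> 0" "exp_bounded A f S"
  shows "exp_bounded A (\<lambda>s. f s ^ m) S"
proof (induction m)
  case 0
  show ?case using assms(1) by (intro exp_bounded_const[where B = 1]) auto
next
  case (Suc m)
  show ?case using exp_bounded_mult[OF assms(2) Suc] by simp
qed

lemma exp_bounded_powr_base:
  assumes "A \<ge> 1" "Q > 0"
  shows "exp_bounded A (\<lambda>s. of_real Q powr s) S"
proof (rule exp_boundedI)
  fix s :: complex
  have "norm (of_real Q powr s) = Q powr Re s" using assms(2) by (simp add: norm_powr_real_powr)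
  also have "\<dots> = exp (Re s * ln Q)" using assms(2) by (simp add: powr_def)
  also have "Re s * ln Q \<le> \<bar>ln Q\<bar> * (1 + norm s)"
  proof -
    have "Re s * ln Q \<le> \<bar>Re s\<bar> * \<bar>ln Q\<bar>" by (metis abs_ge_self abs_mult)
    also have "\<dots> \<le> (1 + norm s) * \<bar>ln Q\<bar>"
      using abs_Re_le_cmod[of s] by (intro mult_right_mono) linarith+
    finally show ?thesis by (simp add: mult_ac)
  qed
  also have "\<dots> \<le> \<bar>ln Q\<bar> * (1 + norm s) powr A" by (intro mult_left_mono norm_le_powr assms(1)) auto
  finally show "norm (of_real Q powr s) \<le> exp (\<bar>ln Q\<bar> * (1 + norm s) powr A)" by simp
qed

lemma exp_bounded_Gamma:
  assumes A: "A \<ge> 5 / 4" and l: "l > 0" and \<mu>: "Re \<mu> \<ge> 0" and r: "r > 0" "\<And>s. s \<in> S \<Longrightarrow> Re s \<ge> r"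
  shows "exp_bounded A (\<lambda>s. Gamma (of_real l * s + \<mu>)) S"
proof -
  have "l * r > 0" using l r by simp
  then obtain K where K: "K \<ge> 0" "\<And>x. x \<ge> l * r \<Longrightarrow> Gamma (x::real) \<le> exp (K * (1 + x) powr (5 / 4))"
    using Gamma_real_upper_bound by metis
  define D where "D = 1 + l + Re \<mu>"
  show ?thesis
  proof (rule exp_boundedI)
    fix s assume s: "s \<in> S"
    define x where "x = l * Re s + Re \<mu>"
    have lr: "l * r \<le> l * Re s" using r(2)[OF s] l by (intro mult_left_mono) auto
    have x: "x \<ge> l * r" using lr \<mu> by (simp add: x_def)
    have x0: "x > 0" using x l r by (smt (verit) mult_pos_pos)
    have "norm (Gamma (of_real l * s + \<mu>)) \<le> Gamma (Re (of_real l * s + \<mu>))"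
      using x0 by (intro norm_Gamma_le) (simp add: x_def)
    also have "\<dots> = Gamma x" by (simp add: x_def)
    also have "\<dots> \<le> exp (K * (1 + x) powr (5 / 4))" using K(2)[OF x] .
    also have "(1 + x) powr (5 / 4) \<le> (D * (1 + norm s)) powr (5 / 4)"
    proof (rule powr_mono2)
      have "l * Re s \<le> l * norm s" using l complex_Re_le_cmod by (intro mult_left_mono) auto
      moreover have "0 \<le> Re \<mu> * norm s" "0 \<le> norm s" using \<mu> by auto
      moreover have "D * (1 + norm s) = 1 + l + Re \<mu> + norm s + l * norm s + Re \<mu> * norm s"
        by (simp add: D_def algebra_simps)
      ultimately show "1 + x \<le> D * (1 + norm s)" unfolding x_def using l by linarith
    qed (use x0 in auto)
    also have "\<dots> = D powr (5 / 4) * (1 + norm s) powr (5 / 4)"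
      by (simp add: powr_mult)
    also have "(1 + norm s) powr (5 / 4) \<le> (1 + norm s) powr A" using A by (intro powr_mono) auto
    finally show "norm (Gamma (of_real l * s + \<mu>)) \<le> exp ((K * D powr (5 / 4)) * (1 + norm s) powr A)"
      using K(1) by (simp add: mult_left_mono mult.assoc)
  qed
qed

definition gamma_prod :: "(real \<times> complex) list \<Rightarrow> complex \<Rightarrow> complex" where
  "gamma_prod gs s = (\<Prod>(l, \<mu>)\<leftarrow>gs. Gamma (of_real l * s + \<mu>))"

lemma gamma_prod_simps [simp]:
  "gamma_prod [] s = 1"
  "gamma_prod ((l, \<mu>) # gs) s = Gamma (of_real l * s + \<mu>) * gamma_prod gs s"
  by (simp_all add: gamma_prod_def)

definition good_params :: "(real \<times> complex) list \<Rightarrow> bool" where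
  "good_params gs \<longleftrightarrow> (\<forall>(l, \<mu>) \<in> set gs. l > 0 \<and> Re \<mu> \<ge> 0)"

lemma good_params_Cons [simp]: "good_params ((l, \<mu>) # gs) \<longleftrightarrow> l > 0 \<and> Re \<mu> \<ge> 0 \<and> good_params gs"
  by (simp add: good_params_def)

lemma Gamma_arg_not_pole:
  assumes "Re s > 0" "l > 0" "Re \<mu> \<ge> 0"
  shows "of_real l * s + \<mu> \<notin> \<int>\<^sub>\<le>\<^sub>0"
proof (rule Re_pos_not_nonpos_Int)
  have "l * Re s > 0" using assms by simp
  moreover have "Re (of_real l * s + \<mu>) = l * Re s + Re \<mu>" by simp
  ultimately show "Re (of_real l * s + \<mu>) > 0" using assms(3) by linarith
qed

lemma gamma_prod_nonzero: "good_params gs \<Longrightarrow> Re s > 0 \<Longrightarrow> gamma_prod gs s \<noteq> 0"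
  by (induction gs) (auto simp: Gamma_eq_zero_iff Gamma_arg_not_pole)

lemma holomorphic_gamma_prod: "good_params gs \<Longrightarrow> gamma_prod gs holomorphic_on {s. Re s > 0}"
proof (induction gs)
  case (Cons p gs)
  obtain l \<mu> where p: "p = (l, \<mu>)" by (cases p)
  have "(\<lambda>s. Gamma (of_real l * s + \<mu>) * gamma_prod gs s) holomorphic_on {s. Re s > 0}"
    using Cons p by (intro holomorphic_intros) (auto simp: Gamma_arg_not_pole)
  thus ?case by (rule holomorphic_transform) (simp add: p)
qed (simp add: gamma_prod_def[abs_def])

lemma exp_bounded_gamma_prod:
  assumes "A \<ge> 5 / 4" "r > 0" "\<And>s. s \<in> S \<Longrightarrow> Re s \<ge> r"
  shows "good_params gs \<Longrightarrow> exp_bounded A (gamma_prod gs) S"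
proof (induction gs)
  case Nil
  show ?case using assms(1) by (intro exp_bounded_const[where B = 1]) auto
next
  case (Cons p gs)
  obtain l \<mu> where p: "p = (l, \<mu>)" by (cases p)
  have "exp_bounded A (\<lambda>s. Gamma (of_real l * s + \<mu>) * gamma_prod gs s) S"
    using Cons p assms by (intro exp_bounded_mult exp_bounded_Gamma[where r = r]) auto
  thus ?case by (rule exp_bounded_cong[THEN iffD1, rotated]) (simp add: p)
qed

text \<open>On a vertical line the bound Gamma (Re z) for |Gamma z| is constant.\<close>

lemma gamma_prod_bounded_line:
  assumes "\<sigma> > 0"
  shows "good_params gs \<Longrightarrow> \<exists>B. \<forall>s. Re s = \<sigma> \<longrightarrow> norm (gamma_prod gs s) \<le> B"
proof (induction gs)
  case (Cons p gs)
  obtain l \<mu> where p: "p = (l, \<mu>)" by (cases p)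
  from Cons p obtain B where B: "\<And>s. Re s = \<sigma> \<Longrightarrow> norm (gamma_prod gs s) \<le> B" by auto
  have l: "l > 0" "Re \<mu> \<ge> 0" using Cons.prems p by auto
  have "norm (gamma_prod (p # gs) s) \<le> Gamma (l * \<sigma> + Re \<mu>) * \<bar>B\<bar>" if s: "Re s = \<sigma>" for s
  proof -
    have "Re (of_real l * s + \<mu>) > 0" using l assms s by (simp add: add_pos_nonneg)
    hence "norm (Gamma (of_real l * s + \<mu>)) \<le> Gamma (l * \<sigma> + Re \<mu>)"
      using norm_Gamma_le[of "of_real l * s + \<mu>"] s by simp
    moreover have "norm (gamma_prod gs s) \<le> \<bar>B\<bar>" using B[OF s] by simp
    ultimately show ?thesis unfolding p gamma_prod_simps norm_mult
      using norm_ge_zero order_trans by (intro mult_mono) blast+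
  qed
  thus ?case by blast
qed auto

text \<open>The order is raised to at least 5/4 so that the Gamma factors obey a bound of the same
  form.\<close>

lemma entire_of_finite_order_exp_bounded:
  assumes "entire_of_finite_order g"
  obtains A where "A \<ge> 5 / 4" "exp_bounded A g UNIV"
proof -
  obtain A0 where hol: "g holomorphic_on UNIV"
    and A0: "(\<lambda>z. norm (g z)) \<in> O[at_infinity](\<lambda>z. exp (norm z powr A0))"
    using assms by (auto simp: entire_of_finite_order_def)
  define A where "A = max A0 (5 / 4)"
  obtain c where c: "c > 0" "eventually (\<lambda>z. norm (norm (g z)) \<le> c * norm (exp (norm z powr A0))) at_infinity"
    using landau_o.bigE[OF A0] by blast
  then obtain r where r: "\<And>z. r \<le> norm z \<Longrightarrow> norm (g z) \<le> c * exp (norm z powr A0)"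
    by (auto simp: eventually_at_infinity)
  have "compact (g ` cball 0 (max r 1))"
    by (intro compact_continuous_image holomorphic_on_imp_continuous_on holomorphic_on_subset[OF hol]) auto
  then obtain M where M: "\<And>z. norm z \<le> max r 1 \<Longrightarrow> norm (g z) \<le> M"
    using compact_imp_bounded bounded_pos by (metis (no_types, lifting) dist_0_norm image_eqI mem_cball)
  define C where "C = 1 + \<bar>M\<bar> + c"
  have "norm (g z) \<le> exp (C * (1 + norm z) powr A)" for z
  proof -
    have p1: "1 \<le> (1 + norm z) powr A" by (intro ge_one_powr_ge_zero) (auto simp: A_def)
    have C0: "C \<ge> 0" using c(1) by (simp add: C_def)
    show ?thesis
    proof (cases "norm z \<le> max r 1")
      case True
      have "norm (g z) \<le> \<bar>M\<bar>" using M[OF True] by simp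
      also have "\<dots> \<le> exp \<bar>M\<bar>" using exp_ge_add_one_self[of "\<bar>M\<bar>"] by linarith
      also have "\<bar>M\<bar> \<le> C * 1" using c(1) by (simp add: C_def)
      also have "C * 1 \<le> C * (1 + norm z) powr A" using p1 C0 by (intro mult_left_mono)
      finally show ?thesis by simp
    next
      case False
      have "norm (g z) \<le> c * exp (norm z powr A0)" using False by (intro r) auto
      also have "\<dots> \<le> exp c * exp ((1 + norm z) powr A)"
      proof (intro mult_mono)
        show "c \<le> exp c" using exp_ge_add_one_self[of c] by linarith
        have "norm z powr A0 \<le> norm z powr A" using False by (intro powr_mono) (auto simp: A_def)
        also have "\<dots> \<le> (1 + norm z) powr A" by (intro powr_mono2) (auto simp: A_def)
        finally show "exp (norm z powr A0) \<le> exp ((1 + norm z) powr A)" by simp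
      qed auto
      also have "\<dots> = exp (c * 1 + (1 + norm z) powr A)" by (simp flip: exp_add)
      also have "c * 1 + (1 + norm z) powr A \<le> C * (1 + norm z) powr A"
      proof -
        have "c * 1 \<le> (c + \<bar>M\<bar>) * (1 + norm z) powr A" using p1 c(1) by (intro mult_mono) auto
        thus ?thesis by (simp add: C_def algebra_simps)
      qed
      finally show ?thesis by simp
    qed
  qed
  hence "exp_bounded A g UNIV" by (intro exp_boundedI)
  thus ?thesis by (intro that[of A]) (auto simp: A_def)
qed

text \<open>The formula for \<open>h\<close> may fail at the single point c, whether or not c is s:
  the limit behind \<open>remove_sings\<close> ignores the value at s, and near any other point c is
  avoided.\<close>

lemma remove_sings_agree:
  assumes "open U" "f holomorphic_on U" "\<And>z. z \<in> U \<Longrightarrow> z \<noteq> c \<Longrightarrow> h z = f z" "s \<in> U"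
  shows "remove_sings h s = f s"
proof (rule remove_sings_eqI)
  have "continuous (at s) f"
    using holomorphic_on_imp_continuous_on[OF assms(2)] assms(1,4) continuous_on_eq_continuous_at by blast
  hence "f \<midarrow>s\<rightarrow> f s" by (simp add: isCont_def)
  moreover have "eventually (\<lambda>z. f z = h z) (at s)"
    using eventually_at_in_open[OF assms(1,4)] eventually_neq_at_within[of c s UNIV]
    by eventually_elim (use assms(3) in auto)
  ultimately show "h \<midarrow>s\<rightarrow> f s" by (rule Lim_transform_eventually)
qed

section \<open>The entire function xi\<close>

locale selberg_xi =
  fixes F :: "complex \<Rightarrow> complex" and Q :: real and gs :: "(real \<times> complex) list" and \<omega> :: complex
    and b :: "nat \<Rightarrow> complex" and g :: "complex \<Rightarrow> complex"
  assumes fe: "functional_equation F Q gs \<omega>"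
    and euler: "euler_coeffs F b"
    and g_entire: "entire_of_finite_order g"
    and g_eq: "\<And>s. s \<noteq> 1 \<Longrightarrow> g s = (s - 1) ^ pole_order_at_1 F * F s"
begin

abbreviation m where "m \<equiv> pole_order_at_1 F"
abbreviation \<xi> where "\<xi> \<equiv> xi_fun F Q gs"

text \<open>A formula for xi in Re s > 0 in which the pole of F at 1 is already absorbed in
  \<open>g\<close>. Its reflection serves in Re s < 1, and these two half-planes cover the
  plane.\<close>

definition xi_right :: "complex \<Rightarrow> complex" where
  "xi_right s = s ^ m * g s * of_real Q powr s * gamma_prod gs s"

lemma Q_pos: "Q > 0" and \<omega>_norm: "norm \<omega> = 1" and good: "good_params gs"
  and fe_eq: "completed F Q gs s = \<omega> * cnj (completed F Q gs (1 - cnj s))"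
  using fe unfolding functional_equation_def good_params_def by blast+

lemma \<omega>_cnj: "\<omega> * cnj \<omega> = 1"
  using \<omega>_norm by (simp add: complex_norm_square[symmetric])

lemma g_holomorphic: "g holomorphic_on UNIV"
  using g_entire by (simp add: entire_of_finite_order_def)

lemma F_eq: "s \<noteq> 1 \<Longrightarrow> F s = g s / (s - 1) ^ m"
  using g_eq[of s] by simp

lemma xi_right_holomorphic: "xi_right holomorphic_on {s. Re s > 0}"
  unfolding xi_right_def using Q_pos
  by (intro holomorphic_intros holomorphic_gamma_prod good holomorphic_on_subset[OF g_holomorphic]) auto

text \<open>For Re s > 0 the Gamma factors have no poles, so s = 1 is the only point there at which
  \<open>remove_sings\<close> can change the product.\<close>

lemma completed_right:
  assumes s: "Re s > 0" "s \<noteq> 1"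
  shows "completed F Q gs s = F s * of_real Q powr s * gamma_prod gs s"
proof -
  have "(\<lambda>s. F s * of_real Q powr s * gamma_prod gs s) holomorphic_on {s. Re s > 0} - {1}"
  proof (rule holomorphic_transform)
    show "(\<lambda>s. g s / (s - 1) ^ m * of_real Q powr s * gamma_prod gs s) holomorphic_on {s. Re s > 0} - {1}"
      using Q_pos by (intro holomorphic_intros holomorphic_on_subset[OF holomorphic_gamma_prod[OF good]]
          holomorphic_on_subset[OF g_holomorphic]) auto
  qed (simp add: F_eq)
  moreover have "open ({s. Re s > 0} - {1})" by (intro open_Diff open_halfspace_Re_gt) auto
  ultimately have "(\<lambda>s. F s * of_real Q powr s * gamma_prod gs s) analytic_on {s}"
    using s by (intro holomorphic_on_imp_analytic_at) auto
  thus ?thesis unfolding completed_def gamma_prod_def by (rule remove_sings_at_analytic)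
qed

lemma product_right:
  assumes "Re s > 0" "s \<noteq> 1"
  shows "s ^ m * (s - 1) ^ m * completed F Q gs s = xi_right s"
  using assms by (simp add: completed_right xi_right_def g_eq)

lemma product_left:
  assumes "Re s < 1" "s \<noteq> 0"
  shows "s ^ m * (s - 1) ^ m * completed F Q gs s = \<omega> * cnj (xi_right (1 - cnj s))"
proof -
  define w where "w = 1 - cnj s"
  have w: "Re w > 0" "w \<noteq> 1" using assms by (auto simp: w_def)
  have sw: "s = 1 - cnj w" by (simp add: w_def)
  \<comment> \<open>Under s -> 1 - cnj s the two factors are exchanged up to conjugation and sign,
    and the two signs (-1)^m cancel.\<close>
  have "s ^ m * (s - 1) ^ m = (- (s - 1)) ^ m * (- s) ^ m"
    by (simp flip: power_mult_distrib add: algebra_simps)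
  also have "\<dots> = cnj (w ^ m * (w - 1) ^ m)" by (simp add: sw algebra_simps)
  finally have sw': "s ^ m * (s - 1) ^ m = cnj (w ^ m * (w - 1) ^ m)" .
  have "s ^ m * (s - 1) ^ m * completed F Q gs s = cnj (w ^ m * (w - 1) ^ m) * (\<omega> * cnj (completed F Q gs w))"
    unfolding sw' using fe_eq[of s] by (simp only: w_def)
  also have "\<dots> = \<omega> * cnj (w ^ m * (w - 1) ^ m * completed F Q gs w)" by (simp add: mult_ac)
  finally show ?thesis unfolding product_right[OF w] by (simp only: w_def)
qed

lemma xi_eq_right:
  assumes "Re s > 0"
  shows "\<xi> s = xi_right s"
  unfolding xi_fun_def using product_right assms
  by (intro remove_sings_agree[OF open_halfspace_Re_gt[of 0] xi_right_holomorphic, of 1]) auto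

lemma reflect_holomorphic: "(\<lambda>s. \<omega> * cnj (xi_right (1 - cnj s))) holomorphic_on {s. Re s < 1}"
proof -
  have "(\<lambda>s. xi_right (1 - s)) holomorphic_on cnj ` {s. Re s < 1}"
    by (rule holomorphic_on_compose_gen[of "\<lambda>s. 1 - s" _ xi_right "{s. Re s > 0}", unfolded o_def])
       (auto intro!: holomorphic_intros xi_right_holomorphic)
  from holomorphic_on_compose_cnj_cnj[OF this open_halfspace_Re_lt]
  have "(\<lambda>s. cnj (xi_right (1 - cnj s))) holomorphic_on {s. Re s < 1}" by (simp add: o_def)
  thus ?thesis by (intro holomorphic_intros)
qed

lemma xi_eq_left:
  assumes "Re s < 1"
  shows "\<xi> s = \<omega> * cnj (xi_right (1 - cnj s))"
  unfolding xi_fun_def using product_left assms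
  by (intro remove_sings_agree[OF open_halfspace_Re_lt[of 1] reflect_holomorphic, of 0]) auto

lemma xi_holomorphic: "\<xi> holomorphic_on UNIV"
proof -
  have "\<xi> holomorphic_on {s. Re s > 0}"
    by (rule holomorphic_transform[OF xi_right_holomorphic]) (simp add: xi_eq_right)
  moreover have "\<xi> holomorphic_on {s. Re s < 1}"
    by (rule holomorphic_transform[OF reflect_holomorphic]) (simp add: xi_eq_left)
  ultimately have "\<xi> holomorphic_on {s. Re s > 0} \<union> {s. Re s < 1}"
    by (intro holomorphic_on_Un open_halfspace_Re_gt open_halfspace_Re_lt)
  moreover have "{s. Re s > 0} \<union> {s. Re s < 1} = (UNIV :: complex set)" by auto
  ultimately show ?thesis by simp
qed

lemma xi_reflect: "\<xi> s = \<omega> * cnj (\<xi> (1 - cnj s))"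
proof (cases "Re s < 1")
  case True
  thus ?thesis by (simp add: xi_eq_left xi_eq_right)
next
  case False
  hence "\<xi> (1 - cnj s) = \<omega> * cnj (\<xi> s)" by (subst xi_eq_left) (simp_all add: xi_eq_right)
  thus ?thesis using \<omega>_cnj by (simp add: mult.assoc[symmetric])
qed

lemma norm_xi_reflect: "norm (\<xi> (1 - cnj s)) = norm (\<xi> s)"
  using xi_reflect[of s] \<omega>_norm by (simp add: norm_mult)

lemma xi_nonzero: "Re s > 1 \<Longrightarrow> \<xi> s \<noteq> 0"
proof -
  assume s: "Re s > 1"
  hence "s \<noteq> 0" "s \<noteq> 1" by auto
  moreover have "F s \<noteq> 0" using euler_product_nonzero[OF euler s] .
  ultimately show "\<xi> s \<noteq> 0"
    using s Q_pos gamma_prod_nonzero[OF good, of s] by (simp add: xi_eq_right xi_right_def g_eq)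
qed

lemma xi_zeros_strip: "\<xi> s = 0 \<Longrightarrow> 0 \<le> Re s \<and> Re s \<le> 1"
  using xi_nonzero[of s] xi_nonzero[of "1 - cnj s"] norm_xi_reflect[of s] by fastforce

lemma xi_exp_bounded_right:
  assumes "A \<ge> 5 / 4" "exp_bounded A g S" "r > 0" "\<And>s. s \<in> S \<Longrightarrow> Re s \<ge> r"
  shows "exp_bounded A \<xi> S"
proof -
  have "exp_bounded A xi_right S"
    unfolding xi_right_def[abs_def] using assms Q_pos exp_bounded_linear[of A 0 S]
    by (intro exp_bounded_mult exp_bounded_power exp_bounded_powr_base exp_bounded_gamma_prod[OF _ assms(3)] good) auto
  moreover have "\<xi> s = xi_right s" if "s \<in> S" for s using assms(3,4) that by (intro xi_eq_right) force
  ultimately show ?thesis using exp_bounded_cong[of S \<xi> xi_right A] by simp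
qed

lemma xi_exp_bounded_reflect:
  assumes "A \<ge> 0" "exp_bounded A \<xi> S"
  shows "exp_bounded A \<xi> ((\<lambda>s. 1 - cnj s) ` S)"
proof -
  obtain C where C: "\<And>s. s \<in> S \<Longrightarrow> norm (\<xi> s) \<le> exp (C * (1 + norm s) powr A)"
    using assms by (auto simp: exp_bounded_def)
  show ?thesis
  proof (rule exp_boundedI)
    fix w assume "w \<in> (\<lambda>s. 1 - cnj s) ` S"
    then obtain s where s: "s \<in> S" "w = 1 - cnj s" by auto
    have "s = 1 - cnj w" using s by simp
    hence "norm s \<le> 1 + norm w" by (metis complex_mod_cnj norm_one norm_triangle_ineq4)
    hence "1 + norm s \<le> 2 * (1 + norm w)" by (smt (verit) norm_ge_zero)
    hence "(1 + norm s) powr A \<le> (2 * (1 + norm w)) powr A"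
      using assms(1) by (intro powr_mono2) auto
    also have "\<dots> = 2 powr A * (1 + norm w) powr A" by (rule powr_mult)
    finally have "C * (1 + norm s) powr A \<le> \<bar>C\<bar> * (2 powr A * (1 + norm w) powr A)"
      by (intro mult_mono) auto
    moreover have "norm (\<xi> w) = norm (\<xi> s)" using s norm_xi_reflect by simp
    ultimately show "norm (\<xi> w) \<le> exp ((\<bar>C\<bar> * 2 powr A) * (1 + norm w) powr A)"
      using order_trans[OF C[OF s(1)]] by (simp add: mult.assoc)
  qed
qed

lemma euler_log:
  obtains L M where "L holomorphic_on {s. Re s > 8 / 5}" "\<And>s. Re s > 8 / 5 \<Longrightarrow> F s = exp (L s)"
    "\<And>s. Re s > 8 / 5 \<Longrightarrow> norm (L s) \<le> M"
  using euler_product_log[OF euler] by blast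

lemma F_bounded_right:
  obtains M where "\<And>s. Re s > 8 / 5 \<Longrightarrow> norm (F s) \<le> M"
proof -
  obtain L M where L: "\<And>s. Re s > 8 / 5 \<Longrightarrow> F s = exp (L s)" "\<And>s. Re s > 8 / 5 \<Longrightarrow> norm (L s) \<le> M"
    using euler_log by metis
  have "norm (F s) \<le> exp M" if "Re s > 8 / 5" for s
    using L[OF that] norm_exp[of "L s"] by (metis exp_le_cancel_iff order_trans)
  thus ?thesis using that by blast
qed

text \<open>On Re s = 2 the factors F, Q^s and Gamma are bounded, so only the polynomial s^m (s -
  1)^m grows; the line Re s = -1 is the mirror image. The reference point 5 has distance at least 3
  from the strip, so |s| <= |s - 5| + 5 <= 3 |s - 5|, and division by (s - 5)^(2m) creates no pole
  there.\<close>

lemma xi_poly_bound_line: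
  obtains B where "B > 0" "\<And>s. Re s = - 1 \<or> Re s = 2 \<Longrightarrow> norm (\<xi> s) \<le> B * norm (s - 5) ^ (2 * m)"
proof -
  obtain M where M: "\<And>s. Re s > 8 / 5 \<Longrightarrow> norm (F s) \<le> M" using F_bounded_right by blast
  obtain G where G: "\<And>s. Re s = 2 \<Longrightarrow> norm (gamma_prod gs s) \<le> G"
    using gamma_prod_bounded_line[OF _ good, of 2] by auto
  define B0 where "B0 = \<bar>M\<bar> * (Q powr 2 * \<bar>G\<bar>) + 1"
  have "\<bar>M\<bar> * (Q powr 2 * \<bar>G\<bar>) \<ge> 0" by simp
  hence B0: "B0 > 0" unfolding B0_def by linarith
  have right: "norm (\<xi> s) \<le> B0 * (norm s * norm (s - 1)) ^ m" if s: "Re s = 2" for s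
  proof -
    have s1: "s \<noteq> 1" using s by auto
    have "norm (\<xi> s) = norm s ^ m * norm (s - 1) ^ m * (norm (F s) * (Q powr 2 * norm (gamma_prod gs s)))"
      using s s1 Q_pos by (simp add: xi_eq_right xi_right_def g_eq norm_mult norm_power norm_powr_real_powr)
    also have "\<dots> \<le> norm s ^ m * norm (s - 1) ^ m * (\<bar>M\<bar> * (Q powr 2 * \<bar>G\<bar>))"
      using M[of s] G[of s] s by (intro mult_left_mono mult_mono) auto
    also have "\<dots> \<le> norm s ^ m * norm (s - 1) ^ m * B0" by (intro mult_left_mono) (auto simp: B0_def)
    finally show ?thesis by (simp add: power_mult_distrib mult_ac)
  qed
  define B where "B = B0 * 9 ^ m"
  have "norm (\<xi> s) \<le> B * norm (s - 5) ^ (2 * m)" if s: "Re s = - 1 \<or> Re s = 2" for s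
  proof -
    define w where "w = (if Re s = 2 then s else 1 - cnj s)"
    have w: "Re w = 2" using s by (auto simp: w_def)
    have xw: "norm (\<xi> w) = norm (\<xi> s)" using norm_xi_reflect by (simp add: w_def)
    have d: "norm (s - 5) \<ge> 3" using abs_Re_le_cmod[of "s - 5"] s by auto
    have "norm s \<le> norm (s - 5) + 5" using norm_triangle_ineq[of "s - 5" 5] by simp
    moreover have "norm (1 - cnj s) = norm (1 - s)" by (metis complex_cnj_diff complex_cnj_one complex_mod_cnj)
    moreover have "norm (s - 1) \<le> norm (s - 5) + 4" using norm_triangle_ineq[of "s - 5" 4] by simp
    moreover have "norm (w - 1) = norm (s - 1) \<or> norm (w - 1) = norm s" 
      by (simp add: w_def norm_minus_commute)
    ultimately have n: "norm w \<le> 3 * norm (s - 5)" "norm (w - 1) \<le> 3 * norm (s - 5)"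
      using d by (auto simp: w_def norm_minus_commute)
    have "norm (\<xi> s) \<le> B0 * (norm w * norm (w - 1)) ^ m" using right[OF w] xw by simp
    also have "\<dots> \<le> B0 * ((3 * norm (s - 5)) * (3 * norm (s - 5))) ^ m"
      using n B0 by (intro mult_left_mono power_mono mult_mono) auto
    also have "((3 * norm (s - 5)) * (3 * norm (s - 5))) ^ m = 9 ^ m * norm (s - 5) ^ (2 * m)"
    proof -
      have "(3 * norm (s - 5)) * (3 * norm (s - 5)) = 9 * norm (s - 5) ^ 2" by (simp add: power2_eq_square)
      thus ?thesis by (simp only: power_mult_distrib power_mult)
    qed
    finally show ?thesis by (simp add: B_def)
  qed
  moreover have "B > 0" using B0 by (simp add: B_def)
  ultimately show ?thesis using that by blast
qed

text \<open>For \<open>g\<close> only some unknown order A is given. That is enough for the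
  Phragmen-Lindelof principle, which reduces the growth inside the strip to the polynomial growth on
  its boundary, and so to exponent 5/4.\<close>

lemma xi_exp_bounded_strip: "exp_bounded (5 / 4) \<xi> {s. - 1 \<le> Re s \<and> Re s \<le> 2}"
proof -
  obtain A where A: "A \<ge> 5 / 4" "exp_bounded A g UNIV"
    using entire_of_finite_order_exp_bounded[OF g_entire] by blast
  have "exp_bounded A \<xi> {s. 1 / 2 \<le> Re s}"
    by (rule xi_exp_bounded_right[OF A(1) exp_bounded_subset[OF A(2)], of _ "1 / 2"]) auto
  moreover from this have "exp_bounded A \<xi> ((\<lambda>s. 1 - cnj s) ` {s. 1 / 2 \<le> Re s})"
    using A(1) by (intro xi_exp_bounded_reflect) auto
  ultimately have "exp_bounded A \<xi> ({s. 1 / 2 \<le> Re s} \<union> (\<lambda>s. 1 - cnj s) ` {s. 1 / 2 \<le> Re s})"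
    by (rule exp_bounded_union)
  moreover have "s \<in> {s. 1 / 2 \<le> Re s} \<union> (\<lambda>s. 1 - cnj s) ` {s. 1 / 2 \<le> Re s}" for s
    by (cases "1 / 2 \<le> Re s") (auto intro!: image_eqI[of s _ "1 - cnj s"])
  ultimately obtain C where C: "\<And>s. norm (\<xi> s) \<le> exp (C * (1 + norm s) powr A)"
    by (auto simp: exp_bounded_def)
  obtain B where B: "B > 0" "\<And>s. Re s = - 1 \<or> Re s = 2 \<Longrightarrow> norm (\<xi> s) \<le> B * norm (s - 5) ^ (2 * m)"
    using xi_poly_bound_line by blast
  have d: "norm (s - 5) \<ge> 3" if "Re s \<le> 2" for s using abs_Re_le_cmod[of "s - 5"] that by auto
  have bound: "norm (\<xi> s) \<le> B * norm ((s - 5) ^ (2 * m))" if s: "- 1 \<le> Re s" "Re s \<le> 2" for s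
  proof -
    have "norm (\<xi> s / (s - 5) ^ (2 * m)) \<le> B"
    proof (rule phragmen_lindelof_strip[where f = "\<lambda>s. \<xi> s / (s - 5) ^ (2 * m)" and
          a = "-1" and b = 2 and A = A and C = C and ?z0.0 = s])
      show "(\<lambda>s. \<xi> s / (s - 5) ^ (2 * m)) holomorphic_on {z. - 1 \<le> Re z \<and> Re z \<le> 2}"
        by (intro holomorphic_intros holomorphic_on_subset[OF xi_holomorphic]) auto
      fix z :: complex
      show "norm (\<xi> z / (z - 5) ^ (2 * m)) \<le> exp (C * (1 + norm z) powr A)" if "Re z \<le> 2"
      proof -
        have "1 \<le> norm (z - 5) ^ (2 * m)" using d[OF that] by (intro one_le_power) auto
        hence "norm (\<xi> z) / norm (z - 5) ^ (2 * m) \<le> norm (\<xi> z) / 1" by (intro divide_left_mono) auto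
        thus ?thesis using C[of z] by (simp add: norm_divide norm_power)
      qed
      show "norm (\<xi> z / (z - 5) ^ (2 * m)) \<le> B" if "Re z = - 1 \<or> Re z = 2"
      proof -
        have "norm (z - 5) ^ (2 * m) > 0" using d[of z] that by (intro zero_less_power) auto
        thus ?thesis using B(2)[OF that] by (simp add: norm_divide norm_power field_simps)
      qed
    qed (use s A(1) B(1) in auto)
    moreover have "norm ((s - 5) ^ (2 * m)) > 0" using d[OF s(2)] by auto
    ultimately show ?thesis by (simp add: norm_divide field_simps)
  qed
  have "exp_bounded (5 / 4) (\<lambda>s. of_real B * (s - 5) ^ (2 * m)) {s. - 1 \<le> Re s \<and> Re s \<le> 2}"
    by (intro exp_bounded_mult exp_bounded_power exp_bounded_linear exp_bounded_const[where B = "\<bar>B\<bar>"]) auto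
  then obtain D where D: "\<And>s. - 1 \<le> Re s \<Longrightarrow> Re s \<le> 2 \<Longrightarrow>
      norm (of_real B * (s - 5) ^ (2 * m)) \<le> exp (D * (1 + norm s) powr (5 / 4))"
    by (auto simp: exp_bounded_def)
  show ?thesis
  proof (rule exp_boundedI)
    fix s assume "s \<in> {s. - 1 \<le> Re s \<and> Re s \<le> 2}"
    thus "norm (\<xi> s) \<le> exp (D * (1 + norm s) powr (5 / 4))"
      using D[of s] bound[of s] B(1) by (simp add: norm_mult)
  qed
qed

text \<open>To the right of the strip the Euler product bounds F, so that the Gamma factors
  determine the growth; to the left the reflection gives the same.\<close>

lemma xi_growth:
  obtains C where "\<And>s. norm (\<xi> s) \<le> exp (C * (1 + norm (s - 2)) powr (5 / 4))"
proof -
  obtain M where M: "\<And>s. Re s > 8 / 5 \<Longrightarrow> norm (F s) \<le> M" using F_bounded_right by blast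
  have "exp_bounded (5 / 4) (\<lambda>s. (s - 1) ^ m * F s) {s. 2 \<le> Re s}"
    using M by (intro exp_bounded_mult exp_bounded_power exp_bounded_linear exp_bounded_const[where B = M]) auto
  hence "exp_bounded (5 / 4) g {s. 2 \<le> Re s}"
  proof (rule exp_bounded_cong[THEN iffD1, rotated])
    fix s assume "s \<in> {s. 2 \<le> Re s}"
    hence "s \<noteq> 1" by auto
    thus "(s - 1) ^ m * F s = g s" by (simp add: g_eq)
  qed
  hence R: "exp_bounded (5 / 4) \<xi> {s. 2 \<le> Re s}" by (intro xi_exp_bounded_right[of _ _ 2]) auto
  hence "exp_bounded (5 / 4) \<xi> ((\<lambda>s. 1 - cnj s) ` {s. 2 \<le> Re s})" by (intro xi_exp_bounded_reflect) auto
  with R xi_exp_bounded_strip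
  have "exp_bounded (5 / 4) \<xi> ({s. 2 \<le> Re s} \<union> (\<lambda>s. 1 - cnj s) ` {s. 2 \<le> Re s} \<union> {s. - 1 \<le> Re s \<and> Re s \<le> 2})"
    by (intro exp_bounded_union)
  moreover have "s \<in> {s. 2 \<le> Re s} \<union> (\<lambda>s. 1 - cnj s) ` {s. 2 \<le> Re s} \<union> {s. - 1 \<le> Re s \<and> Re s \<le> 2}" for s
    by (cases "Re s < - 1") (auto intro!: image_eqI[of s _ "1 - cnj s"])
  ultimately obtain C where C: "\<And>s. norm (\<xi> s) \<le> exp (C * (1 + norm s) powr (5 / 4))"
    by (auto simp: exp_bounded_def)
  have "norm (\<xi> s) \<le> exp ((\<bar>C\<bar> * 3 powr (5 / 4)) * (1 + norm (s - 2)) powr (5 / 4))" for s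
  proof -
    have "norm s \<le> norm (s - 2) + 2" using norm_triangle_ineq[of "s - 2" 2] by simp
    hence "1 + norm s \<le> 3 * (1 + norm (s - 2))" by (smt (verit) norm_ge_zero)
    hence "(1 + norm s) powr (5 / 4) \<le> (3 * (1 + norm (s - 2))) powr (5 / 4)"
      by (intro powr_mono2) auto
    also have "\<dots> = 3 powr (5 / 4) * (1 + norm (s - 2)) powr (5 / 4)" by (rule powr_mult)
    finally have "C * (1 + norm s) powr (5 / 4) \<le> \<bar>C\<bar> * (3 powr (5 / 4) * (1 + norm (s - 2)) powr (5 / 4))"
      by (intro mult_mono) auto
    thus ?thesis using order_trans[OF C[of s]] by (simp add: mult.assoc)
  qed
  thus ?thesis using that by blast
qed

end

section \<open>The logarithmic derivative of xi on the line Re s = 2\<close>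

definition digamma_sum :: "(real \<times> complex) list \<Rightarrow> complex \<Rightarrow> complex" where
  "digamma_sum gs s = (\<Sum>(l, \<mu>)\<leftarrow>gs. of_real l * Digamma (of_real l * s + \<mu>))"

lemma digamma_sum_simps [simp]:
  "digamma_sum [] s = 0"
  "digamma_sum ((l, \<mu>) # gs) s = of_real l * Digamma (of_real l * s + \<mu>) + digamma_sum gs s"
  by (simp_all add: digamma_sum_def)

lemma gamma_prod_has_field_derivative:
  assumes s: "Re s > 0"
  shows "good_params gs \<Longrightarrow> (gamma_prod gs has_field_derivative gamma_prod gs s * digamma_sum gs s) (at s)"
proof (induction gs)
  case Nil
  have "gamma_prod [] = (\<lambda>_. 1)" by (intro ext) simp
  thus ?case by simp
next
  case (Cons p gs)
  obtain l \<mu> where p: "p = (l, \<mu>)" by (cases p)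
  have "of_real l * s + \<mu> \<notin> \<int>\<^sub>\<le>\<^sub>0" using Cons.prems s by (intro Gamma_arg_not_pole) (auto simp: p)
  hence d1: "((\<lambda>s. Gamma (of_real l * s + \<mu>)) has_field_derivative
      Gamma (of_real l * s + \<mu>) * Digamma (of_real l * s + \<mu>) * of_real l) (at s)"
    by (auto intro!: derivative_eq_intros)
  have d2: "(gamma_prod gs has_field_derivative gamma_prod gs s * digamma_sum gs s) (at s)"
    using Cons by (simp add: p)
  have "((\<lambda>s. Gamma (of_real l * s + \<mu>) * gamma_prod gs s) has_field_derivative
      gamma_prod (p # gs) s * digamma_sum (p # gs) s) (at s)"
    by (rule DERIV_cong[OF DERIV_mult[OF d1 d2]]) (simp add: p algebra_simps)
  moreover have "gamma_prod (p # gs) = (\<lambda>s. Gamma (of_real l * s + \<mu>) * gamma_prod gs s)"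
    by (intro ext) (simp add: p)
  ultimately show ?case by simp
qed

lemma digamma_sum_line_bound:
  "good_params gs \<Longrightarrow> \<exists>K\<ge>0. \<forall>t. \<bar>t\<bar> \<ge> 1 \<longrightarrow> \<bar>Re (digamma_sum gs (2 + \<i> * of_real t))\<bar> \<le> K * (1 + ln \<bar>t\<bar>)"
proof (induction gs)
  case (Cons p gs)
  obtain l \<mu> where p: "p = (l, \<mu>)" by (cases p)
  have l: "l > 0" "Re \<mu> \<ge> 0" using Cons.prems by (auto simp: p)
  obtain K where K: "K \<ge> 0" "\<And>t. \<bar>t\<bar> \<ge> 1 \<Longrightarrow> \<bar>Re (digamma_sum gs (2 + \<i> * of_real t))\<bar> \<le> K * (1 + ln \<bar>t\<bar>)"
    using Cons by (auto simp: p)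
  obtain K' where K': "K' \<ge> 0" "\<And>t. \<bar>t\<bar> \<ge> 1 \<Longrightarrow>
    \<bar>Re (Digamma (of_real l * (2 + \<i> * of_real t) + \<mu>))\<bar> \<le> K' * (1 + ln \<bar>t\<bar>)"
    using Re_Digamma_line_bound[OF l] by blast
  have "\<bar>Re (digamma_sum (p # gs) (2 + \<i> * of_real t))\<bar> \<le> (l * K' + K) * (1 + ln \<bar>t\<bar>)" if t: "\<bar>t\<bar> \<ge> 1" for t
  proof -
    define d where "d = Re (Digamma (of_real l * (2 + \<i> * of_real t) + \<mu>))"
    have "\<bar>l * d\<bar> \<le> l * (K' * (1 + ln \<bar>t\<bar>))" using K'(2)[OF t] l by (simp add: d_def abs_mult)
    moreover have "Re (digamma_sum (p # gs) (2 + \<i> * of_real t)) = l * d + Re (digamma_sum gs (2 + \<i> * of_real t))"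
      by (simp add: p d_def)
    moreover have "(l * K' + K) * (1 + ln \<bar>t\<bar>) = l * (K' * (1 + ln \<bar>t\<bar>)) + K * (1 + ln \<bar>t\<bar>)"
      by (simp add: algebra_simps)
    ultimately show ?thesis using K(2)[OF t] by linarith
  qed
  thus ?case using K(1) K'(1) l by (intro exI[of _ "l * K' + K"]) auto
qed (auto intro!: exI[of _ 0])

lemma digamma_sum_line_diff:
  "good_params gs \<Longrightarrow> \<exists>K\<ge>0. \<forall>t\<ge>1. \<bar>Re (digamma_sum gs (2 + \<i> * of_real t)) - Re (digamma_sum gs (2 - \<i> * of_real t))\<bar> \<le> K / t"
proof (induction gs)
  case (Cons p gs)
  obtain l \<mu> where p: "p = (l, \<mu>)" by (cases p)
  have l: "l > 0" "Re \<mu> \<ge> 0" using Cons.prems by (auto simp: p)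
  define D where "D t = Re (digamma_sum gs (2 + \<i> * of_real t)) - Re (digamma_sum gs (2 - \<i> * of_real t))" for t
  obtain K where K: "K \<ge> 0" "\<And>t. t \<ge> 1 \<Longrightarrow> \<bar>D t\<bar> \<le> K / t"
    using Cons by (auto simp: p D_def)
  obtain K' where K': "K' \<ge> 0" "\<And>t. t \<ge> 1 \<Longrightarrow>
    \<bar>Re (Digamma (of_real l * (2 + \<i> * of_real t) + \<mu>)) - Re (Digamma (of_real l * (2 - \<i> * of_real t) + \<mu>))\<bar> \<le> K' / t"
    using Re_Digamma_line_diff[OF l] by blast
  have "\<bar>Re (digamma_sum (p # gs) (2 + \<i> * of_real t)) - Re (digamma_sum (p # gs) (2 - \<i> * of_real t))\<bar> \<le> (l * K' + K) / t"
    if t: "t \<ge> 1" for t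
  proof -
    define d where "d = Re (Digamma (of_real l * (2 + \<i> * of_real t) + \<mu>)) - Re (Digamma (of_real l * (2 - \<i> * of_real t) + \<mu>))"
    have "\<bar>l * d\<bar> \<le> l * (K' / t)" using K'(2)[OF t] l unfolding d_def[symmetric] abs_mult
      by (intro mult_mono) auto
    moreover have "Re (digamma_sum (p # gs) (2 + \<i> * of_real t)) - Re (digamma_sum (p # gs) (2 - \<i> * of_real t)) = l * d + D t"
      by (simp add: p d_def D_def algebra_simps)
    moreover have "(l * K' + K) / t = l * (K' / t) + K / t" by (simp add: add_divide_distrib)
    ultimately show ?thesis using K(2)[OF t] by linarith
  qed
  thus ?case using K(1) K'(1) l by (intro exI[of _ "l * K' + K"]) auto
qed (auto intro!: exI[of _ 0])

text \<open>Discs of radius 1/5 around points with Re s = 2 stay in Re s >= 9/5; Cauchy's estimate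
  on them gives the factor 5.\<close>

lemma deriv_log_bound:
  assumes L: "L holomorphic_on {s. Re s > 8 / 5}" "\<And>s. Re s > 8 / 5 \<Longrightarrow> norm (L s) \<le> M"
    and s: "Re s = 2"
  shows "norm (deriv L s) \<le> 5 * M"
proof -
  have sub: "cball s (1 / 5) \<subseteq> {s. Re s > 8 / 5}"
  proof
    fix z assume "z \<in> cball s (1 / 5)"
    hence "Re (s - z) \<le> 1 / 5" using complex_Re_le_cmod[of "s - z"] by (simp add: dist_norm)
    thus "z \<in> {s. Re s > 8 / 5}" using s by simp
  qed
  have "norm ((deriv ^^ 1) L s) \<le> fact 1 * M / (1 / 5) ^ 1"
  proof (rule Cauchy_inequality)
    show "L holomorphic_on ball s (1 / 5)" by (rule holomorphic_on_subset[OF L(1) subset_trans[OF ball_subset_cball sub]])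
    show "continuous_on (cball s (1 / 5)) L"
      using holomorphic_on_imp_continuous_on[OF holomorphic_on_subset[OF L(1) sub]] .
    show "norm (L x) \<le> M" if "norm (s - x) = 1 / 5" for x
    proof -
      have "x \<in> {s. Re s > 8 / 5}" using subsetD[OF sub, of x] that by (simp add: dist_norm)
      thus ?thesis using L(2)[of x] by simp
    qed
  qed auto
  thus ?thesis by simp
qed

lemma inverse_line_bound:
  assumes "Re s \<ge> 1"
  shows "\<bar>Re (of_nat k / s)\<bar> \<le> of_nat k"
proof -
  have "1 \<le> norm s" using complex_Re_le_cmod[of s] assms by linarith
  hence "norm (of_nat k / s :: complex) \<le> of_nat k / 1" unfolding norm_divide norm_of_nat
    by (intro divide_left_mono) auto
  thus ?thesis using abs_Re_le_cmod[of "of_nat k / s"] by simp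
qed

context selberg_xi
begin

lemma xi_logderiv:
  assumes L: "L holomorphic_on {s. Re s > 8 / 5}" "\<And>s. Re s > 8 / 5 \<Longrightarrow> F s = exp (L s)"
    and s: "Re s > 8 / 5"
  shows "deriv \<xi> s / \<xi> s = of_nat m / s + of_nat m / (s - 1) + deriv L s + of_real (ln Q) + digamma_sum gs s"
proof -
  have s0: "s \<noteq> 0" "s - 1 \<noteq> 0" using s by auto
  define E where "E = (\<lambda>s. s ^ m * (s - 1) ^ m * exp (L s) * exp (s * of_real (ln Q)) * gamma_prod gs s)"
  have xE: "\<xi> z = E z" if z: "Re z > 8 / 5" for z
  proof -
    have "z \<noteq> 1" using z by auto
    thus ?thesis using z Q_pos L(2)[OF z]
      by (simp add: E_def xi_eq_right xi_right_def g_eq powr_def Ln_of_real mult_ac)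
  qed
  have pw: "((\<lambda>s. (s - c) ^ m) has_field_derivative (s - c) ^ m * (of_nat m / (s - c))) (at s)" if "s - c \<noteq> 0" for c
  proof -
    have "((\<lambda>s. s - c) has_field_derivative 1) (at s)" by (auto intro!: derivative_eq_intros)
    from DERIV_power[OF this, of m] show ?thesis
      by (rule DERIV_cong) (use that in \<open>cases m; simp\<close>)
  qed
  have dL: "(L has_field_derivative deriv L s) (at s)"
    using holomorphic_derivI[OF L(1) open_halfspace_Re_gt] s by auto
  have dG: "(gamma_prod gs has_field_derivative gamma_prod gs s * digamma_sum gs s) (at s)"
    using gamma_prod_has_field_derivative[OF _ good, of s] s by simp
  have "(E has_field_derivative E s * (of_nat m / s + of_nat m / (s - 1) + deriv L s + of_real (ln Q) + digamma_sum gs s)) (at s)"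
  proof -
    have mult: "((\<lambda>z. u z * v z) has_field_derivative (u s * v s) * (a + b)) (at s)"
      if "(u has_field_derivative u s * a) (at s)" "(v has_field_derivative v s * b) (at s)" for u v a b
      by (rule DERIV_cong[OF DERIV_mult[OF that]]) (simp add: algebra_simps)
    have eL: "((\<lambda>s. exp (L s)) has_field_derivative exp (L s) * deriv L s) (at s)"
      using dL by (auto intro!: derivative_eq_intros)
    have eQ: "((\<lambda>s. exp (s * of_real (ln Q))) has_field_derivative exp (s * of_real (ln Q)) * of_real (ln Q)) (at s)"
      by (auto intro!: derivative_eq_intros)
    have p0: "((\<lambda>s. s ^ m) has_field_derivative s ^ m * (of_nat m / s)) (at s)"
      using pw[of 0] s0 by simp
    show ?thesis unfolding E_def
      using mult[OF mult[OF mult[OF mult[OF p0 pw[OF s0(2)]] eL] eQ] dG] by simp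
  qed
  moreover have "\<forall>\<^sub>F z in nhds s. \<xi> z = E z"
    using eventually_nhds_in_open[OF open_halfspace_Re_gt[of "8 / 5"], of s] s
    by (auto elim!: eventually_mono simp: xE)
  ultimately have "(\<xi> has_field_derivative E s * (of_nat m / s + of_nat m / (s - 1) + deriv L s + of_real (ln Q) + digamma_sum gs s)) (at s)"
    by (subst DERIV_cong_ev[OF refl _ refl])
  hence "deriv \<xi> s = \<xi> s * (of_nat m / s + of_nat m / (s - 1) + deriv L s + of_real (ln Q) + digamma_sum gs s)"
    using xE[OF s] by (simp add: DERIV_imp_deriv)
  thus ?thesis using xi_nonzero[of s] s by simp
qed

lemma xi_strip_zeros:
  obtains C where "strip_zeros \<xi> C (5 / 4)"
proof -
  obtain C where "\<And>s. norm (\<xi> s) \<le> exp (C * (1 + norm (s - 2)) powr (5 / 4))" using xi_growth by blast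
  hence "strip_zeros \<xi> C (5 / 4)"
    by unfold_locales (use xi_holomorphic xi_nonzero[of 2] xi_zeros_strip in auto)
  thus ?thesis using that by blast
qed

text \<open>Between s and its conjugate the real parts of m/s, m/(s - 1) and ln Q agree and cancel
  in the difference. The digamma part leaves O(1/t), and the Euler product leaves the derivative of
  a bounded function, as the general convergence theorem demands.\<close>

theorem xi_height_sum_convergent:
  assumes "strip_zeros \<xi> C (5 / 4)"
  shows "\<exists>l. (strip_zeros.height_sum \<xi> \<longlongrightarrow> l) at_top"
proof -
  interpret strip_zeros \<xi> C "5 / 4" by fact
  obtain L M where L: "L holomorphic_on {s. Re s > 8 / 5}" "\<And>s. Re s > 8 / 5 \<Longrightarrow> F s = exp (L s)"
    "\<And>s. Re s > 8 / 5 \<Longrightarrow> norm (L s) \<le> M"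
    using euler_log by metis
  have M0: "M \<ge> 0" using order_trans[OF norm_ge_zero L(3)[of 2]] by simp
  obtain K1 where K1: "K1 \<ge> 0" "\<And>t. \<bar>t\<bar> \<ge> 1 \<Longrightarrow> \<bar>Re (digamma_sum gs (2 + \<i> * of_real t))\<bar> \<le> K1 * (1 + ln \<bar>t\<bar>)"
    using digamma_sum_line_bound[OF good] by blast
  obtain K2 where K2: "K2 \<ge> 0" "\<And>t. t \<ge> 1 \<Longrightarrow>
     \<bar>Re (digamma_sum gs (2 + \<i> * of_real t)) - Re (digamma_sum gs (2 - \<i> * of_real t))\<bar> \<le> K2 / t"
    using digamma_sum_line_diff[OF good] by blast
  define c where "c = of_nat m + of_nat m + 5 * M + \<bar>ln Q\<bar>"
  have c0: "c \<ge> 0" using M0 by (simp add: c_def)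
  \<comment> \<open>Differentiating Im L(2 + i t) in t gives Re L'(2 + i t), and the conjugate point
    gives the opposite sign; so \<open>lt'\<close> is the share of the Euler product in the
    difference, and \<open>lt\<close> its bounded antiderivative.\<close>
  define lt where "lt t = Im (L (2 + \<i> * of_real t)) + Im (L (2 - \<i> * of_real t))" for t
  define lt' where "lt' t = Re (deriv L (2 + \<i> * of_real t)) - Re (deriv L (2 - \<i> * of_real t))" for t
  show ?thesis
  proof (rule height_sum_convergent)
    fix t :: real assume t: "\<bar>t\<bar> \<ge> 1"
    define s where "s = 2 + \<i> * of_real t"
    have s: "Re s = 2" by (simp add: s_def)
    have dL: "\<bar>Re (deriv L s)\<bar> \<le> 5 * M"
      using deriv_log_bound[OF L(1,3) s] abs_Re_le_cmod[of "deriv L s"] by linarith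
    have "Re (deriv \<xi> s / \<xi> s) =
      Re (of_nat m / s) + Re (of_nat m / (s - 1)) + Re (deriv L s) + ln Q + Re (digamma_sum gs s)"
      by (subst xi_logderiv[OF L(1,2)]) (use s in \<open>simp_all del: Re_divide_of_nat\<close>)
    also have "\<dots> \<le> c + K1 * (1 + ln \<bar>t\<bar>)"
      using inverse_line_bound[of s m] inverse_line_bound[of "s - 1" m] dL K1(2)[OF t] s
      unfolding c_def s_def by (simp del: Re_divide_of_nat)
    also have "\<dots> \<le> c * (1 + ln \<bar>t\<bar>) + K1 * (1 + ln \<bar>t\<bar>)"
      using t mult_left_mono[of 1 "1 + ln \<bar>t\<bar>" c] c0 by simp
    also have "\<dots> = (c + K1) * (1 + ln \<bar>t\<bar>)" by (simp add: algebra_simps)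
    finally show "Re (deriv \<xi> (2 + \<i> * of_real t) / \<xi> (2 + \<i> * of_real t)) \<le> (c + K1) * (1 + ln \<bar>t\<bar>)"
      unfolding s_def .
  next
    fix t :: real assume t: "t \<ge> 1"
    show "(lt has_real_derivative lt' t) (at t)"
    proof -
      have dL: "(L has_field_derivative deriv L z) (at z)" if "Re z = 2" for z
        using holomorphic_derivI[OF L(1) open_halfspace_Re_gt] that by auto
      have "((\<lambda>x. L (2 + \<i> * x)) has_field_derivative deriv L (2 + \<i> * of_real t) * \<i>) (at (of_real t))"
        by (rule DERIV_chain2[OF dL]) (auto intro!: derivative_eq_intros)
      from bounded_linear.has_vector_derivative[OF bounded_linear_Im has_vector_derivative_real_field[OF this]]
      have 1: "((\<lambda>x. Im (L (2 + \<i> * of_real x))) has_real_derivative Re (deriv L (2 + \<i> * of_real t))) (at t)"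
        by (simp add: has_real_derivative_iff_has_vector_derivative)
      have "((\<lambda>x. L (2 - \<i> * x)) has_field_derivative deriv L (2 - \<i> * of_real t) * (- \<i>)) (at (of_real t))"
        by (rule DERIV_chain2[OF dL]) (auto intro!: derivative_eq_intros)
      from bounded_linear.has_vector_derivative[OF bounded_linear_Im has_vector_derivative_real_field[OF this]]
      have 2: "((\<lambda>x. Im (L (2 - \<i> * of_real x))) has_real_derivative - Re (deriv L (2 - \<i> * of_real t))) (at t)"
        by (simp add: has_real_derivative_iff_has_vector_derivative)
      show ?thesis unfolding lt_def[abs_def] lt'_def using DERIV_add[OF 1 2] by simp
    qed
    have b: "\<bar>Im (L z)\<bar> \<le> M" if "Re z = 2" for z
      using L(3)[of z] abs_Im_le_cmod[of "L z"] that by simp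
    show "\<bar>lt t\<bar> \<le> max (2 * M) K2"
      using b[of "2 + \<i> * of_real t"] b[of "2 - \<i> * of_real t"] unfolding lt_def by simp
    define s where "s = 2 + \<i> * of_real t"
    have s': "2 - \<i> * of_real t = cnj s" by (simp add: s_def)
    have s: "Re s = 2" by (simp add: s_def)
    have Re_eq: "Re (of_nat m / cnj z) = Re (of_nat m / z)" for z
    proof -
      have "of_nat m / cnj z = cnj (of_nat m / z)" by simp
      thus ?thesis by (metis cnj.sel(1))
    qed
    have "Re (deriv \<xi> s / \<xi> s) - Re (deriv \<xi> (cnj s) / \<xi> (cnj s)) - (Re (deriv L s) - Re (deriv L (cnj s))) =
       Re (digamma_sum gs s) - Re (digamma_sum gs (cnj s))"
    proof -
      have "Re (of_nat m / (cnj s - 1)) = Re (of_nat m / (s - 1))" using Re_eq[of "s - 1"] by simp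
      thus ?thesis using xi_logderiv[OF L(1,2), of s] xi_logderiv[OF L(1,2), of "cnj s"] s Re_eq[of s]
        by (simp only: plus_complex.sel cnj.sel)
    qed
    moreover have "K2 / t \<le> max (2 * M) K2 / t" using t by (intro divide_right_mono) auto
    ultimately show "\<bar>Re (deriv \<xi> (2 + \<i> * of_real t) / \<xi> (2 + \<i> * of_real t)) -
        Re (deriv \<xi> (2 - \<i> * of_real t) / \<xi> (2 - \<i> * of_real t)) - lt' t\<bar> \<le> max (2 * M) K2 / t"
      using K2(2)[OF t] unfolding lt'_def s' s_def[symmetric] by linarith
  qed
qed

end

section \<open>The criterion of Bombieri and Lagarias\<close>

text \<open>A second-order Taylor estimate: the next remainder is 1 + h times the previous one plus
  n h^2. Keeping B^n explicit matters, since this rate of growth will be compared with a larger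
  base.\<close>

lemma norm_power_minus_linear:
  fixes h :: complex
  assumes "norm (1 + h) \<le> B" "B \<ge> 1"
  shows "norm ((1 + h) ^ n - 1 - of_nat n * h) \<le> real n ^ 2 * norm h ^ 2 * B ^ n"
proof (induction n)
  case (Suc n)
  have "(1 + h) ^ Suc n - 1 - of_nat (Suc n) * h = (1 + h) * ((1 + h) ^ n - 1 - of_nat n * h) + of_nat n * h ^ 2"
    by (simp add: algebra_simps power2_eq_square)
  hence "norm ((1 + h) ^ Suc n - 1 - of_nat (Suc n) * h) \<le>
      norm (1 + h) * norm ((1 + h) ^ n - 1 - of_nat n * h) + real n * norm h ^ 2"
    using norm_triangle_ineq[of "(1 + h) * ((1 + h) ^ n - 1 - of_nat n * h)" "of_nat n * h ^ 2"]
    by (simp add: norm_mult norm_power)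
  also have "\<dots> \<le> B * (real n ^ 2 * norm h ^ 2 * B ^ n) + real n * norm h ^ 2 * B ^ Suc n"
    using assms Suc one_le_power[OF assms(2), of "Suc n"]
    by (intro add_mono mult_mono mult_left_mono[of 1 _ "real n * norm h ^ 2", simplified]) auto
  also have "\<dots> = (real n ^ 2 + real n) * (norm h ^ 2 * B ^ Suc n)" by (simp add: algebra_simps)
  also have "\<dots> \<le> real (Suc n) ^ 2 * (norm h ^ 2 * B ^ Suc n)"
    using assms(2) by (intro mult_right_mono) (auto simp: power2_eq_square algebra_simps)
  finally show ?case by (simp only: mult.assoc)
qed simp

lemma cos_ge_half_near_int:
  assumes "\<bar>y - of_int p\<bar> \<le> 1 / 6"
  shows "cos (2 * pi * y) \<ge> 1 / 2"
proof -
  have "cos (2 * pi * y) = cos (2 * pi * (y - of_int p))"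
    by (simp add: right_diff_distrib cos_diff)
  also have "\<dots> = cos (2 * pi * \<bar>y - of_int p\<bar>)"
    using cos_abs_real[of "2 * pi * (y - of_int p)"] by (simp add: abs_mult)
  also have "\<dots> \<ge> cos (pi / 3)"
    using mult_left_mono[OF assms, of "2 * pi"] pi_gt_zero by (intro cos_monotone_0_pi_le) auto
  finally show ?thesis by (simp add: cos_60)
qed

text \<open>Dirichlet approximation with parameter 6 brings all angles within 1/6 of a turn of 0,
  that is within pi/3, where the cosine is at least 1/2.\<close>

lemma powers_simultaneously_near_positive:
  fixes A :: "complex set"
  assumes "finite A" "N0 \<ge> 1"
  obtains n where "n \<ge> N0" "\<And>w. w \<in> A \<Longrightarrow> Re (w ^ n) \<ge> norm w ^ n / 2"
proof -
  obtain e where e: "bij_betw e {..<card A} A"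
    using ex_bij_betw_nat_finite[OF assms(1)] by (auto simp: atLeast0LessThan)
  \<comment> \<open>Approximating N0 times the angles makes the exponent n = N0 q a multiple of N0,
    and so at least N0, whatever q is found.\<close>
  define \<theta> where "\<theta> i = real N0 * (Arg (e i) / (2 * pi))" for i
  obtain q p where q: "0 < q" "\<And>i. i < card A \<Longrightarrow> \<bar>of_int q * \<theta> i - of_int (p i)\<bar> < 1 / real 6"
    using Dirichlet_approx_simult[of 6 "card A" \<theta>] by (metis zero_less_numeral)
  define n where "n = N0 * nat q"
  have "nat q \<ge> 1" using q(1) by linarith
  hence "n \<ge> N0" by (simp add: n_def)
  moreover have "Re (w ^ n) \<ge> norm w ^ n / 2" if "w \<in> A" for w
  proof -
    have "w \<in> e ` {..<card A}" using that bij_betw_imp_surj_on[OF e] by simp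
    then obtain i where i: "i < card A" "w = e i" by (auto simp del: bij_betw_imp_surj_on)
    have "real n = real N0 * of_int q" using q(1) by (simp add: n_def)
    hence "real n * Arg w = 2 * pi * (of_int q * \<theta> i)" using i by (simp add: \<theta>_def)
    hence "cos (real n * Arg w) \<ge> 1 / 2" using cos_ge_half_near_int[of "of_int q * \<theta> i" "p i"] q(2)[OF i(1)] by simp
    hence "norm w ^ n * (1 / 2) \<le> norm w ^ n * cos (real n * Arg w)" by (intro mult_left_mono) auto
    also have "\<dots> = Re (w ^ n)"
      using DeMoivre2[of "norm w" "Arg w" n] by (simp add: rcis_cmod_Arg)
    finally show ?thesis by simp
  qed
  ultimately show ?thesis using that by blast
qed

text \<open>By reflection, nonvanishing at \<open>a\<close> also excludes the zero 1 - a, at which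
  the denominator of the Li ratio would vanish. Convergence of the height sum is assumed, which
  separates the criterion from the analysis that establishes it.\<close>

locale li_setting = strip_zeros f C \<alpha> for f C \<alpha> +
  fixes a :: real
  assumes a_less: "a < 1 / 2"
    and a_nonzero: "f (of_real a) \<noteq> 0"
    and reflect: "\<And>s. f s = 0 \<Longrightarrow> f (1 - cnj s) = 0"
    and height: "\<exists>l. (height_sum \<longlongrightarrow> l) at_top"
begin

definition li_ratio :: "complex \<Rightarrow> complex" where
  "li_ratio \<rho> = (\<rho> - of_real a) / (\<rho> + of_real a - 1)"

definition li_shift :: "complex \<Rightarrow> complex" where
  "li_shift \<rho> = of_real (1 - 2 * a) / (\<rho> - of_real (1 - a))"

definition li_partial :: "nat \<Rightarrow> real \<Rightarrow> complex" where
  "li_partial n T = (\<Sum>\<rho>\<in>zeros_below T. of_real (zmult \<rho>) * (1 - li_ratio \<rho> ^ n))"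

lemma reflect_zeros: "\<rho> \<in> zeros \<Longrightarrow> 1 - cnj \<rho> \<in> zeros"
  using reflect by (simp add: zeros_def)

lemma zero_neq: "\<rho> \<in> zeros \<Longrightarrow> \<rho> \<noteq> of_real (1 - a)"
  using reflect[of "of_real (1 - a)"] a_nonzero by (auto simp: zeros_def)

lemma li_ratio_eq: "\<rho> \<in> zeros \<Longrightarrow> li_ratio \<rho> = 1 + li_shift \<rho>"
  using zero_neq[of \<rho>] by (simp add: li_ratio_def li_shift_def field_simps)

text \<open>A ratio of modulus at most 1 means that \<rho> is at least as close to a as to 1 - a;
  the bisector of these two points is Re s = 1/2, and a < 1/2 decides the side.\<close>

lemma norm_li_ratio_le_1_iff:
  assumes "\<rho> \<in> zeros"
  shows "norm (li_ratio \<rho>) \<le> 1 \<longleftrightarrow> Re \<rho> \<le> 1 / 2"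
proof -
  have ne: "\<rho> + of_real a - 1 \<noteq> 0" using zero_neq[OF assms] by (simp add: algebra_simps)
  have "norm (li_ratio \<rho>) \<le> 1 \<longleftrightarrow> norm (\<rho> - of_real a) \<le> norm (\<rho> + of_real a - 1)"
    using ne by (simp add: li_ratio_def norm_divide)
  also have "\<dots> \<longleftrightarrow> (norm (\<rho> - of_real a))\<^sup>2 \<le> (norm (\<rho> + of_real a - 1))\<^sup>2"
    by (simp add: power2_le_iff_abs_le)
  also have "\<dots> \<longleftrightarrow> (1 - 2 * a) * (2 * Re \<rho> - 1) \<le> 0"
    unfolding cmod_power2 by (simp add: power2_eq_square algebra_simps)
  also have "\<dots> \<longleftrightarrow> Re \<rho> \<le> 1 / 2" using a_less by (auto simp: mult_le_0_iff)
  finally show ?thesis .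
qed

text \<open>Lets the centre 2 replace 1 - a in all estimates. Far zeros are handled by the triangle
  inequality; the finitely many near ones have positive distance from 1 - a, and the sum of their
  quotients serves as a crude maximum.\<close>

lemma zeros_distance:
  obtains K where "K > 0" "\<And>\<rho>. \<rho> \<in> zeros \<Longrightarrow> norm (\<rho> - 2) \<le> K * norm (\<rho> - of_real (1 - a))"
proof -
  define b where "b = complex_of_real (1 - a)"
  define Z where "Z = zeros_upto (2 * norm (b - 2))"
  define K where "K = 2 + (\<Sum>\<rho>\<in>Z. norm (\<rho> - 2) / norm (\<rho> - b))"
  have S0: "(\<Sum>\<rho>\<in>Z. norm (\<rho> - 2) / norm (\<rho> - b)) \<ge> 0" by (intro sum_nonneg) auto
  have "norm (\<rho> - 2) \<le> K * norm (\<rho> - b)" if \<rho>: "\<rho> \<in> zeros" for \<rho>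
  proof (cases "\<rho> \<in> Z")
    case True
    have nb: "norm (\<rho> - b) > 0" using zero_neq[OF \<rho>] by (simp add: b_def)
    have "norm (\<rho> - 2) / norm (\<rho> - b) \<le> (\<Sum>\<rho>\<in>Z. norm (\<rho> - 2) / norm (\<rho> - b))"
      using True by (intro member_le_sum) (auto simp: Z_def)
    hence "norm (\<rho> - 2) / norm (\<rho> - b) \<le> K" by (simp add: K_def)
    thus ?thesis using nb by (simp add: field_simps)
  next
    case False
    hence "norm (\<rho> - 2) > 2 * norm (b - 2)" using \<rho> by (auto simp: Z_def zeros_upto_def)
    moreover have "norm (\<rho> - 2) \<le> norm (\<rho> - b) + norm (b - 2)"
      using norm_triangle_ineq[of "\<rho> - b" "b - 2"] by simp
    ultimately have "norm (\<rho> - 2) \<le> 2 * norm (\<rho> - b)" by linarith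
    also have "\<dots> \<le> K * norm (\<rho> - b)" using S0 by (intro mult_right_mono) (auto simp: K_def)
    finally show ?thesis .
  qed
  moreover have "K > 0" using S0 by (simp add: K_def)
  ultimately show ?thesis using that unfolding b_def by blast
qed

text \<open>The shift itself is only O(1/|\<rho> - 2|), but its real part is quadratically small
  because Re \<rho> is bounded on the strip, and moving its pole from 1 - a to 2 costs a quadratic
  error. Quadratic terms are absolutely summable over the zeros.\<close>

lemma li_shift_bounds:
  obtains K where "K > 0" "\<And>\<rho>. \<rho> \<in> zeros \<Longrightarrow> norm (li_shift \<rho>) \<le> K / norm (\<rho> - 2)"
    "\<And>\<rho>. \<rho> \<in> zeros \<Longrightarrow> \<bar>Re (li_shift \<rho>)\<bar> \<le> K / norm (\<rho> - 2) ^ 2"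
    "\<And>\<rho>. \<rho> \<in> zeros \<Longrightarrow> norm (li_shift \<rho> - of_real (1 - 2 * a) / (\<rho> - 2)) \<le> K / norm (\<rho> - 2) ^ 2"
proof -
  define b where "b = complex_of_real (1 - a)"
  obtain K0 where K0: "K0 > 0" "\<And>\<rho>. \<rho> \<in> zeros \<Longrightarrow> norm (\<rho> - 2) \<le> K0 * norm (\<rho> - b)"
    using zeros_distance unfolding b_def by blast
  define c where "c = 1 - 2 * a"
  have c: "c > 0" using a_less by (simp add: c_def)
  define K1 where "K1 = c * K0"
  define K2 where "K2 = c * (1 + \<bar>1 - a\<bar>) * K0\<^sup>2 "
  define K3 where "K3 = c * norm (b - 2) * K0"
  define K where "K = K1 + K2 + K3"
  have nn: "K1 > 0" "K2 \<ge> 0" "K3 \<ge> 0" using c K0(1) by (auto simp: K1_def K2_def K3_def)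
  have b: "norm (li_shift \<rho>) \<le> K1 / norm (\<rho> - 2)" "\<bar>Re (li_shift \<rho>)\<bar> \<le> K2 / norm (\<rho> - 2) ^ 2"
    "norm (li_shift \<rho> - of_real c / (\<rho> - 2)) \<le> K3 / norm (\<rho> - 2) ^ 2" if \<rho>: "\<rho> \<in> zeros" for \<rho>
  proof -
    have v: "norm (\<rho> - 2) \<ge> 1" using norm_zero_ge_1[OF \<rho>] .
    have nb: "norm (\<rho> - b) > 0" using zero_neq[OF \<rho>] by (simp add: b_def)
    have inv: "1 / norm (\<rho> - b) \<le> K0 / norm (\<rho> - 2)"
    proof -
      have "0 < norm (\<rho> - 2)" using v by linarith
      thus ?thesis using K0(2)[OF \<rho>] nb by (simp add: divide_simps mult.commute)
    qed
    have ls: "li_shift \<rho> = of_real c / (\<rho> - b)" by (simp add: li_shift_def b_def c_def)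
    have "norm (li_shift \<rho>) = c * (1 / norm (\<rho> - b))" unfolding ls using c by (simp add: norm_divide)
    also have "\<dots> \<le> c * (K0 / norm (\<rho> - 2))" using inv c by (intro mult_left_mono) auto
    finally show "norm (li_shift \<rho>) \<le> K1 / norm (\<rho> - 2)" by (simp add: K1_def)
    have "\<bar>Re (li_shift \<rho>)\<bar> = c * \<bar>Re \<rho> - (1 - a)\<bar> * (1 / norm (\<rho> - b))\<^sup>2"
      unfolding ls using c by (simp add: Re_divide b_def cmod_power2 abs_mult power_divide)
    also have "\<dots> \<le> c * (1 + \<bar>1 - a\<bar>) * (K0 / norm (\<rho> - 2))\<^sup>2"
      using inv c zeros_strip[OF \<rho>] by (intro mult_mono power_mono) auto
    finally show "\<bar>Re (li_shift \<rho>)\<bar> \<le> K2 / norm (\<rho> - 2) ^ 2" by (simp add: K2_def power_divide)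
    have ne: "\<rho> - b \<noteq> 0" "\<rho> - 2 \<noteq> 0" using v nb by auto
    have "li_shift \<rho> - of_real c / (\<rho> - 2) = of_real c * (b - 2) / ((\<rho> - b) * (\<rho> - 2))"
      unfolding ls using ne by (simp add: field_simps)
    hence "norm (li_shift \<rho> - of_real c / (\<rho> - 2)) = c * norm (b - 2) / norm (\<rho> - 2) * (1 / norm (\<rho> - b))"
      using c by (simp add: norm_divide norm_mult)
    also have "\<dots> \<le> c * norm (b - 2) / norm (\<rho> - 2) * (K0 / norm (\<rho> - 2))"
      using inv c by (intro mult_left_mono) auto
    finally show "norm (li_shift \<rho> - of_real c / (\<rho> - 2)) \<le> K3 / norm (\<rho> - 2) ^ 2"
      by (simp add: K3_def power2_eq_square)
  qed
  have KK: "x / norm (\<rho> - 2) ^ k \<le> K / norm (\<rho> - 2) ^ k" if "x \<le> K" for x k \<rho>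
    using that by (intro divide_right_mono) auto
  have le: "K1 \<le> K" "K2 \<le> K" "K3 \<le> K" using nn by (auto simp: K_def)
  show ?thesis
  proof (rule that[of K])
    show "K > 0" using nn by (simp add: K_def)
    fix \<rho> assume \<rho>: "\<rho> \<in> zeros"
    show "norm (li_shift \<rho>) \<le> K / norm (\<rho> - 2)"
      using order_trans[OF b(1)[OF \<rho>] KK[OF le(1), of \<rho> 1, simplified]] .
    show "\<bar>Re (li_shift \<rho>)\<bar> \<le> K / norm (\<rho> - 2) ^ 2"
      using order_trans[OF b(2)[OF \<rho>] KK[OF le(2)]] .
    show "norm (li_shift \<rho> - of_real (1 - 2 * a) / (\<rho> - 2)) \<le> K / norm (\<rho> - 2) ^ 2"
      using order_trans[OF b(3)[OF \<rho>] KK[OF le(3)]] unfolding c_def .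
  qed
qed

lemma summable_imp_convergent_below:
  assumes "\<And>\<rho>. \<rho> \<in> zeros \<Longrightarrow> norm (g \<rho>) \<le> K / norm (\<rho> - 2) ^ 2"
  shows "\<exists>l. ((\<lambda>T. \<Sum>\<rho>\<in>zeros_below T. of_real (zmult \<rho>) * (g \<rho> :: complex)) \<longlongrightarrow> l) at_top"
proof -
  have "norm (of_real (zmult \<rho>) * g \<rho>) \<le> K * (zmult \<rho> / norm (\<rho> - 2) ^ 2)" if "\<rho> \<in> zeros" for \<rho>
    using mult_left_mono[OF assms[OF that] zmult_nonneg[OF that]] zmult_nonneg[OF that]
    by (simp add: norm_mult mult_ac)
  hence "(\<lambda>\<rho>. of_real (zmult \<rho>) * g \<rho>) summable_on zeros" by (rule summable_zeros_comparison)
  thus ?thesis using tendsto_zeros_below by blast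
qed

text \<open>The real part converges absolutely; the imaginary part is the negative of the height
  sum.\<close>

lemma inverse_sum_convergent:
  "\<exists>l. ((\<lambda>T. \<Sum>\<rho>\<in>zeros_below T. of_real (zmult \<rho>) * (1 / (\<rho> - 2))) \<longlongrightarrow> l) at_top"
proof -
  obtain h where h: "(height_sum \<longlongrightarrow> h) at_top" using height by blast
  have Re: "Re (1 / (\<rho> - 2)) = - (2 - Re \<rho>) / norm (\<rho> - 2) ^ 2" and
       Im: "Im (1 / (\<rho> - 2)) = - (Im \<rho> / norm (\<rho> - 2) ^ 2)" for \<rho>
    by (auto simp: Re_divide Im_divide cmod_power2)
  have le: "norm (complex_of_real (Re (1 / (\<rho> - 2)))) \<le> 2 / norm (\<rho> - 2) ^ 2" if "\<rho> \<in> zeros" for \<rho>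
    unfolding Re norm_of_real using zeros_strip[OF that] by (simp add: abs_mult divide_right_mono)
  obtain l where l: "((\<lambda>T. \<Sum>\<rho>\<in>zeros_below T. of_real (zmult \<rho>) * complex_of_real (Re (1 / (\<rho> - 2)))) \<longlongrightarrow> l) at_top"
    using summable_imp_convergent_below[OF le] by blast
  have "(\<Sum>\<rho>\<in>zeros_below T. of_real (zmult \<rho>) * (1 / (\<rho> - 2))) =
     (\<Sum>\<rho>\<in>zeros_below T. of_real (zmult \<rho>) * complex_of_real (Re (1 / (\<rho> - 2)))) - \<i> * of_real (height_sum T)" for T
  proof -
    have "of_real (zmult \<rho>) * (1 / (\<rho> - 2)) = of_real (zmult \<rho>) * complex_of_real (Re (1 / (\<rho> - 2)))
        - \<i> * of_real (zmult \<rho> * (Im \<rho> / norm (\<rho> - 2) ^ 2))" for \<rho>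
    proof -
      have "1 / (\<rho> - 2) = of_real (Re (1 / (\<rho> - 2))) + \<i> * of_real (Im (1 / (\<rho> - 2)))" by (rule complex_eq)
      hence "1 / (\<rho> - 2) = of_real (Re (1 / (\<rho> - 2))) - \<i> * of_real (Im \<rho> / norm (\<rho> - 2) ^ 2)"
        unfolding Im of_real_minus by (simp only: mult_minus_right add_uminus_conv_diff)
      thus ?thesis by (metis (no_types, lifting) mult.left_commute of_real_mult right_diff_distrib)
    qed
    thus ?thesis unfolding height_sum_def of_real_sum sum_distrib_left sum_subtractf[symmetric]
      by (intro sum.cong) auto
  qed
  moreover have "((\<lambda>T. (\<Sum>\<rho>\<in>zeros_below T. of_real (zmult \<rho>) * complex_of_real (Re (1 / (\<rho> - 2)))) -
     \<i> * of_real (height_sum T)) \<longlongrightarrow> l - \<i> * of_real h) at_top"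
    by (intro tendsto_intros l h)
  ultimately show ?thesis by (intro exI[of _ "l - \<i> * of_real h"]) (simp only:)
qed

lemma norm_li_ratio_bounded:
  obtains B where "B \<ge> 1" "\<And>\<rho>. \<rho> \<in> zeros \<Longrightarrow> norm (li_ratio \<rho>) \<le> B"
proof -
  obtain K where K: "K > 0" "\<And>\<rho>. \<rho> \<in> zeros \<Longrightarrow> norm (li_shift \<rho>) \<le> K / norm (\<rho> - 2)"
    using li_shift_bounds by metis
  have "norm (li_ratio \<rho>) \<le> 1 + K" if \<rho>: "\<rho> \<in> zeros" for \<rho>
  proof -
    have "K / norm (\<rho> - 2) \<le> K / 1" using K(1) norm_zero_ge_1[OF \<rho>] by (intro divide_left_mono) auto
    thus ?thesis using K(2)[OF \<rho>] norm_triangle_ineq[of 1 "li_shift \<rho>"] by (simp add: li_ratio_eq[OF \<rho>])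
  qed
  thus ?thesis using K(1) by (intro that[of "1 + K"]) auto
qed

text \<open>With h the shift, 1 - w^n = - (w^n - 1 - n h) - n (h - (1 - 2a)/(\<rho> - 2)) - n (1 -
  2a)/(\<rho> - 2). The first two terms are absolutely summable, and the last needs only the sum of
  1/(\<rho> - 2), which is the same for all n.\<close>

theorem li_partial_convergent: "\<exists>l. (li_partial n \<longlongrightarrow> l) at_top"
proof -
  obtain K where K: "K > 0" "\<And>\<rho>. \<rho> \<in> zeros \<Longrightarrow> norm (li_shift \<rho>) \<le> K / norm (\<rho> - 2)"
    "\<And>\<rho>. \<rho> \<in> zeros \<Longrightarrow> norm (li_shift \<rho> - of_real (1 - 2 * a) / (\<rho> - 2)) \<le> K / norm (\<rho> - 2) ^ 2"
    using li_shift_bounds by metis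
  obtain B where B: "B \<ge> 1" "\<And>\<rho>. \<rho> \<in> zeros \<Longrightarrow> norm (li_ratio \<rho>) \<le> B"
    using norm_li_ratio_bounded by blast
  obtain l1 where l1: "((\<lambda>T. \<Sum>\<rho>\<in>zeros_below T. of_real (zmult \<rho>) * (1 / (\<rho> - 2))) \<longlongrightarrow> l1) at_top"
    using inverse_sum_convergent by blast
  obtain l2 where l2: "((\<lambda>T. \<Sum>\<rho>\<in>zeros_below T. of_real (zmult \<rho>) *
      (li_shift \<rho> - of_real (1 - 2 * a) / (\<rho> - 2))) \<longlongrightarrow> l2) at_top"
    using summable_imp_convergent_below[OF K(3)] by blast
  have "norm (li_ratio \<rho> ^ n - 1 - of_nat n * li_shift \<rho>) \<le> (real n ^ 2 * K\<^sup>2 * B ^ n) / norm (\<rho> - 2) ^ 2"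
    if \<rho>: "\<rho> \<in> zeros" for \<rho>
  proof -
    have "norm (li_ratio \<rho> ^ n - 1 - of_nat n * li_shift \<rho>) \<le> real n ^ 2 * norm (li_shift \<rho>) ^ 2 * B ^ n"
      using norm_power_minus_linear[of "li_shift \<rho>" B n] B(1) B(2)[OF \<rho>] by (simp add: li_ratio_eq[OF \<rho>])
    also have "\<dots> \<le> real n ^ 2 * (K / norm (\<rho> - 2)) ^ 2 * B ^ n"
      using K(2)[OF \<rho>] B(1) by (intro mult_right_mono mult_left_mono power_mono) auto
    finally show ?thesis by (simp add: power_divide)
  qed
  from summable_imp_convergent_below[OF this] obtain l3 where
    l3: "((\<lambda>T. \<Sum>\<rho>\<in>zeros_below T. of_real (zmult \<rho>) * (li_ratio \<rho> ^ n - 1 - of_nat n * li_shift \<rho>)) \<longlongrightarrow> l3) at_top"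
    by blast
  have eq: "li_partial n = (\<lambda>T. - (\<Sum>\<rho>\<in>zeros_below T. of_real (zmult \<rho>) * (li_ratio \<rho> ^ n - 1 - of_nat n * li_shift \<rho>))
     - of_nat n * ((\<Sum>\<rho>\<in>zeros_below T. of_real (zmult \<rho>) * (li_shift \<rho> - of_real (1 - 2 * a) / (\<rho> - 2)))
       + of_real (1 - 2 * a) * (\<Sum>\<rho>\<in>zeros_below T. of_real (zmult \<rho>) * (1 / (\<rho> - 2)))))"
    unfolding fun_eq_iff li_partial_def sum_distrib_left sum_subtractf[symmetric] sum.distrib[symmetric] sum_negf[symmetric]
    by (intro allI sum.cong refl) (simp add: algebra_simps)
  show ?thesis unfolding eq
    by (intro exI[of _ "- l3 - of_nat n * (l2 + of_real (1 - 2 * a) * l1)"] tendsto_intros l1 l2 l3)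
qed

lemma Re_li_partial: "Re (li_partial n T) = (\<Sum>\<rho>\<in>zeros_below T. zmult \<rho> * (1 - Re (li_ratio \<rho> ^ n)))"
  by (simp add: li_partial_def)

lemma Re_li_limit_nonneg:
  assumes crit: "\<And>\<rho>. \<rho> \<in> zeros \<Longrightarrow> Re \<rho> = 1 / 2" and l: "(li_partial n \<longlongrightarrow> l) at_top"
  shows "Re l \<ge> 0"
proof (rule tendsto_lowerbound[OF tendsto_Re[OF l]])
  have "Re (li_partial n T) \<ge> 0" for T
    unfolding Re_li_partial
  proof (intro sum_nonneg mult_nonneg_nonneg)
    fix \<rho> assume "\<rho> \<in> zeros_below T"
    hence \<rho>: "\<rho> \<in> zeros" using zeros_below_subset by blast
    show "zmult \<rho> \<ge> 0" by (rule zmult_nonneg[OF \<rho>])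
    have "norm (li_ratio \<rho> ^ n) \<le> 1"
      using norm_li_ratio_le_1_iff[OF \<rho>] crit[OF \<rho>] by (simp add: norm_power power_le_one)
    thus "1 - Re (li_ratio \<rho> ^ n) \<ge> 0" using complex_Re_le_cmod[of "li_ratio \<rho> ^ n"] by linarith
  qed
  thus "eventually (\<lambda>T. 0 \<le> Re (li_partial n T)) at_top" by simp
qed simp

lemma finite_large_ratio:
  assumes "r > 1"
  shows "finite {\<rho> \<in> zeros. norm (li_ratio \<rho>) \<ge> r}"
proof -
  obtain K where K: "K > 0" "\<And>\<rho>. \<rho> \<in> zeros \<Longrightarrow> norm (li_shift \<rho>) \<le> K / norm (\<rho> - 2)"
    using li_shift_bounds by metis
  have "{\<rho> \<in> zeros. norm (li_ratio \<rho>) \<ge> r} \<subseteq> zeros_upto (K / (r - 1))"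
  proof
    fix \<rho> assume "\<rho> \<in> {\<rho> \<in> zeros. norm (li_ratio \<rho>) \<ge> r}"
    hence \<rho>: "\<rho> \<in> zeros" "norm (li_ratio \<rho>) \<ge> r" by auto
    have "r \<le> 1 + K / norm (\<rho> - 2)"
      using \<rho>(2) K(2)[OF \<rho>(1)] norm_triangle_ineq[of 1 "li_shift \<rho>"] by (simp add: li_ratio_eq[OF \<rho>(1)])
    hence "(r - 1) * norm (\<rho> - 2) \<le> K / norm (\<rho> - 2) * norm (\<rho> - 2)"
      by (intro mult_right_mono) auto
    also have "\<dots> = K" using norm_zero_ge_1[OF \<rho>(1)] by (subst nonzero_eq_divide_eq[symmetric]) auto
    finally have "norm (\<rho> - 2) \<le> K / (r - 1)" using assms by (simp add: field_simps)
    thus "\<rho> \<in> zeros_upto (K / (r - 1))" using \<rho>(1) by (simp add: zeros_upto_def)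
  qed
  thus ?thesis using finite_subset by blast
qed

text \<open>For each r > 1 only finitely many zeros have a ratio of modulus at least r, so there is
  a maximum M and a gap below it.\<close>

lemma dominant_ratio:
  assumes "\<rho>1 \<in> zeros" "norm (li_ratio \<rho>1) > 1"
  obtains M t where "M > 1" "1 \<le> t" "t < M" "finite {\<rho> \<in> zeros. norm (li_ratio \<rho>) = M}"
    "{\<rho> \<in> zeros. norm (li_ratio \<rho>) = M} \<noteq> {}"
    "\<And>\<rho>. \<rho> \<in> zeros \<Longrightarrow> norm (li_ratio \<rho>) \<noteq> M \<Longrightarrow> norm (li_ratio \<rho>) \<le> t"
proof -
  define X where "X = {\<rho> \<in> zeros. norm (li_ratio \<rho>) \<ge> norm (li_ratio \<rho>1)}"
  define M where "M = Max ((\<lambda>\<rho>. norm (li_ratio \<rho>)) ` X)"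
  have X: "finite X" "\<rho>1 \<in> X" using finite_large_ratio[OF assms(2)] assms(1) by (auto simp: X_def)
  have M1: "M \<ge> norm (li_ratio \<rho>1)" unfolding M_def using X by (intro Max_ge) auto
  have M_max: "norm (li_ratio \<rho>) \<le> M" if "\<rho> \<in> zeros" for \<rho>
  proof (cases "\<rho> \<in> X")
    case True
    thus ?thesis unfolding M_def using X by (intro Max_ge) auto
  next
    case False
    thus ?thesis using that M1 by (simp add: X_def)
  qed
  have "M \<in> (\<lambda>\<rho>. norm (li_ratio \<rho>)) ` X" unfolding M_def using X by (intro Max_in) auto
  hence ne: "{\<rho> \<in> zeros. norm (li_ratio \<rho>) = M} \<noteq> {}" by (auto simp: X_def)
  have gt: "M > 1" using M1 assms(2) by simp
  have fin: "finite {\<rho> \<in> zeros. norm (li_ratio \<rho>) = M}"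
    by (rule finite_subset[OF _ finite_large_ratio[OF gt]]) auto
  \<comment> \<open>A threshold strictly between 1 and M; it keeps t >= 1 even if no other ratio
    exceeds 1 in modulus.\<close>
  define r where "r = (1 + M) / 2"
  have r: "1 < r" "r < M" using gt by (auto simp: r_def)
  define Y where "Y = {\<rho> \<in> zeros. norm (li_ratio \<rho>) \<ge> r \<and> norm (li_ratio \<rho>) \<noteq> M}"
  have Y: "finite Y" by (rule finite_subset[OF _ finite_large_ratio[OF r(1)]]) (auto simp: Y_def)
  define t where "t = Max (insert r ((\<lambda>\<rho>. norm (li_ratio \<rho>)) ` Y))"
  have "t \<in> insert r ((\<lambda>\<rho>. norm (li_ratio \<rho>)) ` Y)" unfolding t_def using Y by (intro Max_in) auto
  hence "t < M" using r M_max by (fastforce simp: Y_def)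
  moreover have tr: "r \<le> t" unfolding t_def using Y by (intro Max_ge) auto
  moreover have "norm (li_ratio \<rho>) \<le> t" if "\<rho> \<in> zeros" "norm (li_ratio \<rho>) \<noteq> M" for \<rho>
  proof (cases "\<rho> \<in> Y")
    case True
    thus ?thesis unfolding t_def using Y by (intro Max_ge) auto
  next
    case False
    thus ?thesis using that tr by (simp add: Y_def)
  qed
  ultimately show ?thesis using that[of M t] gt ne fin r by simp
qed

text \<open>Along exponents \<open>n\<close> for which all ratios of maximal modulus \<open>M > 1\<close> have powers close to the
  positive axis, the sum is at most \<open>O(1) - c M\<^sup>n + O(n\<^sup>2 t\<^sup>n)\<close> with \<open>t < M\<close>.\<close>
lemma Re_li_limit_negative:
  assumes \<rho>1: "\<rho>1 \<in> zeros" "norm (li_ratio \<rho>1) > 1"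
  obtains n where "n \<ge> 1" "\<And>l. (li_partial n \<longlongrightarrow> l) at_top \<Longrightarrow> Re l < 0"
proof -
  obtain M t where M: "M > 1" "1 \<le> t" "t < M" and AM: "finite {\<rho> \<in> zeros. norm (li_ratio \<rho>) = M}"
    "{\<rho> \<in> zeros. norm (li_ratio \<rho>) = M} \<noteq> {}"
    and others: "\<And>\<rho>. \<rho> \<in> zeros \<Longrightarrow> norm (li_ratio \<rho>) \<noteq> M \<Longrightarrow> norm (li_ratio \<rho>) \<le> t"
    by (rule dominant_ratio[OF \<rho>1]) (rule that)
  define A where "A = {\<rho> \<in> zeros. norm (li_ratio \<rho>) = M}"
  have A: "finite A" "A \<noteq> {}" "A \<subseteq> zeros" using AM by (auto simp: A_def)
  obtain K where K: "K > 0" "\<And>\<rho>. \<rho> \<in> zeros \<Longrightarrow> norm (li_shift \<rho>) \<le> K / norm (\<rho> - 2)"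
    "\<And>\<rho>. \<rho> \<in> zeros \<Longrightarrow> \<bar>Re (li_shift \<rho>)\<bar> \<le> K / norm (\<rho> - 2) ^ 2"
    using li_shift_bounds by metis
  obtain S where S: "\<And>X. finite X \<Longrightarrow> X \<subseteq> zeros \<Longrightarrow> (\<Sum>\<rho>\<in>X. zmult \<rho> * norm (\<rho> - 2) powr (- 3 / 2)) \<le> S"
    using zero_sum_bound by blast
  define mA where "mA = (\<Sum>\<rho>\<in>A. zmult \<rho>)"
  have mA: "mA > 0" unfolding mA_def using A zmult_pos by (intro sum_pos) auto
  \<comment> \<open>K bounds the linear term through the real part of the shift, K^2 the quadratic
    remainder, and S the total weight of the zeros.\<close>
  define D where "D = (K + K\<^sup>2) * S"
  have "((\<lambda>n. (mA + D * (real n ^ 2 * t ^ n)) / M ^ n) \<longlonglongrightarrow> 0)"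
  proof -
    have l1: "(\<lambda>n. real n ^ 2 * (t / M) ^ n) \<longlonglongrightarrow> 0"
    proof -
      have "(\<lambda>n. real n ^ 2 * r ^ n) \<longlonglongrightarrow> 0" if "r > 0" "r < 1" for r :: real
        using that by real_asymp
      moreover have "t / M < 1" "t / M > 0" using M by auto
      ultimately show ?thesis by blast
    qed
    have l2: "(\<lambda>n. (1 / M) ^ n) \<longlonglongrightarrow> 0" using M by (intro LIMSEQ_realpow_zero) auto
    have "(\<lambda>n. mA * (1 / M) ^ n + D * (real n ^ 2 * (t / M) ^ n)) \<longlonglongrightarrow> mA * 0 + D * 0"
      by (intro tendsto_add tendsto_mult tendsto_const l1 l2)
    thus ?thesis by (simp add: add_divide_distrib power_divide)
  qed
  hence "eventually (\<lambda>n. (mA + D * (real n ^ 2 * t ^ n)) / M ^ n < mA / 2) sequentially"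
    using mA by (intro order_tendstoD(2)) auto
  then obtain N0 where N0: "\<And>n. n \<ge> N0 \<Longrightarrow> (mA + D * (real n ^ 2 * t ^ n)) / M ^ n < mA / 2"
    by (auto simp: eventually_sequentially)
  obtain n where n: "n \<ge> max N0 1" "\<And>w. w \<in> li_ratio ` A \<Longrightarrow> Re (w ^ n) \<ge> norm w ^ n / 2"
    using powers_simultaneously_near_positive[of "li_ratio ` A" "max N0 1"] A(1) by auto
  have neg: "mA + D * (real n ^ 2 * t ^ n) - mA / 2 * M ^ n < 0"
  proof -
    have "(mA + D * (real n ^ 2 * t ^ n)) / M ^ n < mA / 2" using N0 n(1) by simp
    thus ?thesis using M by (simp add: divide_less_eq)
  qed
  have "Re l \<le> mA + D * (real n ^ 2 * t ^ n) - mA / 2 * M ^ n" if l: "(li_partial n \<longlongrightarrow> l) at_top" for l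
  proof (rule tendsto_upperbound[OF tendsto_Re[OF l]])
    define T0 where "T0 = Max ((\<lambda>\<rho>. \<bar>Im \<rho>\<bar>) ` A)"
    have T0: "\<bar>Im \<rho>\<bar> \<le> T0" if "\<rho> \<in> A" for \<rho> unfolding T0_def using that A(1) by (intro Max_ge) auto
    show "eventually (\<lambda>T. Re (li_partial n T) \<le> mA + D * (real n ^ 2 * t ^ n) - mA / 2 * M ^ n) at_top"
      using eventually_ge_at_top[of T0]
    proof eventually_elim
      case (elim T)
      have sub: "A \<subseteq> zeros_below T" using A(3) T0 elim by (force simp: zeros_below_def)
      define Y where "Y = zeros_below T - A"
      have Y: "finite Y" "Y \<subseteq> zeros" using zeros_below_subset by (auto simp: Y_def)
      have "Re (li_partial n T) = (\<Sum>\<rho>\<in>Y. zmult \<rho> * (1 - Re (li_ratio \<rho> ^ n))) + (\<Sum>\<rho>\<in>A. zmult \<rho> * (1 - Re (li_ratio \<rho> ^ n)))"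
        unfolding Re_li_partial Y_def by (rule sum.subset_diff[OF sub]) simp
      also have "(\<Sum>\<rho>\<in>A. zmult \<rho> * (1 - Re (li_ratio \<rho> ^ n))) \<le> (\<Sum>\<rho>\<in>A. zmult \<rho> * (1 - M ^ n / 2))"
      proof (intro sum_mono mult_left_mono)
        fix \<rho> assume \<rho>: "\<rho> \<in> A"
        have "norm (li_ratio \<rho>) = M" using \<rho> by (simp add: A_def)
        thus "1 - Re (li_ratio \<rho> ^ n) \<le> 1 - M ^ n / 2" using n(2)[of "li_ratio \<rho>"] \<rho> by simp
        show "zmult \<rho> \<ge> 0" using \<rho> A(3) zmult_nonneg by blast
      qed
      also have "\<dots> = mA * (1 - M ^ n / 2)" unfolding mA_def by (simp only: sum_distrib_right)
      also have "\<dots> = mA - mA / 2 * M ^ n" by (simp add: algebra_simps)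
      also have "(\<Sum>\<rho>\<in>Y. zmult \<rho> * (1 - Re (li_ratio \<rho> ^ n))) \<le>
         (\<Sum>\<rho>\<in>Y. (K + K\<^sup>2) * (real n ^ 2 * t ^ n) * (zmult \<rho> * norm (\<rho> - 2) powr (- 3 / 2)))"
      proof (rule sum_mono)
        fix \<rho> assume "\<rho> \<in> Y"
        hence \<rho>: "\<rho> \<in> zeros" "norm (li_ratio \<rho>) \<noteq> M" using Y by (auto simp: Y_def A_def)
        have v: "norm (\<rho> - 2) \<ge> 1" using norm_zero_ge_1[OF \<rho>(1)] .
        define p where "p = real n ^ 2 * t ^ n"
        have t1: "t ^ n \<ge> 1" using M by simp
        have n1: "real n \<ge> 1" using n(1) by simp
        have "real n * 1 \<le> real n * real n * t ^ n"
          unfolding mult.assoc using n1 t1 mult_mono[of 1 "real n" 1 "t ^ n"] by (intro mult_left_mono) auto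
        hence np: "real n \<le> p" by (simp add: p_def power2_eq_square)
        have "norm (li_ratio \<rho> ^ n - 1 - of_nat n * li_shift \<rho>) \<le> real n ^ 2 * norm (li_shift \<rho>) ^ 2 * t ^ n"
          using norm_power_minus_linear[of "li_shift \<rho>" t n] M(2) others[OF \<rho>] by (simp add: li_ratio_eq[OF \<rho>(1)])
        also have "\<dots> = p * norm (li_shift \<rho>) ^ 2" by (simp add: p_def)
        also have "\<dots> \<le> p * (K / norm (\<rho> - 2)) ^ 2"
          using K(2)[OF \<rho>(1)] np n1 by (intro mult_left_mono power_mono) auto
        finally have e1: "norm (li_ratio \<rho> ^ n - 1 - of_nat n * li_shift \<rho>) \<le> p * (K\<^sup>2 / norm (\<rho> - 2) ^ 2)"
          by (simp add: power_divide)
        have e2: "real n * \<bar>Re (li_shift \<rho>)\<bar> \<le> p * (K / norm (\<rho> - 2) ^ 2)"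
          using K(3)[OF \<rho>(1)] np n1 by (intro mult_mono) auto
        \<comment> \<open>Only the real part of the linear term enters, so no cancellation between
          zeros is needed and the bound is uniform in T.\<close>
        have "1 - Re (li_ratio \<rho> ^ n) = - Re (li_ratio \<rho> ^ n - 1 - of_nat n * li_shift \<rho>) - real n * Re (li_shift \<rho>)"
          by simp
        also have "\<dots> \<le> norm (li_ratio \<rho> ^ n - 1 - of_nat n * li_shift \<rho>) + real n * \<bar>Re (li_shift \<rho>)\<bar>"
        proof -
          have "- (real n * Re (li_shift \<rho>)) \<le> real n * \<bar>Re (li_shift \<rho>)\<bar>"
            using mult_left_mono[of "- Re (li_shift \<rho>)" "\<bar>Re (li_shift \<rho>)\<bar>" "real n"] by simp
          thus ?thesis using abs_Re_le_cmod[of "li_ratio \<rho> ^ n - 1 - of_nat n * li_shift \<rho>"] by linarith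
        qed
        also have "\<dots> \<le> p * (K\<^sup>2 / norm (\<rho> - 2) ^ 2) + p * (K / norm (\<rho> - 2) ^ 2)" using e1 e2 by linarith
        also have "\<dots> = (K + K\<^sup>2) * p * norm (\<rho> - 2) powr (- 2)"
          using v by (simp add: powr_minus_divide algebra_simps add_divide_distrib)
        also have "\<dots> \<le> (K + K\<^sup>2) * p * norm (\<rho> - 2) powr (- 3 / 2)"
          using v K(1) np n1 by (intro mult_left_mono powr_mono) auto
        finally have "zmult \<rho> * (1 - Re (li_ratio \<rho> ^ n)) \<le> zmult \<rho> * ((K + K\<^sup>2) * p * norm (\<rho> - 2) powr (- 3 / 2))"
          using zmult_nonneg[OF \<rho>(1)] by (intro mult_left_mono)
        thus "zmult \<rho> * (1 - Re (li_ratio \<rho> ^ n)) \<le>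
          (K + K\<^sup>2) * (real n ^ 2 * t ^ n) * (zmult \<rho> * norm (\<rho> - 2) powr (- 3 / 2))"
          by (simp add: p_def mult_ac)
      qed
      also have "\<dots> = (K + K\<^sup>2) * (real n ^ 2 * t ^ n) * (\<Sum>\<rho>\<in>Y. zmult \<rho> * norm (\<rho> - 2) powr (- 3 / 2))"
        by (simp add: sum_distrib_left)
      also have "\<dots> \<le> (K + K\<^sup>2) * (real n ^ 2 * t ^ n) * S"
        using K(1) M by (intro mult_left_mono S Y) auto
      also have "\<dots> = D * (real n ^ 2 * t ^ n)" by (simp add: D_def)
      finally show ?case by simp
    qed
  qed simp
  thus ?thesis using that[of n] n(1) neg by force
qed

theorem li_criterion:
  "(\<forall>\<rho>\<in>zeros. Re \<rho> = 1 / 2) \<longleftrightarrow> (\<forall>n\<ge>1. Re (Lim at_top (li_partial n)) \<ge> 0)"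
proof -
  \<comment> \<open>\<open>Lim\<close> is a definite description; it is known to denote the limit
    only because convergence has been proved for every n.\<close>
  have lim: "(li_partial n \<longlongrightarrow> Lim at_top (li_partial n)) at_top" for n
    using li_partial_convergent[of n] tendsto_Lim[OF trivial_limit_at_top_linorder] by metis
  show ?thesis
  proof
    assume "\<forall>\<rho>\<in>zeros. Re \<rho> = 1 / 2"
    thus "\<forall>n\<ge>1. Re (Lim at_top (li_partial n)) \<ge> 0" using Re_li_limit_nonneg[OF _ lim] by blast
  next
    assume nonneg: "\<forall>n\<ge>1. Re (Lim at_top (li_partial n)) \<ge> 0"
    have le: "Re \<rho> \<le> 1 / 2" if \<rho>: "\<rho> \<in> zeros" for \<rho>
    proof (rule ccontr)
      assume "\<not> Re \<rho> \<le> 1 / 2"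
      hence "norm (li_ratio \<rho>) > 1" using norm_li_ratio_le_1_iff[OF \<rho>] by simp
      then obtain n where "n \<ge> 1" "Re (Lim at_top (li_partial n)) < 0"
        using Re_li_limit_negative[OF \<rho>] lim by metis
      thus False using nonneg by (meson not_le)
    qed
    show "\<forall>\<rho>\<in>zeros. Re \<rho> = 1 / 2"
    proof
      fix \<rho> assume "\<rho> \<in> zeros"
      \<comment> \<open>The reflected zero has real part 1 - Re \<rho>, so the inequality for it is
        the reverse bound for \<rho>.\<close>
      thus "Re \<rho> = 1 / 2" using le[of \<rho>] le[OF reflect_zeros[of \<rho>]] by simp
    qed
  qed
qed

end

theorem theorem5:
  fixes a :: real and F :: "complex \<Rightarrow> complex"
    and Q :: real and gs :: "(real \<times> complex) list" and \<omega> :: complex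
  assumes "a < 1 / 2"
    and "F \<in> selberg_class_tilde"
    and "functional_equation F Q gs \<omega>"
    and "complex_of_real a \<notin> nontrivial_zeros F Q gs"
  shows "(\<forall>\<rho> \<in> nontrivial_zeros F Q gs. Re \<rho> = 1 / 2) \<longleftrightarrow>
         (\<forall>n::nat. n \<ge> 1 \<longrightarrow> Re (li_coeff F Q gs n a) \<ge> 0)"
proof -
  have F: "F \<in> selberg_class" using assms(2) by (simp add: selberg_class_tilde_def)
  then obtain b where b: "euler_coeffs F b" by (auto simp: selberg_class_def)
  have "\<exists>m. clears_pole F m" using F by (simp add: selberg_class_def)
  hence "clears_pole F (pole_order_at_1 F)" unfolding pole_order_at_1_def by (rule LeastI_ex)
  then obtain g where g: "entire_of_finite_order g" "\<And>s. s \<noteq> 1 \<Longrightarrow> g s = (s - 1) ^ pole_order_at_1 F * F s"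
    by (auto simp: clears_pole_def)
  interpret selberg_xi F Q gs \<omega> b g by unfold_locales (fact assms(3) b g)+
  obtain C where C: "strip_zeros (xi_fun F Q gs) C (5 / 4)" using xi_strip_zeros by blast
  interpret Z: strip_zeros "xi_fun F Q gs" C "5 / 4" by fact
  have reflect: "xi_fun F Q gs (1 - cnj s) = 0" if "xi_fun F Q gs s = 0" for s
    using norm_xi_reflect[of s] that by simp
  interpret Z: li_setting "xi_fun F Q gs" C "5 / 4" a
    by unfold_locales
      (use assms(1,4) reflect xi_height_sum_convergent[OF C] in \<open>auto simp: nontrivial_zeros_def\<close>)
  have zeros: "nontrivial_zeros F Q gs = Z.zeros"
    by (simp add: nontrivial_zeros_def Z.zeros_def)
  have "li_coeff F Q gs n a = Lim at_top (Z.li_partial n)" for n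
    unfolding li_coeff_def Z.li_partial_def[abs_def] zeros Z.zeros_below_def Z.zmult_def Z.li_ratio_def
    by (simp only: of_real_of_int_eq)
  thus ?thesis unfolding zeros using Z.li_criterion by simp
qed

end
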